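(* Let $f:\mathbb{N}\to\mathbb{N}$ be a function. Then $f\in\mathcal{F}$ (i.e. $f$ is a tile counting function) if and only if there exist an integer $k\ge 1$ and an $\mathbb{N}$-rational generating function $F\in\mathcal{R}_k$ such that $$f(n)=\bigl[x_1^{n}x_2^{n}\cdots x_k^{n}\bigr]\,F(x_1,\ldots,x_k)\qquad\text{for all } n\in\mathbb{N}.$$
   Context: $\mathbb{N}=\{0,1,2,\ldots\}$. Tile counting functions: A tile is an axis-parallel simply connected closed polygon in $\mathbb{R}^2$ (side lengths may be irrational); tiles are considered up to translation. A tile is tall if it has height exactly $1$. For real $a\ge 0$ let $R_a=[1\times a]$ be the rectangle of height $1$ and length $a$. A tiling of $R_a$ with a finite set of tiles $T$ is a collection of translates of tiles of $T$ (no rotations or reflections) with pairwise disjoint interiors whose union is $R_a$ (for $a=0$ the only tiling is the empty one). For a finite set $T$ of tall tiles and a fixed real $\varepsilon\ge 0$, let $f_{T,\varepsilon}(n)$ be the number of tilings of $R_{n+\varepsilon}$ with $T$, $n\in\mathbb{N}$. $\mathcal{F}$ denotes the set of all functions $f_{T,\varepsilon}:\mathbb{N}\to\mathbb{N}$ obtained in this way. $\mathbb{N}$-rational functions: $\mathcal{R}_k$ is the smallest class of formal power series in $\mathbb{N}[[x_1,\ldots,x_k]]$ such that (1) $0,x_1,\ldots,x_k\in\mathcal{R}_k$; (2) if $F,G\in\mathcal{R}_k$ then $F+G\in\mathcal{R}_k$ and $F\cdot G\in\mathcal{R}_k$; (3) if $F\in\mathcal{R}_k$ has constant term $0$, then $\frac{1}{1-F}\in\mathcal{R}_k$.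 $[x_1^{c_1}\cdots x_k^{c_k}]\,F$ denotes the coefficient of $x_1^{c_1}\cdots x_k^{c_k}$ in $F$. *)

theory Defs
  imports "HOL-Analysis.Analysis" "HOL-Library.Poly_Mapping"
begin

subsection \<open>Tiles and tile counting functions\<close>

(* A closed axis-parallel polygon is a nonempty finite union of nondegenerate closed
   axis-parallel rectangles, not necessarily disjoint, with connected interior.  The
   interior condition excludes, e.g., two squares meeting only in a corner.  The polygons
   that are also simply connected are exactly the closed regions bounded by a simple
   closed curve made of finitely many horizontal and vertical segments. *)
definition axis_parallel_polygon :: "(real \<times> real) set \<Rightarrow> bool" where
  "axis_parallel_polygon S \<longleftrightarrow>
     (\<exists>B. finite B \<and> B \<noteq> {} \<and>
          (\<forall>R\<in>B. \<exists>a b c d. a < b \<and> c < d \<and> R = {a..b} \<times> {c..d}) \<and>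
          S = \<Union>B) \<and>
     connected (interior S)"

definition tile :: "(real \<times> real) set \<Rightarrow> bool" where
  "tile S \<longleftrightarrow> axis_parallel_polygon S \<and> simply_connected S"

definition height :: "(real \<times> real) set \<Rightarrow> real" where
  "height S = Sup (snd ` S) - Inf (snd ` S)"

definition tall_tile :: "(real \<times> real) set \<Rightarrow> bool" where
  "tall_tile S \<longleftrightarrow> tile S \<and> height S = 1"

(* Length is measured along the first coordinate, height along the second. *)
definition rect :: "real \<Rightarrow> (real \<times> real) set" where
  "rect a = {0..a} \<times> {0..1}"

(* The degenerate rectangle of length 0 has exactly one tiling, the empty one, by
   convention: as a point set it is a segment, which the empty family does not cover.
   A tiling is the set of its pieces, so two members of T that are translates of each
   other count as one tile. *)
definition tiling :: "(real \<times> real) set set \<Rightarrow> real \<Rightarrow> (real \<times> real) set set \<Rightarrow> bool" where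
  "tiling T a \<P> \<longleftrightarrow>
     (if a = 0 then \<P> = {}
      else (\<forall>P\<in>\<P>. \<exists>t\<in>T. \<exists>v. P = (+) v ` t) \<and>
           pairwise (\<lambda>P Q. interior P \<inter> interior Q = {}) \<P> \<and>
           \<Union>\<P> = rect a)"

(* For a finite set T of tall tiles there are only finitely many tilings of a given
   rectangle, so card is the true count. *)
definition tile_count :: "(real \<times> real) set set \<Rightarrow> real \<Rightarrow> nat \<Rightarrow> nat" where
  "tile_count T \<epsilon> n = card {\<P>. tiling T (real n + \<epsilon>) \<P>}"

definition tile_counting_functions :: "(nat \<Rightarrow> nat) set" where
  "tile_counting_functions =
     {tile_count T \<epsilon> | T \<epsilon>. finite T \<and> (\<forall>t\<in>T. tall_tile t) \<and> 0 \<le> \<epsilon>}"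


subsection \<open>Multivariate formal power series and N-rational series\<close>

(* A power series is its coefficient function.  A monomial in the variables x_1, x_2, ...
   is the finitely supported map sending i to the exponent of x_i. *)
type_synonym 'a mps = "(nat \<Rightarrow>\<^sub>0 nat) \<Rightarrow> 'a"

definition mps_one :: "'a::comm_semiring_1 mps" where
  "mps_one m = (if m = 0 then 1 else 0)"

definition mps_var :: "nat \<Rightarrow> 'a::comm_semiring_1 mps" where
  "mps_var i m = (if m = Poly_Mapping.single i 1 then 1 else 0)"

definition mps_mult :: "'a::comm_semiring_1 mps \<Rightarrow> 'a mps \<Rightarrow> 'a mps" where
  "mps_mult F G m = (\<Sum>(p, q)\<in>{(p, q). p + q = m}. F p * G q)"

lemma finite_mps_mult_index: "finite {(p, q). p + q = (m :: nat \<Rightarrow>\<^sub>0 nat)}"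
proof -
  let ?D = "{p. \<exists>q. p + q = m}"
  let ?K = "Poly_Mapping.keys m"
  let ?M = "Max (Poly_Mapping.lookup m ` ?K)"
  let ?L = "{g. \<forall>i. (i \<in> ?K \<longrightarrow> g i \<in> {..?M}) \<and> (i \<notin> ?K \<longrightarrow> g i = (0::nat))}"
  have "Poly_Mapping.lookup p \<in> ?L" if pq: "p + q = m" for p q
  proof -
    have le: "Poly_Mapping.lookup p i \<le> Poly_Mapping.lookup m i" for i
      using pq by (auto simp: lookup_add)
    have "Poly_Mapping.lookup p i \<le> ?M" if "i \<in> ?K" for i
      by (rule order_trans[OF le]) (rule Max_ge, use that in auto)
    moreover have "Poly_Mapping.lookup p i = 0" if "i \<notin> ?K" for i
      using le[of i] that by (simp only: not_in_keys_iff_lookup_eq_zero le_zero_eq)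
    ultimately show ?thesis by blast
  qed
  then have "Poly_Mapping.lookup p \<in> ?L" if "p \<in> ?D" for p
    using that by (elim CollectE exE) assumption
  then have "Poly_Mapping.lookup ` ?D \<subseteq> ?L"
    by (rule image_subsetI)
  moreover have "finite ?L"
    by (rule finite_set_of_finite_funs) auto
  ultimately have "finite (Poly_Mapping.lookup ` ?D)" by (rule finite_subset)
  then have "finite ?D"
    by (rule finite_imageD) (auto simp: inj_on_def)
  moreover have "{(p, q). p + q = m} \<subseteq> (\<lambda>p. (p, m - p)) ` ?D"
    by auto
  ultimately show ?thesis
    by (meson finite_imageI finite_subset)
qed

(* In the last rule G is the series 1 / (1 - F).  As 1 - F need not have coefficients in
   the natural numbers, the equation (1 - F) * G = 1 is stated over the integers; it has
   exactly one solution G there, whose coefficients are nonnegative. *)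
inductive_set N_rational :: "nat \<Rightarrow> nat mps set" for k :: nat where
  zero: "(\<lambda>m. 0) \<in> N_rational k"
| var: "i \<in> {1..k} \<Longrightarrow> mps_var i \<in> N_rational k"
| add: "F \<in> N_rational k \<Longrightarrow> G \<in> N_rational k \<Longrightarrow> (\<lambda>m. F m + G m) \<in> N_rational k"
| mult: "F \<in> N_rational k \<Longrightarrow> G \<in> N_rational k \<Longrightarrow> mps_mult F G \<in> N_rational k"
| inverse: "F \<in> N_rational k \<Longrightarrow> F 0 = 0 \<Longrightarrow>
    mps_mult (\<lambda>m. mps_one m - int (F m)) (\<lambda>m. int (G m)) = mps_one \<Longrightarrow>
    G \<in> N_rational k"

(* The monomial x_1^n x_2^n ... x_k^n; addition of exponent maps multiplies monomials. *)
definition diag_monomial :: "nat \<Rightarrow> nat \<Rightarrow> (nat \<Rightarrow>\<^sub>0 nat)" where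
  "diag_monomial k n = (\<Sum>i\<in>{1..k}. Poly_Mapping.single i n)"

end

theory Submission
  imports Defs
begin

text \<open>
  Tall tiles in a tiling of a rectangle are linearly ordered from left to right, because two
  disjoint connected sets joining the bottom to the top of a strip cannot cross (Fashoda meet
  theorem).  The region to the left of a tile is determined by the tile, so tilings can be cut and
  glued along a common tile, and tilings correspond to the words of a local language whose letters
  have positive real lengths with prescribed sum \<open>n + \<epsilon>\<close>.  On the rational span of the lengths, the
  condition on the sum is equivalent to finitely many conditions with positive integral weights,
  obtained from rational functionals close to the inclusion into the reals; reading these off on a
  diagonal and eliminating states one by one gives a rational series.  Conversely, a rational series
  counts the paths of a finite automaton by weight.  The edges become tiles whose left and right
  sides encode the states by a bump, and whose lengths are rationally independent reals, logarithms
  of primes up to a common factor, so that a total length \<open>n + \<epsilon>\<close> forces all exponents to be \<open>n\<close>.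
\<close>

section \<open>Multivariate power series as a semiring\<close>

text \<open>The sides of neighbouring tiles may interlock in complicated ways, so contact between
  sides is never described. A tile enters only through the set where it abuts the bottom line, and
  compatibility is existential: two tiles fit if they are neighbours in some tiling of the whole
  infinite strip. Half strips complete a tiling of a rectangle to such a tiling; the walls thereby
  become pieces like all others, and translations act. On the algebraic side the obstacle is the
  star, which is admissible only for series without constant term. Rational coordinates of a length
  can be zero or negative, whereas functionals that are positive on all lengths make every letter
  consume a nonzero monomial, up to a bounded carry. In the converse direction, tilings start and
  end at a flat wall, so paths are closed at one state and could go round repeatedly. An extra
  variable occurs three times per round, and \<epsilon> is three times its length, which allows
  exactly one round. This \<epsilon> is positive, which also avoids the rectangle of length 0: its
  count is 1 by convention, while the constant term of the series is arbitrary.\<close>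

type_synonym exps = "nat \<Rightarrow>\<^sub>0 nat"

abbreviation expt :: "exps \<Rightarrow> nat \<Rightarrow> nat" where "expt \<equiv> Poly_Mapping.lookup"
abbreviation vars :: "exps \<Rightarrow> nat set" where "vars \<equiv> Poly_Mapping.keys"

text \<open>A type of its own lets convolution be the class multiplication, so that semiring
  simplification and finite sums apply to series.\<close>

typedef 'a pser = "UNIV :: 'a mps set" morphisms pcoeff Abs_pser
  by simp

setup_lifting type_definition_pser

lemma pser_eqI: "(\<And>m. pcoeff F m = pcoeff G m) \<Longrightarrow> F = G"
  by (simp add: pcoeff_inject[symmetric] fun_eq_iff)

lemma mps_mult_commute: "mps_mult F G = mps_mult G F"
proof
  fix m
  show "mps_mult F G m = mps_mult G F m"
    unfolding mps_mult_def
    by (rule sum.reindex_bij_witness[where i = "\<lambda>(p, q). (q, p)" and j = "\<lambda>(p, q). (q, p)"])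
       (auto simp: add.commute mult.commute)
qed

lemma mps_mult_assoc: "mps_mult (mps_mult F G) H = mps_mult F (mps_mult G H)"
proof
  fix m :: "exps"
  let ?I = "\<lambda>m :: exps. {(p, q). p + q = m}"
  have fin: "finite (?I m)" "\<forall>x\<in>S. finite (?I (h x))" for m S and h :: "_ \<Rightarrow> exps"
    by (auto simp only: finite_mps_mult_index)
  have "mps_mult (mps_mult F G) H m =
      (\<Sum>x\<in>?I m. \<Sum>y\<in>?I (fst x). F (fst y) * G (snd y) * H (snd x))"
    unfolding mps_mult_def by (simp add: sum_distrib_right case_prod_beta)
  also have "\<dots> = (\<Sum>z\<in>Sigma (?I m) (\<lambda>x. ?I (fst x)).
      F (fst (snd z)) * G (snd (snd z)) * H (snd (fst z)))"
    by (subst sum.Sigma[OF fin]) (simp add: case_prod_beta)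
  also have "\<dots> = (\<Sum>z\<in>Sigma (?I m) (\<lambda>x. ?I (snd x)).
      F (fst (fst z)) * (G (fst (snd z)) * H (snd (snd z))))"
    by (rule sum.reindex_bij_witness
          [where j = "\<lambda>((a, b), (c, d)). ((c, d + b), (d, b))"
             and i = "\<lambda>((a, b), (c, d)). ((a + c, d), (a, c))"])
       (auto simp: add.assoc mult.assoc)
  also have "\<dots> = mps_mult F (mps_mult G H) m"
    unfolding mps_mult_def by (simp add: fin sum.Sigma case_prod_beta sum_distrib_left)
  finally show "mps_mult (mps_mult F G) H m = mps_mult F (mps_mult G H) m" .
qed

text \<open>The unit law and multiplication by a monomial are both instances. Subtraction of
  exponents is truncated, hence the case distinction on divisibility.\<close>

lemma mps_mult_left:
  "mps_mult (\<lambda>p. if p = u then 1 else 0) F m = (if \<exists>q. u + q = m then F (m - u) else 0)"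
proof -
  have "mps_mult (\<lambda>p. if p = u then 1 else 0) F m =
      (\<Sum>x\<in>{(p, q). p + q = m}. if fst x = u then F (snd x) else 0)"
    unfolding mps_mult_def by (intro sum.cong) auto
  also have "\<dots> = (\<Sum>x\<in>{(p, q). p + q = m} \<inter> {x. fst x = u}. F (snd x))"
    using sum.inter_restrict[OF finite_mps_mult_index, of "\<lambda>x. F (snd x)" m "{x. fst x = u}"] by simp
  also have "{(p, q). p + q = m} \<inter> {x. fst x = u} = (if \<exists>q. u + q = m then {(u, m - u)} else {})"
    by auto
  finally show ?thesis by simp
qed

lemma mps_mult_one_left: "mps_mult mps_one F = F"
proof
  fix m
  show "mps_mult mps_one F m = F m"
    using mps_mult_left[of 0 F m] unfolding mps_one_def[abs_def] by simp
qed

lemma mps_mult_add_left: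
  "mps_mult (\<lambda>m. F m + G m) H = (\<lambda>m. mps_mult F H m + mps_mult G H m)"
  unfolding mps_mult_def by (auto simp: case_prod_beta distrib_right sum.distrib)

instantiation pser :: (comm_semiring_1) comm_semiring_1
begin

lift_definition zero_pser :: "'a pser" is "\<lambda>m. 0" .
lift_definition one_pser :: "'a pser" is mps_one .
lift_definition plus_pser :: "'a pser \<Rightarrow> 'a pser \<Rightarrow> 'a pser" is "\<lambda>F G m. F m + G m" .
lift_definition times_pser :: "'a pser \<Rightarrow> 'a pser \<Rightarrow> 'a pser" is mps_mult .

instance
proof
  fix a b c :: "'a pser"
  show "a + b + c = a + (b + c)" by transfer (auto simp: add.assoc)
  show "a + b = b + a" by transfer (auto simp: add.commute)
  show "0 + a = a" by transfer auto
  show "a * b * c = a * (b * c)" by transfer (rule mps_mult_assoc)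
  show "a * b = b * a" by transfer (rule mps_mult_commute)
  show "1 * a = a" by transfer (rule mps_mult_one_left)
  show "(a + b) * c = a * c + b * c" by transfer (rule mps_mult_add_left)
  show "0 * a = 0" by transfer (auto simp: mps_mult_def)
  show "a * 0 = 0" by transfer (auto simp: mps_mult_def)
  show "(0 :: 'a pser) \<noteq> 1" by transfer (auto simp: mps_one_def fun_eq_iff)
qed

end

lemma pcoeff_zero [simp]: "pcoeff 0 m = 0" by transfer auto
lemma pcoeff_one: "pcoeff 1 m = (if m = 0 then 1 else 0)" by transfer (simp add: mps_one_def)
lemma pcoeff_add [simp]: "pcoeff (F + G) m = pcoeff F m + pcoeff G m" by transfer auto
lemma pcoeff_mult: "pcoeff (F * G) m = (\<Sum>(p, q)\<in>{(p, q). p + q = m}. pcoeff F p * pcoeff G q)"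
  by (simp only: times_pser.rep_eq mps_mult_def)

lemma pcoeff_sum: "pcoeff (\<Sum>x\<in>A. f x) m = (\<Sum>x\<in>A. pcoeff (f x) m)"
  by (induction A rule: infinite_finite_induct) auto

lemma add_eq_0_poly_mapping_iff: "p + q = (0 :: exps) \<longleftrightarrow> p = 0 \<and> q = 0"
proof
  assume "p + q = 0"
  then have "expt (p + q) i = 0" for i by simp
  then have "expt p i = 0 \<and> expt q i = 0" for i
    unfolding lookup_add by simp
  then show "p = 0 \<and> q = 0" by (simp add: poly_mapping_eqI)
qed simp

lemma pair_sum_zero_set: "{(p, q). p + q = (0 :: exps)} = {(0, 0)}"
  unfolding add_eq_0_poly_mapping_iff by auto

lemma pcoeff_mult_0 [simp]: "pcoeff (F * G) 0 = pcoeff F 0 * pcoeff G 0"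
  by (simp add: pcoeff_mult pair_sum_zero_set)

definition pmono :: "exps \<Rightarrow> 'a::comm_semiring_1 pser" where
  "pmono u = Abs_pser (\<lambda>m. if m = u then 1 else 0)"

lemma pcoeff_pmono: "pcoeff (pmono u) m = (if m = u then 1 else 0)"
  by (simp add: pmono_def Abs_pser_inverse)

lemma pcoeff_pmono_mult:
  "pcoeff (pmono u * F) m = (if \<exists>q. m = u + q then pcoeff F (m - u) else 0)"
  using mps_mult_left[of u "pcoeff F" m]
  by (auto simp: pmono_def Abs_pser_inverse times_pser.rep_eq)

lemma pmono_zero: "pmono 0 = 1"
  by (rule pser_eqI) (simp add: pcoeff_pmono pcoeff_one)

lemma pmono_add: "pmono (u + v) = pmono u * pmono v"
  by (rule pser_eqI) (auto simp: pcoeff_pmono_mult pcoeff_pmono)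

section \<open>Total degree, and the equation \<open>X = A + P * X\<close> for \<open>P\<close>
  without constant term\<close>

definition tdeg :: "exps \<Rightarrow> nat" where
  "tdeg m = (\<Sum>i\<in>vars m. expt m i)"

lemma tdeg_sum: "finite A \<Longrightarrow> vars m \<subseteq> A \<Longrightarrow> tdeg m = (\<Sum>i\<in>A. expt m i)"
  unfolding tdeg_def by (rule sum.mono_neutral_left) (auto simp: in_keys_iff)

lemma tdeg_add: "tdeg (m + n) = tdeg m + tdeg n"
proof -
  let ?A = "vars m \<union> vars n"
  have "vars (m + n) \<subseteq> ?A" by (rule keys_add)
  then show ?thesis
    by (simp add: tdeg_sum[of ?A] lookup_add sum.distrib)
qed

lemma tdeg_eq_0_iff: "tdeg m = 0 \<longleftrightarrow> m = 0"
proof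
  assume "tdeg m = 0"
  then have "\<forall>i\<in>vars m. expt m i = 0" by (simp add: tdeg_def)
  then show "m = 0" by (metis in_keys_iff lookup_zero poly_mapping_eqI)
qed (simp add: tdeg_def)

lemma tdeg_single [simp]: "tdeg (Poly_Mapping.single i n) = n"
  by (simp add: tdeg_def)

text \<open>A factor without constant term raises the degree, so the product at \<open>m\<close>
  sees only smaller degrees of the other factor. This contraction lies behind both uniqueness and
  existence of fixed points.\<close>

lemma pcoeff_mult_cong:
  fixes P :: "nat pser"
  assumes "pcoeff P 0 = 0" "\<And>q. tdeg q < tdeg m \<Longrightarrow> pcoeff X q = pcoeff Y q"
  shows "pcoeff (P * X) m = pcoeff (P * Y) m"
  unfolding pcoeff_mult
proof (rule sum.cong[OF refl])
  fix z assume "z \<in> {(p, q). p + q = m}"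
  then obtain p q where z: "z = (p, q)" "m = p + q" by auto
  show "(case z of (p, q) \<Rightarrow> pcoeff P p * pcoeff X q) = (case z of (p, q) \<Rightarrow> pcoeff P p * pcoeff Y q)"
  proof (cases "p = 0")
    case False
    then have "tdeg q < tdeg m" using z tdeg_eq_0_iff[of p] by (simp add: tdeg_add)
    then show ?thesis using assms(2) z by simp
  qed (use assms(1) z in simp)
qed

lemma affine_pser_unique:
  fixes P :: "nat pser"
  assumes "pcoeff P 0 = 0" "X = A + P * X" "Y = A + P * Y"
  shows "X = Y"
proof (rule pser_eqI)
  fix m show "pcoeff X m = pcoeff Y m"
  proof (induction "tdeg m" arbitrary: m rule: less_induct)
    case less
    have "pcoeff (P * X) m = pcoeff (P * Y) m" using less by (rule pcoeff_mult_cong[OF assms(1)])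
    moreover have "pcoeff X m = pcoeff A m + pcoeff (P * X) m" "pcoeff Y m = pcoeff A m + pcoeff (P * Y) m"
      by (metis assms(2) pcoeff_add) (metis assms(3) pcoeff_add)
    ultimately show ?case by simp
  qed
qed

text \<open>The partial sums \<open>1 + P + ... + P^n\<close> of the geometric series in Horner
  form.\<close>

fun star_approx :: "nat pser \<Rightarrow> nat \<Rightarrow> nat pser" where
  "star_approx P 0 = 1"
| "star_approx P (Suc n) = 1 + P * star_approx P n"

lemma star_exists:
  fixes P :: "nat pser"
  assumes "pcoeff P 0 = 0"
  shows "\<exists>G. G = 1 + P * G"
proof -
  have step: "tdeg m \<le> n \<Longrightarrow> pcoeff (star_approx P n) m = pcoeff (star_approx P (Suc n)) m" for n m
  proof (induction n arbitrary: m)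
    case 0
    then show ?case using assms by (simp add: tdeg_eq_0_iff)
  next
    case (Suc n)
    have "pcoeff (P * star_approx P n) m = pcoeff (P * star_approx P (Suc n)) m"
      by (rule pcoeff_mult_cong[OF assms], rule Suc.IH) (use Suc.prems in simp)
    then show ?case by simp
  qed
  have stable: "tdeg m \<le> n \<Longrightarrow> pcoeff (star_approx P n) m = pcoeff (star_approx P (tdeg m)) m" for n m
  proof (induction n)
    case (Suc n)
    then show ?case using step[of m n] by (cases "tdeg m \<le> n") (auto simp: le_Suc_eq)
  qed simp
  \<comment> \<open>The coefficient at \<open>m\<close> is stationary from stage
    \<open>tdeg m\<close> on, so the limit is read off there.\<close>
  define G where "G = Abs_pser (\<lambda>m. pcoeff (star_approx P (tdeg m)) m)"
  have cG: "pcoeff G m = pcoeff (star_approx P (tdeg m)) m" for m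
    by (simp add: G_def Abs_pser_inverse)
  have "pcoeff G m = pcoeff (1 + P * G) m" for m
  proof -
    have "pcoeff G m = pcoeff (star_approx P (Suc (tdeg m))) m" by (subst cG) (rule step, simp)
    also have "\<dots> = pcoeff 1 m + pcoeff (P * star_approx P (tdeg m)) m" by simp
    also have "pcoeff (P * star_approx P (tdeg m)) m = pcoeff (P * G) m"
      by (rule pcoeff_mult_cong[OF assms], subst cG, rule stable) simp
    finally show ?thesis by simp
  qed
  then have "G = 1 + P * G" by (rule pser_eqI)
  then show ?thesis ..
qed

text \<open>Moving \<open>F * G\<close> to the other side gives an equation over the naturals, so
  integers occur nowhere else.\<close>

lemma star_int_iff:
  fixes F G :: "nat pser"
  shows "mps_mult (\<lambda>m. mps_one m - int (pcoeff F m)) (\<lambda>m. int (pcoeff G m)) = mps_one \<longleftrightarrow> G = 1 + F * G"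
proof -
  have eq: "mps_mult (\<lambda>m. mps_one m - int (pcoeff F m)) (\<lambda>m. int (pcoeff G m)) m
      = int (pcoeff G m) - int (pcoeff (F * G) m)" for m
  proof -
    have "mps_mult (\<lambda>m. mps_one m - int (pcoeff F m)) (\<lambda>m. int (pcoeff G m)) m
      = mps_mult mps_one (\<lambda>m. int (pcoeff G m)) m - int (pcoeff (F * G) m)"
      unfolding mps_mult_def pcoeff_mult
      by (simp add: case_prod_beta left_diff_distrib sum_subtractf)
    then show ?thesis by (simp add: mps_mult_one_left)
  qed
  have "mps_one m = int (pcoeff 1 m)" for m by (simp add: mps_one_def pcoeff_one)
  then have "mps_mult (\<lambda>m. mps_one m - int (pcoeff F m)) (\<lambda>m. int (pcoeff G m)) = mps_one
     \<longleftrightarrow> (\<forall>m. int (pcoeff G m) - int (pcoeff (F * G) m) = int (pcoeff 1 m))"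
    unfolding fun_eq_iff eq by simp
  also have "\<dots> \<longleftrightarrow> (\<forall>m. pcoeff G m = pcoeff (1 + F * G) m)"
    by (intro all_cong1) auto
  also have "\<dots> \<longleftrightarrow> G = 1 + F * G"
    using pser_eqI by metis
  finally show ?thesis .
qed

section \<open>N-rational series as a class of series, and linear systems over it\<close>

definition NR :: "nat \<Rightarrow> nat pser set" where
  "NR k = {F. pcoeff F \<in> N_rational k}"

lemma NR_zero: "0 \<in> NR k"
  unfolding NR_def using N_rational.zero by (simp add: zero_pser.rep_eq)

lemma NR_var: "i \<in> {1..k} \<Longrightarrow> pmono (Poly_Mapping.single i 1) \<in> NR k"
  unfolding NR_def using N_rational.var[of i k] by (simp add: pmono_def Abs_pser_inverse mps_var_def[abs_def])

lemma NR_add: "F \<in> NR k \<Longrightarrow> G \<in> NR k \<Longrightarrow> F + G \<in> NR k"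
  unfolding NR_def using N_rational.add[of "pcoeff F" k "pcoeff G"] by (simp add: plus_pser.rep_eq)

lemma NR_mult: "F \<in> NR k \<Longrightarrow> G \<in> NR k \<Longrightarrow> F * G \<in> NR k"
  unfolding NR_def using N_rational.mult[of "pcoeff F" k "pcoeff G"] by (simp add: times_pser.rep_eq)

lemma NR_star: "F \<in> NR k \<Longrightarrow> pcoeff F 0 = 0 \<Longrightarrow> G = 1 + F * G \<Longrightarrow> G \<in> NR k"
  unfolding NR_def using N_rational.inverse[of "pcoeff F" k "pcoeff G"] star_int_iff[of F G] by simp

lemma NR_one: "1 \<in> NR k"
  using NR_star[OF NR_zero] by simp

lemma NR_sum: "(\<And>x. x \<in> A \<Longrightarrow> f x \<in> NR k) \<Longrightarrow> sum f A \<in> NR k"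
  by (induction A rule: infinite_finite_induct) (auto intro: NR_zero NR_add)

lemma NR_pmono: "vars u \<subseteq> {1..k} \<Longrightarrow> pmono u \<in> NR k"
proof (induction "tdeg u" arbitrary: u)
  case 0
  then have "u = 0" by (metis tdeg_eq_0_iff)
  then show ?case by (simp add: pmono_zero NR_one)
next
  case (Suc n)
  then have "u \<noteq> 0" using tdeg_eq_0_iff[of u] by simp
  then obtain i where i: "i \<in> vars u"
    using keys_eq_empty[of u] by blast
  define v where "v = u - Poly_Mapping.single i 1"
  have u: "u = Poly_Mapping.single i 1 + v"
    using i by (intro poly_mapping_eqI) (auto simp: v_def lookup_add lookup_minus lookup_single when_def in_keys_iff)
  have "Suc n = 1 + tdeg v"
    using Suc.hyps(2) arg_cong[OF u, of tdeg] by (simp add: tdeg_add)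
  moreover have "vars v \<subseteq> {1..k}"
    using Suc.prems by (auto simp: v_def in_keys_iff lookup_minus)
  ultimately have "pmono v \<in> NR k" using Suc.hyps(1) by simp
  moreover have "i \<in> {1..k}" using i Suc.prems by auto
  ultimately show ?case by (subst u) (auto simp only: pmono_add intro!: NR_mult NR_var)
qed

text \<open>Gaussian elimination with the star as division: the equation of \<open>q\<close> is
  solved for \<open>X q\<close> by the star of its diagonal entry and substituted into the others.
  Constant terms of the coefficients are tolerated along strictly decreasing rank \<rho>; this
  forces the diagonal entries to have none, and elimination preserves it.\<close>

lemma NR_linear_system:
  fixes X :: "'q \<Rightarrow> nat pser" and \<rho> :: "'q \<Rightarrow> nat"
  assumes "finite Q"
    and "\<And>i. i \<in> Q \<Longrightarrow> X i = b i + (\<Sum>j\<in>Q. P i j * X j)"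
    and "\<And>i. i \<in> Q \<Longrightarrow> b i \<in> NR k"
    and "\<And>i j. i \<in> Q \<Longrightarrow> j \<in> Q \<Longrightarrow> P i j \<in> NR k"
    and "\<And>i j. i \<in> Q \<Longrightarrow> j \<in> Q \<Longrightarrow> pcoeff (P i j) 0 \<noteq> 0 \<Longrightarrow> \<rho> j < \<rho> i"
  shows "\<forall>i\<in>Q. X i \<in> NR k"
  using assms
proof (induction Q arbitrary: b P rule: finite_induct)
  case (insert q Q)
  have Pq0: "pcoeff (P q q) 0 = 0" using insert.prems(4)[of q q] by auto
  obtain S where S: "S = 1 + P q q * S" using star_exists[OF Pq0] by blast
  have SNR: "S \<in> NR k" using NR_star[OF _ Pq0 S] insert.prems(3) by simp
  define R where "R = b q + (\<Sum>j\<in>Q. P q j * X j)"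
  have "X q = R + P q q * X q"
    using insert.prems(1)[of q] insert.hyps by (simp add: R_def algebra_simps)
  moreover have "S * R = R + P q q * (S * R)"
    by (subst S) (simp add: algebra_simps)
  ultimately have Xq: "X q = S * R" using affine_pser_unique[OF Pq0] by blast
  define b' where "b' i = b i + P i q * (S * b q)" for i
  define P' where "P' i j = P i j + P i q * (S * P q j)" for i j
  have IH: "\<forall>i\<in>Q. X i \<in> NR k"
  proof (rule insert.IH[of b' P'])
    fix i assume i: "i \<in> Q"
    have "X i = b i + P i q * X q + (\<Sum>j\<in>Q. P i j * X j)"
      using insert.prems(1)[of i] insert.hyps i by (simp add: algebra_simps)
    then show "X i = b' i + (\<Sum>j\<in>Q. P' i j * X j)"
      by (simp add: Xq R_def b'_def P'_def algebra_simps sum.distrib sum_distrib_left)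
    show "b' i \<in> NR k" unfolding b'_def using insert.prems i SNR by (intro NR_add NR_mult) auto
  next
    fix i j assume ij: "i \<in> Q" "j \<in> Q"
    show "P' i j \<in> NR k" unfolding P'_def using insert.prems ij SNR by (intro NR_add NR_mult) auto
    show "\<rho> j < \<rho> i" if "pcoeff (P' i j) 0 \<noteq> 0"
    proof (cases "pcoeff (P i j) 0 = 0")
      case True
      \<comment> \<open>A constant term created by the substitution needs one in both
        \<open>P i q\<close> and \<open>P q j\<close>, so the rank drops twice.\<close>
      with that have "pcoeff (P i q) 0 \<noteq> 0" "pcoeff (P q j) 0 \<noteq> 0" by (auto simp: P'_def)
      then have "\<rho> q < \<rho> i" "\<rho> j < \<rho> q" using insert.prems(4) ij by auto
      then show ?thesis by simp
    qed (use insert.prems(4) ij in auto)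
  qed
  moreover have "X q \<in> NR k"
    unfolding Xq R_def using IH insert.prems SNR by (intro NR_mult NR_add NR_sum) auto
  ultimately show ?case by simp
qed simp

section \<open>Counting words by weight\<close>

text \<open>A local language. The letter \<open>x\<close> stands in front of the word: it plays the
  part of a start state, and of the last letter when the word is empty.\<close>

definition words :: "'a set \<Rightarrow> ('a \<Rightarrow> 'a \<Rightarrow> bool) \<Rightarrow> ('a \<Rightarrow> bool) \<Rightarrow> 'a \<Rightarrow> 'a list set" where
  "words S R E x = {ws. set ws \<subseteq> S \<and> successively R (x # ws) \<and> E (last (x # ws))}"

lemma Nil_in_words [simp]: "[] \<in> words S R E x \<longleftrightarrow> E x"
  by (simp add: words_def)

lemma Cons_in_words [simp]: "t # ws \<in> words S R E x \<longleftrightarrow> t \<in> S \<and> R x t \<and> ws \<in> words S R E t"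
  by (auto simp: words_def)

definition word_count ::
  "'a set \<Rightarrow> ('a \<Rightarrow> 'a \<Rightarrow> bool) \<Rightarrow> ('a \<Rightarrow> bool) \<Rightarrow> ('a \<Rightarrow> exps) \<Rightarrow> 'a \<Rightarrow> exps \<Rightarrow> nat" where
  "word_count S R E H x M = card {ws \<in> words S R E x. (\<Sum>t\<leftarrow>ws. H t) = M}"

lemma ex_add_iff_le:
  fixes u M :: "exps"
  shows "(\<exists>q. M = u + q) \<longleftrightarrow> (\<forall>j. expt u j \<le> expt M j)"
proof
  assume "\<forall>j. expt u j \<le> expt M j"
  then have "M = u + (M - u)"
    by (intro poly_mapping_eqI) (simp add: lookup_add lookup_minus)
  then show "\<exists>q. M = u + q" ..
qed (auto simp: lookup_add)

text \<open>Every letter adds at least 1 to the total degree, so the total degree of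
  \<open>M\<close> bounds the length.\<close>

lemma finite_bounded_weight_words:
  assumes "finite S" "\<And>t. t \<in> S \<Longrightarrow> H t \<noteq> 0"
  shows "finite {ws. set ws \<subseteq> S \<and> (\<Sum>t\<leftarrow>ws. H t) = (M :: exps)}"
proof (rule finite_subset)
  have "length ws \<le> tdeg (\<Sum>t\<leftarrow>ws. H t)" if "set ws \<subseteq> S" for ws
    using that
  proof (induction ws)
    case (Cons t ws)
    then have "tdeg (H t) > 0" using assms(2) tdeg_eq_0_iff[of "H t"] by auto
    then show ?case using Cons by (simp add: tdeg_add)
  qed simp
  then show "{ws. set ws \<subseteq> S \<and> (\<Sum>t\<leftarrow>ws. H t) = M} \<subseteq> {ws. set ws \<subseteq> S \<and> length ws \<le> tdeg M}"
    by blast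
  show "finite {ws. set ws \<subseteq> S \<and> length ws \<le> tdeg M}"
    using assms(1) by (rule finite_lists_length_le)
qed

lemma word_count_rec:
  fixes S :: "'a set"
  assumes "finite S" "\<And>t. t \<in> S \<Longrightarrow> H t \<noteq> 0"
  shows "word_count S R E H x M = (if E x \<and> M = 0 then 1 else 0) +
    (\<Sum>t\<in>S. if R x t \<and> (\<exists>q. M = H t + q) then word_count S R E H t (M - H t) else 0)"
proof -
  define A where "A t M = {ws \<in> words S R E t. (\<Sum>t\<leftarrow>ws. H t) = M}" for t M
  have fin: "finite (A t M)" for t M
    by (rule finite_subset[OF _ finite_bounded_weight_words[OF assms, where M = M]])
       (auto simp: A_def words_def)
  define S' where "S' = {t \<in> S. R x t \<and> (\<exists>q. M = H t + q)}"
  define B where "B = {ws :: 'a list. ws = [] \<and> E x \<and> M = 0}"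
  have A: "A x M = B \<union> (\<Union>t\<in>S'. (#) t ` A t (M - H t))"
  proof (intro equalityI subsetI)
    fix ws assume "ws \<in> A x M"
    then show "ws \<in> B \<union> (\<Union>t\<in>S'. (#) t ` A t (M - H t))"
      by (cases ws) (auto simp: A_def S'_def B_def)
  next
    fix ws assume "ws \<in> B \<union> (\<Union>t\<in>S'. (#) t ` A t (M - H t))"
    then show "ws \<in> A x M"
      by (auto simp: A_def S'_def B_def)
  qed
  have "card (A x M) = card B + card (\<Union>t\<in>S'. (#) t ` A t (M - H t))"
    unfolding A using assms(1) fin
    by (intro card_Un_disjoint) (auto simp: B_def S'_def)
  also have "card B = (if E x \<and> M = 0 then 1 else 0)"
    by (simp add: B_def)
  also have "card (\<Union>t\<in>S'. (#) t ` A t (M - H t)) = (\<Sum>t\<in>S'. card ((#) t ` A t (M - H t)))"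
    using assms(1) fin by (intro card_UN_disjoint) (auto simp: S'_def)
  also have "\<dots> = (\<Sum>t\<in>S'. card (A t (M - H t)))"
    by (intro sum.cong card_image) auto
  also have "\<dots> = (\<Sum>t\<in>S. if R x t \<and> (\<exists>q. M = H t + q) then card (A t (M - H t)) else 0)"
    unfolding S'_def using assms(1) by (rule sum.inter_filter)
  finally show ?thesis unfolding word_count_def A_def .
qed

section \<open>Exponent vectors, and carries in the subtraction of weights\<close>

definition exp_vec :: "nat \<Rightarrow> (nat \<Rightarrow> nat) \<Rightarrow> exps" where
  "exp_vec k g = (\<Sum>j\<in>{1..k}. Poly_Mapping.single j (g j))"

lemma lookup_sum_single:
  "finite A \<Longrightarrow> expt (\<Sum>j\<in>A. Poly_Mapping.single j (g j)) i = (if i \<in> A then g i else (0 :: nat))"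
  by (induction A rule: finite_induct) (auto simp: lookup_add lookup_single when_def)

lemma expt_exp_vec [simp]: "expt (exp_vec k g) j = (if j \<in> {1..k} then g j else 0)"
  unfolding exp_vec_def by (subst lookup_sum_single) simp_all

lemma vars_exp_vec: "vars (exp_vec k g) \<subseteq> {1..k}"
  by (auto simp: in_keys_iff split: if_splits)

definition exp_scale :: "nat \<Rightarrow> exps \<Rightarrow> exps" where
  "exp_scale N m = Poly_Mapping.map ((*) N) m"

lemma expt_exp_scale [simp]: "expt (exp_scale N m) j = N * expt m j"
  by (simp add: exp_scale_def Poly_Mapping.map.rep_eq when_def)

lemma finite_bounded_exps:
  "finite {s :: exps. vars s \<subseteq> {1..k} \<and> (\<forall>j. expt s j \<le> C)}" (is "finite ?A")
proof (rule finite_imageD)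
  show "finite (expt ` ?A)"
  proof (rule finite_subset)
    show "finite {f. \<forall>i. (i \<in> {1..k} \<longrightarrow> f i \<in> {..C}) \<and> (i \<notin> {1..k} \<longrightarrow> f i = (0::nat))}"
      by (rule finite_set_of_finite_funs) auto
    show "expt ` ?A \<subseteq> {f. \<forall>i. (i \<in> {1..k} \<longrightarrow> f i \<in> {..C}) \<and> (i \<notin> {1..k} \<longrightarrow> f i = (0::nat))}"
      by (auto simp: in_keys_iff)
  qed
qed (simp add: inj_on_def)

text \<open>\<open>c\<close> is a ceiling: the least number of blocks of size \<open>N\<close> to
  borrow before \<open>h\<close> can be taken from \<open>s\<close>. The bound on what is left keeps
  all remainders in a finite range, and \<open>c = 0\<close> singles out the payments without
  borrowing.\<close>

lemma carry_div:
  fixes h s m N :: nat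
  assumes "N > 0"
  defines "c \<equiv> (h - s + N - 1) div N"
  shows "h \<le> N * m + s \<longleftrightarrow> c \<le> m" and "h \<le> s + N * c" and "s + N * c - h \<le> max s N"
    and "c = 0 \<longleftrightarrow> h \<le> s"
proof -
  have c: "N * c \<le> h - s + N - 1" "h - s + N - 1 < N * c + N"
    using mult_div_mod_eq[of N "h - s + N - 1"] mod_less_divisor[OF assms(1), of "h - s + N - 1"]
    unfolding c_def by linarith+
  show h: "h \<le> s + N * c" using c by linarith
  have c0: "N \<le> N * c" if "c \<noteq> 0" using that by simp
  show "s + N * c - h \<le> max s N"
  proof (cases "c = 0")
    case False
    have "s + N * c - h \<le> N" using c c0[OF False] assms(1) by arith
    then show ?thesis by simp
  qed simp
  have le: "N * c \<le> N * m" if "c \<le> m" using that by simp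
  have gt: "N * m + N \<le> N * c" if "\<not> c \<le> m"
  proof -
    have "N * Suc m \<le> N * c" using that by (intro mult_le_mono) auto
    then show ?thesis by simp
  qed
  show "h \<le> N * m + s \<longleftrightarrow> c \<le> m"
    using le gt c h by linarith
  show "c = 0 \<longleftrightarrow> h \<le> s"
  proof (cases "c = 0")
    case False
    have "\<not> h \<le> s"
    proof
      assume "h \<le> s"
      then have "N * c \<le> N - 1" using c(1) by simp
      then show False using c0[OF False] assms(1) by linarith
    qed
    then show ?thesis using False by simp
  qed (use h in simp)
qed

text \<open>
  A word is read letter by letter while remembering the part \<open>s\<close> of the target weight that is
  not a multiple of \<open>N\<close>; whenever a letter exceeds \<open>s\<close>, multiples of \<open>N\<close> are borrowed from
  \<open>m\<close>, which is recorded by a monomial.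
\<close>

lemma word_count_N_rational:
  fixes H :: "'a \<Rightarrow> exps"
  assumes S: "finite S" "\<And>t. t \<in> S \<Longrightarrow> H t \<noteq> 0" and N: "N > 0"
    and keys: "\<And>t. t \<in> S \<Longrightarrow> vars (H t) \<subseteq> {1..k}" "vars r \<subseteq> {1..k}"
  shows "(\<lambda>m. word_count S R E H x (exp_scale N m + r)) \<in> N_rational k"
proof -
  let ?l = "expt"
  \<comment> \<open>A bound for the entries of all reachable remainders: \<open>r\<close> obeys it,
    and by \<open>carry_div\<close> a step leaves at most the maximum of the old entry and
    \<open>N\<close>. The inserted 0 covers an empty range of indices.\<close>
  define C where "C = max N (Max (insert 0 (?l r ` {1..k})))"
  have C: "?l r j \<le> C" for j
  proof (cases "j \<in> {1..k}")
    case True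
    then have "?l r j \<le> Max (insert 0 (?l r ` {1..k}))" by (intro Max_ge) auto
    then show ?thesis by (simp add: C_def)
  next
    case False
    then have "?l r j = 0" using keys(2) by (auto simp: in_keys_iff)
    then show ?thesis by simp
  qed
  define Z where "Z = {s :: exps. vars s \<subseteq> {1..k} \<and> (\<forall>j. ?l s j \<le> C)}"
  define Q where "Q = insert x S \<times> Z"
  define c where "c t s = exp_vec k (\<lambda>j. (?l (H t) j - ?l s j + N - 1) div N)" for t s
  define nx where "nx t s = exp_vec k (\<lambda>j. ?l s j + N * ?l (c t s) j - ?l (H t) j)" for t s
  define X where "X = (\<lambda>(t, s). Abs_pser (\<lambda>m. word_count S R E H t (exp_scale N m + s)))"
  define b :: "'a \<times> exps \<Rightarrow> nat pser" where "b = (\<lambda>(t, s). if E t \<and> s = 0 then 1 else 0)"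
  define P :: "'a \<times> exps \<Rightarrow> 'a \<times> exps \<Rightarrow> nat pser"
    where "P = (\<lambda>(t, s) (t', s'). if t' \<in> S \<and> R t t' \<and> s' = nx t' s then pmono (c t' s) else 0)"
  have "finite Z" unfolding Z_def by (rule finite_bounded_exps)
  then have finQ: "finite Q" using S by (simp add: Q_def)
  have H0: "?l (H t) j = 0" if "t \<in> S" "j \<notin> {1..k}" for t j
    using keys(1)[OF that(1)] that(2) by (auto simp: in_keys_iff)
  have Z0: "?l s j = 0" if "s \<in> Z" "j \<notin> {1..k}" for s j
    using that by (auto simp: Z_def in_keys_iff)
  have nxZ: "nx t s \<in> Z" if "s \<in> Z" for t s
  proof -
    have "?l (nx t s) j \<le> C" for j
    proof (cases "j \<in> {1..k}")
      case True
      then have "?l (nx t s) j \<le> max (?l s j) N"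
        using carry_div(3)[OF N, where h = "?l (H t) j" and s = "?l s j"] by (simp add: nx_def c_def)
      also have "\<dots> \<le> C" using that by (simp add: Z_def C_def)
      finally show ?thesis .
    next
      case False
      then have "?l (nx t s) j = 0" unfolding nx_def expt_exp_vec by auto
      then show ?thesis by simp
    qed
    moreover have "vars (nx t s) \<subseteq> {1..k}"
      unfolding nx_def by (rule vars_exp_vec)
    ultimately show ?thesis by (simp add: Z_def)
  qed
  have split: "(\<exists>q. exp_scale N m + s = H t + q) \<longleftrightarrow> (\<exists>q. m = c t s + q)"
    if "t \<in> S" "s \<in> Z" for t s m
    unfolding ex_add_iff_le
  proof (intro all_cong1)
    fix j
    show "?l (H t) j \<le> ?l (exp_scale N m + s) j \<longleftrightarrow> ?l (c t s) j \<le> ?l m j"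
      using carry_div(1)[OF N, of "?l (H t) j" "?l m j" "?l s j"] H0[OF that(1), of j] Z0[OF that(2), of j]
      by (cases "j \<in> {1..k}") (auto simp: c_def lookup_add)
  qed
  have rest: "exp_scale N m + s - H t = exp_scale N (m - c t s) + nx t s"
    if "t \<in> S" "s \<in> Z" "m = c t s + q" for t s m q
  proof (rule poly_mapping_eqI)
    fix j
    show "?l (exp_scale N m + s - H t) j = ?l (exp_scale N (m - c t s) + nx t s) j"
      using carry_div(2)[OF N, of "?l (H t) j" "?l s j"] H0[OF that(1), of j] Z0[OF that(2), of j]
      by (cases "j \<in> {1..k}") (auto simp: that(3) c_def nx_def lookup_add lookup_minus algebra_simps)
  qed
  have "\<forall>i\<in>Q. X i \<in> NR k"
  \<comment> \<open>A transition has a constant term only when nothing is borrowed. Then the letter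
    is paid out of \<open>s\<close>, and its weight is nonzero, so the total degree of
    \<open>s\<close> drops; this supplies the rank.\<close>
  proof (rule NR_linear_system[where b = b and P = P and \<rho> = "\<lambda>(t, s). tdeg s"])
    show "finite Q" by (rule finQ)
  next
    fix i assume "i \<in> Q"
    then obtain t s where i: "i = (t, s)" "t \<in> insert x S" "s \<in> Z" by (auto simp: Q_def)
    show "b i \<in> NR k" by (simp add: b_def i NR_one NR_zero)
    have "(\<Sum>j\<in>Q. P i j * X j)
        = (\<Sum>t'\<in>insert x S. \<Sum>s'\<in>Z. P i (t', s') * X (t', s'))"
      unfolding Q_def by (simp add: sum.cartesian_product case_prod_beta)
    also have "\<dots> = (\<Sum>t'\<in>insert x S. if t' \<in> S \<and> R t t' then pmono (c t' s) * X (t', nx t' s) else 0)"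
    proof (rule sum.cong[OF refl])
      fix t'
      have "(\<Sum>s'\<in>Z. P i (t', s') * X (t', s'))
         = (\<Sum>s'\<in>Z. if s' = nx t' s then (if t' \<in> S \<and> R t t' then pmono (c t' s) * X (t', nx t' s) else 0) else 0)"
        by (rule sum.cong) (auto simp: P_def i)
      also have "\<dots> = (if t' \<in> S \<and> R t t' then pmono (c t' s) * X (t', nx t' s) else 0)"
        using \<open>finite Z\<close> nxZ[OF i(3), of t'] by simp
      finally show "(\<Sum>s'\<in>Z. P i (t', s') * X (t', s'))
         = (if t' \<in> S \<and> R t t' then pmono (c t' s) * X (t', nx t' s) else 0)" .
    qed
    also have "\<dots> = (\<Sum>t'\<in>S. if R t t' then pmono (c t' s) * X (t', nx t' s) else 0)"
      using S(1) by (intro sum.mono_neutral_cong_right) auto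
    finally have sum_eq: "(\<Sum>j\<in>Q. P i j * X j)
        = (\<Sum>t'\<in>S. if R t t' then pmono (c t' s) * X (t', nx t' s) else 0)" .
    show "X i = b i + (\<Sum>j\<in>Q. P i j * X j)"
    proof (rule pser_eqI)
      fix m
      have "pcoeff (X i) m = word_count S R E H t (exp_scale N m + s)"
        by (simp add: X_def i Abs_pser_inverse)
      also have "\<dots> = (if E t \<and> exp_scale N m + s = 0 then 1 else 0) +
          (\<Sum>t'\<in>S. if R t t' \<and> (\<exists>q. exp_scale N m + s = H t' + q)
             then word_count S R E H t' (exp_scale N m + s - H t') else 0)"
        by (rule word_count_rec[OF S])
      also have "exp_scale N m + s = 0 \<longleftrightarrow> m = 0 \<and> s = 0"
        unfolding add_eq_0_poly_mapping_iff using N by (auto simp: poly_mapping_eq_iff fun_eq_iff)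
      also have "(if E t \<and> m = 0 \<and> s = 0 then 1 else 0) = pcoeff (b i) m"
        by (simp add: b_def i pcoeff_one)
      also have "(\<Sum>t'\<in>S. if R t t' \<and> (\<exists>q. exp_scale N m + s = H t' + q)
             then word_count S R E H t' (exp_scale N m + s - H t') else 0)
          = (\<Sum>t'\<in>S. pcoeff (if R t t' then pmono (c t' s) * X (t', nx t' s) else 0) m)"
      proof (rule sum.cong[OF refl])
        fix t' assume t': "t' \<in> S"
        show "(if R t t' \<and> (\<exists>q. exp_scale N m + s = H t' + q)
             then word_count S R E H t' (exp_scale N m + s - H t') else 0)
          = pcoeff (if R t t' then pmono (c t' s) * X (t', nx t' s) else 0) m"
          unfolding split[OF t' i(3)]
          using rest[OF t' i(3)]
          by (auto simp: pcoeff_pmono_mult X_def Abs_pser_inverse)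
      qed
      also have "\<dots> = pcoeff (\<Sum>j\<in>Q. P i j * X j) m"
        by (simp add: sum_eq pcoeff_sum)
      finally show "pcoeff (X i) m = pcoeff (b i + (\<Sum>j\<in>Q. P i j * X j)) m" by simp
    qed
  next
    fix i j assume "i \<in> Q" "j \<in> Q"
    then obtain t s t' s' where ij: "i = (t, s)" "j = (t', s')" "s \<in> Z" by (auto simp: Q_def)
    have "vars (c t' s) \<subseteq> {1..k}" unfolding c_def by (rule vars_exp_vec)
    then show "P i j \<in> NR k"
      by (simp add: P_def ij NR_pmono NR_zero)
    assume "pcoeff (P i j) 0 \<noteq> 0"
    then have *: "t' \<in> S" "s' = nx t' s" "c t' s = 0"
      by (auto simp: P_def ij pcoeff_pmono split: if_splits)
    have le: "?l (H t') j \<le> ?l s j" for j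
    proof (cases "j \<in> {1..k}")
      case True
      have "?l (c t' s) j = 0" using *(3) by simp
      then show ?thesis
        using True carry_div(4)[OF N, of "?l (H t') j" "?l s j"] unfolding c_def expt_exp_vec by simp
    qed (simp add: H0[OF *(1)])
    have "s = H t' + s'"
    proof (rule poly_mapping_eqI)
      fix j
      show "?l s j = ?l (H t' + s') j"
        using le[of j] *(3) Z0[OF ij(3), of j] H0[OF *(1), of j]
        by (simp add: *(2) nx_def lookup_add)
    qed
    moreover have "tdeg (H t') > 0" using S(2)[OF *(1)] tdeg_eq_0_iff by auto
    ultimately have "tdeg s' < tdeg s" by (simp add: tdeg_add)
    then show "(case j of (t, s) \<Rightarrow> tdeg s) < (case i of (t, s) \<Rightarrow> tdeg s)"
      by (simp add: ij)
  qed
  moreover have "(x, r) \<in> Q" using keys(2) C by (simp add: Q_def Z_def)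
  ultimately have "X (x, r) \<in> NR k" by blast
  then show ?thesis by (simp add: X_def NR_def Abs_pser_inverse)
qed

section \<open>Real weights\<close>

interpretation qvs: vector_space "\<lambda>(q :: rat) (x :: real). of_rat q * x"
  by unfold_locales (auto simp: algebra_simps of_rat_add of_rat_mult)

text \<open>
  The functionals are small rational perturbations of the inclusion of the rational span of \<open>A\<close>
  into the reals: close to it they stay positive on \<open>A\<close>, and moving one coordinate at a time
  makes them separate points.
\<close>

lemma rational_functionals:
  fixes A :: "real set"
  assumes fin: "finite A" and pos: "\<forall>a\<in>A. 0 < a"
  shows "\<exists>k\<ge>1. \<exists>h :: nat \<Rightarrow> real \<Rightarrow> rat. (\<forall>j. \<forall>a\<in>A. h j a > 0) \<and>
    (\<forall>j. \<forall>x\<in>qvs.span A. \<forall>y\<in>qvs.span A. h j (x + y) = h j x + h j y) \<and>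
    (\<forall>x\<in>qvs.span A. (\<forall>j\<in>{1..k}. h j x = 0) \<longrightarrow> x = 0)"
proof -
  obtain B where B: "B \<subseteq> A" "qvs.independent B" "A \<subseteq> qvs.span B"
    using qvs.maximal_independent_subset by blast
  have finB: "finite B" using B(1) fin by (rule finite_subset)
  define c where "c = qvs.representation B"
  have span: "qvs.span A \<subseteq> qvs.span B" using B(3) qvs.span_minimal qvs.subspace_span by blast
  have repr: "(\<Sum>b\<in>B. of_rat (c x b) * b) = x" if "x \<in> qvs.span B" for x
    unfolding c_def using qvs.sum_representation_eq[OF B(2) that finB] by simp
  define M where "M = (\<Sum>a\<in>A. \<Sum>b\<in>B. \<bar>real_of_rat (c a b)\<bar>) + 1"
  have M: "(\<Sum>b\<in>B. \<bar>real_of_rat (c a b)\<bar>) < M" if "a \<in> A" for a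
    using member_le_sum[OF that, of "\<lambda>a. \<Sum>b\<in>B. \<bar>real_of_rat (c a b)\<bar>"] fin
    by (simp add: M_def sum_nonneg)
  have "M > 0" unfolding M_def by (intro add_nonneg_pos sum_nonneg) auto
  \<comment> \<open>Basis values that are off by at most \<eta> move the value at \<open>a\<close>
    by less than \<open>\<eta> * M \<le> a\<close>, so positivity survives. One half of \<eta> is
    spent on rational approximation, the other on the perturbation \<zeta>. The inserted 1 covers an
    empty \<open>A\<close>.\<close>
  define \<eta> where "\<eta> = Min (insert 1 A) / M"
  have \<eta>: "\<eta> > 0" using \<open>M > 0\<close> fin pos by (simp add: \<eta>_def)
  have \<eta>M: "\<eta> * M \<le> a" if "a \<in> A" for a using \<open>M > 0\<close> fin that by (simp add: \<eta>_def)
  have "\<exists>q. b < of_rat q \<and> of_rat q < b + \<eta> / 2" for b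
    using of_rat_dense[of b "b + \<eta> / 2"] \<eta> by auto
  then obtain \<beta> where \<beta>: "\<And>b. b < of_rat (\<beta> b)" "\<And>b. of_rat (\<beta> b) < b + \<eta> / 2" by metis
  obtain \<zeta> :: rat where \<zeta>: "0 < \<zeta>" "of_rat \<zeta> < \<eta> / 2"
    using of_rat_dense[of 0 "\<eta> / 2"] \<eta> by auto
  then have \<zeta>': "real_of_rat \<zeta> > 0" by simp
  obtain e where e: "bij_betw e {1..card B} B"
    using ex_bij_betw_nat_finite_1[OF finB] by blast
  \<comment> \<open>Index \<open>card B + 1\<close> gives the unperturbed functional. Subtracting it
    from the one with index \<open>j\<close> leaves \<zeta> times the coordinate at
    \<open>e j\<close>, so a common zero has all coordinates zero.\<close>
  define h where "h j x = (\<Sum>b\<in>B. c x b * (\<beta> b + (if j \<in> {1..card B} \<and> e j = b then \<zeta> else 0)))" for j x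
  show ?thesis
  proof (rule exI[of _ "card B + 1"], rule conjI, simp, rule exI[of _ h], intro conjI allI ballI impI)
    fix j a assume a: "a \<in> A"
    define \<gamma> where "\<gamma> b = \<beta> b + (if j \<in> {1..card B} \<and> e j = b then \<zeta> else 0)" for b
    have \<gamma>: "\<bar>of_rat (\<gamma> b) - b\<bar> \<le> \<eta>" for b
      using \<beta>[of b] \<zeta> \<zeta>' \<eta> by (auto simp: \<gamma>_def of_rat_add simp del: zero_less_of_rat_iff)
    have "a - of_rat (h j a) = (\<Sum>b\<in>B. of_rat (c a b) * b) - (\<Sum>b\<in>B. of_rat (c a b) * of_rat (\<gamma> b))"
    proof -
      have "h j a = (\<Sum>b\<in>B. c a b * \<gamma> b)" by (simp add: h_def \<gamma>_def)
      moreover have "(\<Sum>b\<in>B. of_rat (c a b) * b) = a" using repr B(3) a by blast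
      ultimately show ?thesis by (simp add: of_rat_sum of_rat_mult)
    qed
    also have "\<dots> = (\<Sum>b\<in>B. of_rat (c a b) * (b - of_rat (\<gamma> b)))"
      by (simp add: sum_subtractf right_diff_distrib)
    also have "\<dots> \<le> (\<Sum>b\<in>B. \<bar>real_of_rat (c a b)\<bar> * \<eta>)"
    proof (rule sum_mono)
      fix b
      have "of_rat (c a b) * (b - of_rat (\<gamma> b)) \<le> \<bar>real_of_rat (c a b)\<bar> * \<bar>b - of_rat (\<gamma> b)\<bar>"
        by (metis abs_ge_self abs_mult)
      also have "\<dots> \<le> \<bar>real_of_rat (c a b)\<bar> * \<eta>"
        using \<gamma>[of b] by (intro mult_left_mono) (auto simp: abs_minus_commute)
      finally show "of_rat (c a b) * (b - of_rat (\<gamma> b)) \<le> \<bar>real_of_rat (c a b)\<bar> * \<eta>" .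
    qed
    also have "\<dots> = \<eta> * (\<Sum>b\<in>B. \<bar>real_of_rat (c a b)\<bar>)"
      by (simp add: sum_distrib_left mult.commute)
    also have "\<dots> < \<eta> * M" using M[OF a] \<eta> by simp
    also have "\<dots> \<le> a" by (rule \<eta>M[OF a])
    finally show "h j a > 0" by simp
  next
    fix j x y assume "x \<in> qvs.span A" "y \<in> qvs.span A"
    then have "x \<in> qvs.span B" "y \<in> qvs.span B" using span by auto
    then have "c (x + y) b = c x b + c y b" for b
      unfolding c_def using qvs.representation_add[OF B(2)] by simp
    then show "h j (x + y) = h j x + h j y"
      by (simp add: h_def sum.distrib algebra_simps)
  next
    fix x assume x: "x \<in> qvs.span A" and h0: "\<forall>j\<in>{1..card B + 1}. h j x = 0"
    have "c x b = 0" if b: "b \<in> B" for b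
    proof -
      have "b \<in> e ` {1..card B}" using bij_betw_imp_surj_on[OF e] b by simp
      then obtain j where j: "j \<in> {1..card B}" "e j = b" by (elim imageE) simp
      have "h j x = (\<Sum>b\<in>B. c x b * \<beta> b) + (\<Sum>b'\<in>B. if b' = b then c x b' * \<zeta> else 0)"
        unfolding h_def sum.distrib[symmetric] using j by (intro sum.cong) (auto simp: algebra_simps)
      also have "(\<Sum>b\<in>B. c x b * \<beta> b) = h (card B + 1) x"
        by (simp add: h_def)
      finally show ?thesis using bspec[OF h0, of j] bspec[OF h0, of "card B + 1"] j b finB \<zeta> by simp
    qed
    then show "x = 0" using repr[of x] x span by auto
  qed
qed

lemma common_denominator:
  fixes V :: "rat set"
  assumes "finite V" "\<And>v. v \<in> V \<Longrightarrow> 0 \<le> v"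
  obtains N :: nat where "N > 0" "\<And>v. v \<in> V \<Longrightarrow> \<exists>m :: nat. of_nat N * v = of_nat m"
proof -
  have "\<exists>N :: nat. N > 0 \<and> (\<forall>v\<in>V. \<exists>m :: nat. of_nat N * v = of_nat m)"
    using assms
  proof (induction V rule: finite_induct)
    case empty
    then show ?case by (intro exI[of _ 1]) auto
  next
    case (insert v V)
    then obtain N :: nat where N: "N > 0" "\<forall>v\<in>V. \<exists>m :: nat. of_nat N * v = of_nat m"
      by auto
    obtain a b where ab: "v = Fract a b" "b > 0" using Rat_cases[of v] by metis
    have "a \<ge> 0" using insert.prems[of v] ab by (simp add: zero_le_Fract_iff)
    have v: "of_nat (nat b) * v = of_nat (nat a)"
      using ab \<open>a \<ge> 0\<close> by (simp add: Fract_of_int_quotient)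
    show ?case
    proof (rule exI[of _ "N * nat b"], intro conjI ballI)
      fix u assume "u \<in> insert v V"
      then consider "u = v" | "u \<in> V" by auto
      then show "\<exists>m :: nat. of_nat (N * nat b) * u = of_nat m"
      proof cases
        case 1
        then have "of_nat (N * nat b) * u = of_nat (N * nat a)" using v by (simp add: mult.assoc)
        then show ?thesis ..
      next
        case 2
        then obtain m :: nat where "of_nat N * u = of_nat m" using N by blast
        then have "of_nat (N * nat b) * u = of_nat (m * nat b)" by (metis mult.assoc mult.commute of_nat_mult)
        then show ?thesis ..
      qed
    qed (use N ab in simp)
  qed
  then show thesis using that by blast
qed

lemma diag_monomial_exp_vec: "diag_monomial k n = exp_vec k (\<lambda>_. n)"
  by (simp add: diag_monomial_def exp_vec_def)

text \<open>All quantities lie in the rational span of 1, \<epsilon> and the lengths, so finitely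
  many separating functionals decide the equation. Each is scaled to the value \<open>N\<close> at
  1, where \<open>N\<close> clears the denominators on this finite set; its values there become
  naturals, and the target becomes \<open>N * n\<close> plus a fixed remainder in every
  coordinate.\<close>

lemma integral_weights:
  fixes w :: "'a \<Rightarrow> real"
  assumes S: "finite S" "\<forall>t\<in>S. w t > 0" and \<epsilon>: "\<epsilon> \<ge> 0"
  shows "\<exists>k N H r. k \<ge> 1 \<and> N > 0 \<and> (\<forall>t\<in>S. H t \<noteq> 0) \<and>
    (\<forall>t. vars (H t) \<subseteq> {1..k}) \<and> vars r \<subseteq> {1..k} \<and>
    (\<forall>ws n. set ws \<subseteq> S \<longrightarrow>
      ((\<Sum>t\<leftarrow>ws. w t) = real n + \<epsilon> \<longleftrightarrow> (\<Sum>t\<leftarrow>ws. H t) = exp_scale N (diag_monomial k n) + r))"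
proof -
  \<comment> \<open>The functionals are controlled on positive numbers only, so \<epsilon> is left
    out when it is 0; \<open>r\<close> then has zero entries.\<close>
  define A where "A = insert 1 (w ` S) \<union> ({\<epsilon>} - {0})"
  have finA: "finite A" using S(1) by (simp add: A_def)
  have posA: "\<forall>a\<in>A. 0 < a" using S(2) \<epsilon> by (auto simp: A_def)
  from rational_functionals[OF finA posA]
  obtain k and h :: "nat \<Rightarrow> real \<Rightarrow> rat" where k: "k \<ge> 1" and h: "\<forall>j. \<forall>a\<in>A. h j a > 0"
    "\<forall>j. \<forall>x\<in>qvs.span A. \<forall>y\<in>qvs.span A. h j (x + y) = h j x + h j y"
    "\<forall>x\<in>qvs.span A. (\<forall>j\<in>{1..k}. h j x = 0) \<longrightarrow> x = 0"
    by (elim exE conjE)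
  have hpos: "h j a > 0" if "a \<in> A" for j a using h(1) that by simp
  have hadd: "h j (x + y) = h j x + h j y" if "x \<in> qvs.span A" "y \<in> qvs.span A" for j x y
    using h(2) that by simp
  define V where "V = (\<lambda>(j, a). h j a / h j 1) ` ({1..k} \<times> A)"
  have one: "1 \<in> A" by (simp add: A_def)
  have "finite V" using finA by (simp add: V_def)
  moreover have "0 \<le> v" if "v \<in> V" for v using that hpos one by (auto simp: V_def intro: less_imp_le)
  ultimately obtain N :: nat where N: "N > 0" "\<And>v. v \<in> V \<Longrightarrow> \<exists>m :: nat. of_nat N * v = of_nat m"
    using common_denominator by blast
  \<comment> \<open>Division by the value at 1 gives all functionals the same value \<open>N\<close>
    there, which is what puts the target on a multiple of the diagonal monomial.\<close>
  define g where "g j x = of_nat N * (h j x / h j 1)" for j x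
  define G where "G j a = (THE m :: nat. g j a = of_nat m)" for j a
  have G: "g j a = of_nat (G j a)" if ja: "j \<in> {1..k}" "a \<in> A" for j a
  proof -
    have "\<exists>m :: nat. g j a = of_nat m"
      unfolding g_def using ja by (intro N(2)) (auto simp: V_def)
    then have "\<exists>!m :: nat. g j a = of_nat m" by auto
    then show ?thesis unfolding G_def by (rule theI')
  qed
  have gadd: "g j (x + y) = g j x + g j y" if "x \<in> qvs.span A" "y \<in> qvs.span A" for j x y
    using hadd[OF that, of j] by (simp add: g_def algebra_simps add_divide_distrib)
  have g1: "g j 1 = of_nat N" for j using hpos[OF one, of j] by (simp add: g_def)
  have gpos: "g j a > 0" if "a \<in> A" for j a using hpos[OF that] hpos[OF one] N by (simp add: g_def)
  have gsep: "x = 0" if "x \<in> qvs.span A" "\<And>j. j \<in> {1..k} \<Longrightarrow> g j x = 0" for x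
  proof (rule h(3)[rule_format, OF that(1)])
    fix j assume "j \<in> {1..k}"
    then show "h j x = 0" using that(2)[of j] N(1) hpos[OF one, of j] by (simp add: g_def)
  qed
  have g0: "g j 0 = 0" for j using gadd[of 0 0 j] qvs.span_zero by simp
  have gn: "g j (real n) = of_nat (N * n)" and n_span: "real n \<in> qvs.span A" for j n
  proof -
    show "real n \<in> qvs.span A" for n
    proof (induction n)
      case (Suc n)
      then show ?case using qvs.span_add[OF qvs.span_base[OF one]] by simp
    qed (simp add: qvs.span_zero)
    then show "g j (real n) = of_nat (N * n)"
    proof (induction n)
      case (Suc n)
      have "g j (1 + real n) = g j 1 + g j (real n)"
        using Suc.prems[of n] qvs.span_base[OF one] gadd by blast
      then show ?case using Suc g1 by (simp add: algebra_simps)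
    qed (simp add: g0)
  qed
  define H where "H t = exp_vec k (\<lambda>j. G j (w t))" for t
  define r where "r = exp_vec k (\<lambda>j. if \<epsilon> = 0 then 0 else G j \<epsilon>)"
  have \<epsilon>_span: "\<epsilon> \<in> qvs.span A"
    by (cases "\<epsilon> = 0") (auto simp: A_def qvs.span_zero intro: qvs.span_base)
  have gr: "g j \<epsilon> = of_nat (expt r j)" if "j \<in> {1..k}" for j
    using that G[of j \<epsilon>] g0 by (auto simp: r_def A_def)
  have ws_span: "(\<Sum>t\<leftarrow>ws. w t) \<in> qvs.span A" if "set ws \<subseteq> S" for ws
    using that by (induction ws) (auto simp: qvs.span_zero A_def intro: qvs.span_add qvs.span_base)
  have gws: "g j (\<Sum>t\<leftarrow>ws. w t) = of_nat (expt (\<Sum>t\<leftarrow>ws. H t) j)"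
    if "set ws \<subseteq> S" "j \<in> {1..k}" for j ws
    using that
  proof (induction ws)
    case (Cons t ws)
    have "w t \<in> A" using Cons.prems by (auto simp: A_def)
    then have "g j (w t + (\<Sum>t\<leftarrow>ws. w t)) = g j (w t) + g j (\<Sum>t\<leftarrow>ws. w t)"
      using gadd qvs.span_base ws_span Cons.prems by simp
    then show ?case using Cons G[OF _ \<open>w t \<in> A\<close>] by (simp add: lookup_add H_def)
  qed (simp add: g0)
  have H0: "expt (\<Sum>t\<leftarrow>ws. H t) j = 0" if "j \<notin> {1..k}" for j ws
    using that by (induction ws) (auto simp: lookup_add H_def)
  show ?thesis
  proof (rule exI[of _ k], rule exI[of _ N], rule exI[of _ H], rule exI[of _ r], intro conjI ballI allI impI)
    fix t assume t: "t \<in> S"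
    then have "w t \<in> A" by (auto simp: A_def)
    then have "expt (H t) 1 \<noteq> 0"
      using G[of 1 "w t"] gpos[of "w t" 1] k by (auto simp: H_def)
    then show "H t \<noteq> 0" by auto
  next
    fix ws n assume ws: "set ws \<subseteq> S"
    define x where "x = real n + \<epsilon>"
    have x: "x \<in> qvs.span A" unfolding x_def by (intro qvs.span_add n_span \<epsilon>_span)
    have gx: "g j x = of_nat (expt (exp_scale N (diag_monomial k n) + r) j)" if "j \<in> {1..k}" for j
      using that gadd[OF n_span \<epsilon>_span] gn gr by (simp add: x_def lookup_add diag_monomial_exp_vec)
    define d where "d = (\<Sum>t\<leftarrow>ws. w t) - x"
    have d: "d \<in> qvs.span A" unfolding d_def by (intro qvs.span_diff ws_span ws x)
    have gd: "g j (\<Sum>t\<leftarrow>ws. w t) = g j d + g j x" for j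
      using gadd[OF d x, of j] by (simp add: d_def)
    have "(\<Sum>t\<leftarrow>ws. w t) = x \<longleftrightarrow> (\<forall>j\<in>{1..k}. g j d = 0)"
      using gsep[OF d] g0 by (auto simp: d_def)
    also have "\<dots> \<longleftrightarrow> (\<forall>j\<in>{1..k}. expt (\<Sum>t\<leftarrow>ws. H t) j
        = expt (exp_scale N (diag_monomial k n) + r) j)"
    proof (intro ball_cong refl)
      fix j assume j: "j \<in> {1..k}"
      have "g j d = of_nat (expt (\<Sum>t\<leftarrow>ws. H t) j)
          - of_nat (expt (exp_scale N (diag_monomial k n) + r) j)"
        using gd[of j] gws[OF ws j] gx[OF j] by simp
      then show "g j d = 0 \<longleftrightarrow> expt (\<Sum>t\<leftarrow>ws. H t) j
          = expt (exp_scale N (diag_monomial k n) + r) j"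
        by (metis eq_iff_diff_eq_0 of_nat_eq_iff)
    qed
    also have "\<dots> \<longleftrightarrow> (\<Sum>t\<leftarrow>ws. H t) = exp_scale N (diag_monomial k n) + r"
    proof
      assume eq: "\<forall>j\<in>{1..k}. expt (\<Sum>t\<leftarrow>ws. H t) j
        = expt (exp_scale N (diag_monomial k n) + r) j"
      show "(\<Sum>t\<leftarrow>ws. H t) = exp_scale N (diag_monomial k n) + r"
      proof (rule poly_mapping_eqI)
        fix j
        show "expt (\<Sum>t\<leftarrow>ws. H t) j
          = expt (exp_scale N (diag_monomial k n) + r) j"
        proof (cases "j \<in> {1..k}")
          case False
          then have "expt (exp_scale N (diag_monomial k n) + r) j = 0"
            unfolding lookup_add expt_exp_scale diag_monomial_exp_vec r_def expt_exp_vec by auto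
          then show ?thesis using H0[OF False] by simp
        qed (use eq in blast)
      qed
    qed simp
    finally show "(\<Sum>t\<leftarrow>ws. w t) = real n + \<epsilon> \<longleftrightarrow> (\<Sum>t\<leftarrow>ws. H t) = exp_scale N (diag_monomial k n) + r"
      by (simp add: x_def)
  qed (use k N vars_exp_vec in \<open>simp_all add: H_def r_def\<close>)
qed

lemma real_word_count_diagonal:
  fixes w :: "'a \<Rightarrow> real"
  assumes S: "finite S" "\<forall>t\<in>S. w t > 0" and \<epsilon>: "\<epsilon> \<ge> 0"
  shows "\<exists>k\<ge>1. \<exists>F\<in>N_rational k. \<forall>n.
    card {ws \<in> words S R E x. (\<Sum>t\<leftarrow>ws. w t) = real n + \<epsilon>} = F (diag_monomial k n)"
proof -
  from integral_weights[OF S \<epsilon>]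
  obtain k N :: nat and H r where kN: "k \<ge> 1" "N > 0"
    and H: "\<forall>t\<in>S. H t \<noteq> 0" "\<forall>t. vars (H t) \<subseteq> {1..k}" "vars r \<subseteq> {1..k}"
    and eq: "\<forall>ws n. set ws \<subseteq> S \<longrightarrow>
      ((\<Sum>t\<leftarrow>ws. w t) = real n + \<epsilon> \<longleftrightarrow> (\<Sum>t\<leftarrow>ws. H t) = exp_scale N (diag_monomial k n) + r)"
    by (elim exE conjE)
  define F where "F m = word_count S R E H x (exp_scale N m + r)" for m
  have "F \<in> N_rational k"
    unfolding F_def using S(1) H kN(2) by (intro word_count_N_rational) auto
  moreover have "card {ws \<in> words S R E x. (\<Sum>t\<leftarrow>ws. w t) = real n + \<epsilon>} = F (diag_monomial k n)" for n
    unfolding F_def word_count_def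
  proof (rule arg_cong[where f = card], rule Collect_cong, rule conj_cong[OF refl])
    fix ws assume "ws \<in> words S R E x"
    then have "set ws \<subseteq> S" by (simp add: words_def)
    then show "(\<Sum>t\<leftarrow>ws. w t) = real n + \<epsilon> \<longleftrightarrow> (\<Sum>t\<leftarrow>ws. H t) = exp_scale N (diag_monomial k n) + r"
      using eq by simp
  qed
  ultimately show ?thesis using kN(1) by blast
qed

section \<open>Pieces of the strip touching both sides\<close>

type_synonym region = "(real \<times> real) set"

text \<open>Meant for open subsets of the open strip, which miss the bottom line itself: the half
  squares record where such a set abuts that line.\<close>

definition foot :: "region \<Rightarrow> real set" where
  "foot U = {p. \<exists>d>0. {p-d<..<p+d} \<times> {0<..<d} \<subseteq> U}"

lemma foot_vertical:
  assumes "p \<in> foot U"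
  obtains d where "0 < d" "d < 1" "{p} \<times> {0<..d} \<subseteq> U"
proof -
  obtain d where d: "d > 0" "{p-d<..<p+d} \<times> {0<..<d} \<subseteq> U" using assms by (auto simp: foot_def)
  have "{p} \<times> {0<..min d 1 / 2} \<subseteq> {p-d<..<p+d} \<times> {0<..<d}" using d(1) by auto
  then show thesis using d by (intro that[of "min d 1 / 2"]) auto
qed

lemma foot_disjoint: "U \<inter> V = {} \<Longrightarrow> foot U \<inter> foot V = {}"
proof (rule ccontr)
  assume UV: "U \<inter> V = {}" and "foot U \<inter> foot V \<noteq> {}"
  then obtain p where p: "p \<in> foot U" "p \<in> foot V" by auto
  obtain d where d: "0 < d" "{p} \<times> {0<..d} \<subseteq> U" using foot_vertical[OF p(1)] by metis
  obtain e where e: "0 < e" "{p} \<times> {0<..e} \<subseteq> V" using foot_vertical[OF p(2)] by metis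
  have "(p, min d e) \<in> U \<inter> V" using d e by (auto simp: subset_iff)
  then show False using UV by auto
qed

lemma foot_mono: "U \<subseteq> V \<Longrightarrow> foot U \<subseteq> foot V"
  unfolding foot_def by blast

lemma open_foot: "open (foot U)"
  unfolding open_dist
proof (intro ballI)
  fix p assume "p \<in> foot U"
  then obtain d where d: "d > 0" "{p-d<..<p+d} \<times> {0<..<d} \<subseteq> U" by (auto simp: foot_def)
  have "y \<in> foot U" if "dist y p < d / 2" for y
  proof -
    have "{y-d/2<..<y+d/2} \<times> {0<..<d/2} \<subseteq> {p-d<..<p+d} \<times> {0<..<d}"
      using that[unfolded dist_real_def abs_less_iff] by auto
    then show ?thesis using d unfolding foot_def by (intro CollectI exI[of _ "d/2"]) auto
  qed
  then show "\<exists>e>0. \<forall>y. dist y p < e \<longrightarrow> y \<in> foot U" using d(1) by (intro exI[of _ "d/2"]) auto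
qed

text \<open>The Fashoda meet theorem, carried from \<open>real^2\<close> to pairs. With path
  connected sets in place of paths, arcs can later be prolonged by unions with segments, without
  joining parametrisations.\<close>

lemma cross_paths_meet:
  fixes S T :: "region"
  assumes "path_connected S" "path_connected T"
    and "S \<subseteq> {-M..M} \<times> {0..h}" "T \<subseteq> {-M..M} \<times> {0..h}"
    and "(-M, s) \<in> S" "(M, s') \<in> S" "(t, 0) \<in> T" "(t', h) \<in> T"
  shows "S \<inter> T \<noteq> {}"
proof -
  define \<phi> :: "real \<times> real \<Rightarrow> real^2" where "\<phi> z = (\<chi> i. if i = 1 then fst z else snd z)" for z
  have \<phi>[simp]: "\<phi> z $ 1 = fst z" "\<phi> z $ 2 = snd z" for z by (simp_all add: \<phi>_def)
  have cont: "continuous_on X \<phi>" for X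
    unfolding \<phi>_def
  proof (rule continuous_on_vec_lambda)
    fix i :: 2
    show "continuous_on X (\<lambda>z. if i = 1 then fst z else snd z)"
      by (cases "i = 1") (auto intro: continuous_on_fst continuous_on_snd continuous_on_id)
  qed
  have inj: "z = z'" if "\<phi> z = \<phi> z'" for z z' by (metis \<phi> that prod_eqI)
  obtain f where f: "path f" "path_image f \<subseteq> S" "pathstart f = (-M, s)" "pathfinish f = (M, s')"
    using assms unfolding path_connected_def by blast
  obtain g where g: "path g" "path_image g \<subseteq> T" "pathstart g = (t, 0)" "pathfinish g = (t', h)"
    using assms unfolding path_connected_def by blast
  have box: "\<phi> ` X \<subseteq> cbox (\<phi> (-M, 0)) (\<phi> (M, h))" if "X \<subseteq> {-M..M} \<times> {0..h}" for X
    using that by (auto simp: mem_box_cart forall_2)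
  obtain z where "z \<in> path_image (\<phi> \<circ> f)" "z \<in> path_image (\<phi> \<circ> g)"
  proof (rule fashoda[of "\<phi> \<circ> f" "\<phi> \<circ> g" "\<phi> (-M, 0)" "\<phi> (M, h)"])
    show "path (\<phi> \<circ> f)" "path (\<phi> \<circ> g)" using f g cont by (auto intro: path_continuous_image)
    show "path_image (\<phi> \<circ> f) \<subseteq> cbox (\<phi> (-M, 0)) (\<phi> (M, h))"
      "path_image (\<phi> \<circ> g) \<subseteq> cbox (\<phi> (-M, 0)) (\<phi> (M, h))"
      using f g assms by (auto simp only: path_image_compose intro!: box)
  qed (auto simp: pathstart_compose pathfinish_compose f g)
  then obtain x y where "x \<in> path_image f" "y \<in> path_image g" "\<phi> x = \<phi> y"
    by (auto simp: path_image_compose)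
  then show ?thesis using inj f(2) g(2) by blast
qed

text \<open>An arc in \<open>U\<close> from above \<open>p\<close> to above \<open>p'\<close> arches
  over the start of an arc in \<open>V\<close> that begins above \<open>q\<close> and climbs higher
  than the first one. Prolonged to the boundary of a box, the two are in the position of the Fashoda
  meet theorem.\<close>

lemma nested_bottoms_meet:
  assumes U: "open U" "connected U" "U \<subseteq> UNIV \<times> {0<..<1}" "p \<in> foot U" "p' \<in> foot U"
    and V: "open V" "connected V" "V \<subseteq> UNIV \<times> {0<..<1}" "q \<in> foot V"
    and high: "\<And>h. h < 1 \<Longrightarrow> \<exists>z\<in>V. h < snd z"
    and "p < q" "q < p'"
  shows "U \<inter> V \<noteq> {}"
proof
  assume UV: "U \<inter> V = {}"
  obtain d where d: "0 < d" "{p} \<times> {0<..d} \<subseteq> U" using foot_vertical[OF U(4)] by metis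
  obtain d' where d': "0 < d'" "{p'} \<times> {0<..d'} \<subseteq> U" using foot_vertical[OF U(5)] by metis
  obtain e where e: "0 < e" "{q} \<times> {0<..e} \<subseteq> V" using foot_vertical[OF V(4)] by metis
  have pU: "path_connected U" and pV: "path_connected V"
    using U V by (simp_all add: connected_open_path_connected)
  have "(p, d) \<in> U" "(p', d') \<in> U" "(q, e) \<in> V" using d d' e by auto
  with pU obtain f where
    f: "path f" "path_image f \<subseteq> U" "pathstart f = (p, d)" "pathfinish f = (p', d')"
    unfolding path_connected_def by metis
  have top: "\<exists>z\<in>path_image g. \<forall>w\<in>path_image g. snd w \<le> snd z" if "path g"
    for g :: "real \<Rightarrow> real \<times> real"
    using that by (intro continuous_attains_sup compact_path_image path_image_nonempty continuous_on_snd continuous_on_id)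
  \<comment> \<open>\<open>V\<close> reaches above the highest point of the first arc, so the
    highest point of the second arc lies on the upper edge of a box that contains both.\<close>
  obtain x where x: "x \<in> path_image f" "\<forall>w\<in>path_image f. snd w \<le> snd x" using top[OF f(1)] by blast
  then have "snd x < 1" using f(2) U(3) by (cases x) auto
  then obtain y where "y \<in> V" "snd x < snd y" using high by blast
  with pV \<open>(q, e) \<in> V\<close> obtain g where
    g: "path g" "path_image g \<subseteq> V" "pathstart g = (q, e)" "pathfinish g = y"
    unfolding path_connected_def by metis
  obtain z where z: "z \<in> path_image g" "\<forall>w\<in>path_image g. snd w \<le> snd z" using top[OF g(1)] by blast
  have ends: "(p, d) \<in> path_image f" "(p', d') \<in> path_image f" "(q, e) \<in> path_image g" "y \<in> path_image g"
    using f g by (metis pathstart_in_path_image pathfinish_in_path_image)+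
  define h where "h = snd z"
  have "snd y \<le> h" using z(2) ends(4) by (simp add: h_def)
  then have h: "snd w \<le> h" if "w \<in> path_image f \<union> path_image g" for w
    using that x(2) z(2) \<open>snd x < snd y\<close> by (fastforce simp: h_def)
  then have de: "d \<le> h" "d' \<le> h" "e \<le> h" using ends by fastforce+
  have "bounded (fst ` (path_image f \<union> path_image g))"
    using f(1) g(1) by (intro bounded_fst) (auto simp: bounded_path_image)
  then obtain B where B: "\<And>z. z \<in> path_image f \<union> path_image g \<Longrightarrow> \<bar>fst z\<bar> \<le> B"
    unfolding bounded_iff by (auto simp del: image_Un)
  define M where "M = B + \<bar>p\<bar> + \<bar>p'\<bar> + \<bar>q\<bar>"
  have "B \<ge> 0" using B[of "(p, d)"] ends by auto
  then have M: "-M \<le> p" "p \<le> M" "-M \<le> p'" "p' \<le> M" "-M \<le> q" "q \<le> M" by (auto simp: M_def)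
  \<comment> \<open>Along the bottom from the left wall to \<open>p\<close>, up, along the arc, down
    to \<open>p'\<close>, and along the bottom to the right wall. \<open>T\<close> needs only a drop
    to the bottom.\<close>
  define S where "S = {-M..p} \<times> {0} \<union> ({p} \<times> {0..d} \<union> (path_image f \<union> ({p'} \<times> {0..d'} \<union> {p'..M} \<times> {0})))"
  define T where "T = {q} \<times> {0..e} \<union> path_image g"
  have conv: "path_connected ({a..b} \<times> {c})" "path_connected ({c} \<times> {a..b})" for a b c :: real
    by (intro convex_imp_path_connected convex_Times; simp)+
  have un: "path_connected (A \<union> B)" if "path_connected A" "path_connected B" "z \<in> A" "z \<in> B"
    for A B :: region and z
    using that by (intro path_connected_Un) auto
  have "path_connected S"
    unfolding S_def
  proof (rule un[where z = "(p, 0)"], rule conv, rule un[where z = "(p, d)"], rule conv,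
      rule un[where z = "(p', d')"], rule path_connected_path_image[OF f(1)],
      rule un[where z = "(p', 0)"], rule conv, rule conv)
  qed (use M d d' ends in auto)
  moreover have "path_connected T"
    unfolding T_def
  proof (rule un[where z = "(q, e)"], rule conv, rule path_connected_path_image[OF g(1)])
  qed (use e ends in auto)
  moreover have box: "path_image f \<union> path_image g \<subseteq> {-M..M} \<times> {0..h}"
  proof
    fix w assume w: "w \<in> path_image f \<union> path_image g"
    then have "\<bar>fst w\<bar> \<le> M" using B[of w] by (simp add: M_def)
    moreover have "w \<in> UNIV \<times> {0<..<1}" using w f(2) g(2) U(3) V(3) by blast
    ultimately show "w \<in> {-M..M} \<times> {0..h}" using h[OF w] by (cases w) auto
  qed
  have "S \<subseteq> {-M..M} \<times> {0..h}"
    using box M de d(1) d'(1) unfolding S_def by (intro Un_least) (simp_all add: subset_iff)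
  moreover have "T \<subseteq> {-M..M} \<times> {0..h}"
    using box M de e(1) unfolding T_def by (intro Un_least) (simp_all add: subset_iff)
  moreover have "(-M, 0) \<in> S" "(M, 0) \<in> S" "(q, 0) \<in> T" "(fst z, h) \<in> T"
    using M e(1) z(1) by (simp_all add: S_def T_def h_def)
  ultimately have "S \<inter> T \<noteq> {}" by (intro cross_paths_meet)
  then obtain w where w: "w \<in> S" "w \<in> T" by auto
  have low: "{a} \<times> {0..d} \<subseteq> insert (a, 0) W" if "{a} \<times> {0<..d} \<subseteq> W" for a d :: real and W
  proof
    fix z assume "z \<in> {a} \<times> {0..d}"
    then have "z = (a, 0) \<or> z \<in> {a} \<times> {0<..d}" by (cases z) auto
    then show "z \<in> insert (a, 0) W" using that by blast
  qed
  \<comment> \<open>Outside \<open>U\<close> and \<open>V\<close> the prolonged sets have only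
    points of the bottom line, and there \<open>S\<close> keeps away from the open interval between
    \<open>p\<close> and \<open>p'\<close>, whereas \<open>T\<close> has only
    \<open>q\<close>.\<close>
  let ?S = "U \<union> ({..p} \<union> {p'..}) \<times> {0}" and ?T = "insert (q, 0) V"
  have "{p} \<times> {0..d} \<subseteq> ?S" by (rule order_trans[OF low[OF d(2)]]) auto
  moreover have "{p'} \<times> {0..d'} \<subseteq> ?S" by (rule order_trans[OF low[OF d'(2)]]) auto
  moreover have "path_image f \<subseteq> ?S" using f(2) by auto
  ultimately have S: "S \<subseteq> ?S" unfolding S_def by (intro Un_least) auto
  have T: "T \<subseteq> ?T" unfolding T_def using low[OF e(2)] g(2) by (intro Un_least) auto
  have "w \<in> U \<or> snd w = 0 \<and> (fst w \<le> p \<or> p' \<le> fst w)" using subsetD[OF S w(1)] by auto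
  moreover have "w \<in> V \<or> snd w = 0 \<and> fst w = q" using subsetD[OF T w(2)] by auto
  moreover have "0 < snd w" if "w \<in> U \<or> w \<in> V"
    using that subsetD[OF U(3), of w] subsetD[OF V(3), of w] by (cases w) auto
  ultimately show False
    using UV \<open>p < q\<close> \<open>q < p'\<close> by force
qed

section \<open>Pieces of the strip, their order from left to right, and rows\<close>

abbreviation strip :: "region" where
  "strip \<equiv> UNIV \<times> {0..1}"

definition lower :: "region \<Rightarrow> real set" where
  "lower P = foot (interior P)"

text \<open>The properties of tall tiles on which the order and the gluing rest. Bounded sets are
  not demanded, so that the half strips beside a tiling are pieces too. The last clause excludes
  isolated contacts with the bottom and is what makes neighbouring bottoms abut.\<close>

definition piece :: "region \<Rightarrow> bool" where
  "piece P \<longleftrightarrow> closed P \<and> P \<subseteq> strip \<and> P \<subseteq> closure (interior P) \<and> connected (interior P) \<and>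
     lower P \<noteq> {} \<and> (\<exists>x. (x, 1) \<in> P) \<and> (\<forall>x. (x, 0) \<in> P \<longrightarrow> x \<in> closure (lower P))"

definition left_of :: "region \<Rightarrow> region \<Rightarrow> bool" where
  "left_of P Q \<longleftrightarrow> (\<forall>p\<in>lower P. \<forall>q\<in>lower Q. p < q)"

definition before :: "region \<Rightarrow> region \<Rightarrow> bool" where
  "before P Q \<longleftrightarrow> left_of P Q \<and> interior P \<inter> interior Q = {}"

text \<open>Rows cover the whole strip rather than a rectangle, which makes the notion invariant
  under translation and lets pieces beyond a given one be exchanged freely.\<close>

definition row :: "region list \<Rightarrow> bool" where
  "row xs \<longleftrightarrow> (\<forall>P\<in>set xs. piece P) \<and> sorted_wrt before xs \<and> \<Union>(set xs) = strip"

lemma interior_strip: "P \<subseteq> strip \<Longrightarrow> interior P \<subseteq> UNIV \<times> {0<..<1}"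
  using interior_mono[of P strip] by (simp add: interior_Times)

lemma piece_closed: "piece P \<Longrightarrow> closed P" and piece_strip: "piece P \<Longrightarrow> P \<subseteq> strip"
  by (simp_all add: piece_def)

lemma piece_interior: "piece P \<Longrightarrow> interior P \<subseteq> UNIV \<times> {0<..<1}"
  by (simp add: piece_def interior_strip)

lemma piece_meets:
  assumes "piece P" "open W" "z \<in> W" "z \<in> P"
  obtains z' where "z' \<in> W" "z' \<in> interior P"
proof -
  have "z \<in> closure (interior P)" using assms by (auto simp: piece_def)
  then have "W \<inter> interior P \<noteq> {}"
    using open_Int_closure_eq_empty[OF assms(2)] assms(3) by blast
  then show thesis using that by blast
qed

lemma piece_reaches_top:
  assumes "piece P" "h < 1"
  shows "\<exists>z\<in>interior P. h < snd z"
proof -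
  obtain x where "(x, 1) \<in> P" using assms(1) by (auto simp: piece_def)
  moreover have "open (UNIV \<times> {h<..} :: region)" by (intro open_Times) auto
  moreover have "(x, 1) \<in> UNIV \<times> {h<..}" using assms(2) by simp
  ultimately obtain z where "z \<in> UNIV \<times> {h<..}" "z \<in> interior P"
    using piece_meets[OF assms(1)] by metis
  then show ?thesis by (intro bexI[of _ z]) auto
qed

text \<open>If neither bottom preceded the other, a bottom point of one piece would lie between two
  of the other, and \<open>nested_bottoms_meet\<close> would make the interiors overlap.\<close>

lemma left_of_total:
  assumes "piece P" "piece Q" "interior P \<inter> interior Q = {}"
  shows "left_of P Q \<or> left_of Q P"
proof (rule ccontr)
  have nest: "\<not> (p < q \<and> q < p')"
    if "piece P" "piece Q" "interior P \<inter> interior Q = {}" "p \<in> lower P" "p' \<in> lower P" "q \<in> lower Q"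
    for P Q p p' q
    using nested_bottoms_meet[of "interior P" p p' "interior Q" q]
      that piece_interior[of P] piece_interior[of Q] piece_reaches_top[of Q]
    by (auto simp: piece_def lower_def)
  have ne: "p \<noteq> q" if "p \<in> lower P" "q \<in> lower Q" for p q
    using foot_disjoint[OF assms(3)] that by (auto simp: lower_def)
  assume "\<not> ?thesis"
  then obtain p q p' q' where pq: "p \<in> lower P" "p' \<in> lower P" "q \<in> lower Q" "q' \<in> lower Q"
    and "\<not> p < q" "\<not> q' < p'"
    unfolding left_of_def by blast
  then have "q < p" "p' < q'" "p \<noteq> q'" using ne by force+
  then show False
    using nest[OF assms pq(2,1,4)] nest[of Q P, OF assms(2,1) _ pq(3,4,1)] assms(3) by fastforce
qed

lemma left_of_trans: "piece Q \<Longrightarrow> left_of P Q \<Longrightarrow> left_of Q R \<Longrightarrow> left_of P R"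
  unfolding left_of_def piece_def by fastforce

lemma left_of_asym: "piece P \<Longrightarrow> piece Q \<Longrightarrow> left_of P Q \<Longrightarrow> \<not> left_of Q P"
  unfolding left_of_def piece_def by fastforce

text \<open>
  If pieces on the two sides of \<open>P\<close> overlapped, their union would be a connected open set touching
  the bottom on both sides of \<open>P\<close>, although \<open>P\<close> joins the bottom to the top.
\<close>

lemma separated_by_piece:
  assumes pieces: "piece A" "piece P" "piece D" and "before A P" "before P D"
  shows "interior A \<inter> interior D = {}"
proof (rule ccontr)
  assume ne: "interior A \<inter> interior D \<noteq> {}"
  let ?U = "interior A \<union> interior D"
  have U: "open ?U" "connected ?U" "?U \<subseteq> UNIV \<times> {0<..<1}"
    using pieces ne piece_interior by (auto simp: piece_def intro!: connected_Un)
  obtain a p d where apd: "a \<in> lower A" "p \<in> lower P" "d \<in> lower D"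
    using pieces by (auto simp: piece_def)
  then have "a < p" "p < d" using assms(4,5) by (auto simp: before_def left_of_def)
  moreover have "a \<in> foot ?U" "d \<in> foot ?U"
    using apd foot_mono[of "interior A" ?U] foot_mono[of "interior D" ?U] by (auto simp: lower_def)
  ultimately have "?U \<inter> interior P \<noteq> {}"
    using nested_bottoms_meet[OF U _ _ open_interior _ piece_interior[OF pieces(2)] _
        piece_reaches_top[OF pieces(2)], of a d p] pieces(2) apd(2)
    by (simp add: piece_def lower_def)
  then show False using assms(4,5) by (auto simp: before_def)
qed

text \<open>This is the precise sense in which a piece determines the region to its left.
  Disjointness across \<open>P\<close> is \<open>separated_by_piece\<close>. A point missed by the
  new row lies in some \<open>X\<close> to the right of \<open>P\<close> in the first row, and a
  nearby interior point of \<open>X\<close> lies in some \<open>Y\<close> to the left of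
  \<open>P\<close> in the second row; \<open>X\<close> and \<open>Y\<close> then overlap across
  \<open>P\<close>.\<close>

lemma row_glue:
  assumes r1: "row (as @ P # bs)" and r2: "row (cs @ P # ds)"
  shows "row (as @ P # ds)"
proof -
  have pieces: "\<forall>X\<in>set as \<union> {P} \<union> set bs \<union> set cs \<union> set ds. piece X"
    using r1 r2 by (auto simp: row_def)
  have o1: "sorted_wrt before as" "\<forall>X\<in>set as. before X P" "\<forall>X\<in>set bs. before P X"
    using r1 by (auto simp: row_def sorted_wrt_append)
  have o2: "sorted_wrt before ds" "\<forall>X\<in>set cs. before X P" "\<forall>X\<in>set ds. before P X"
    using r2 by (auto simp: row_def sorted_wrt_append)
  have "before X Y" if "X \<in> set as" "Y \<in> set ds" for X Y
    unfolding before_def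
  proof
    show "left_of X Y" using that pieces o1 o2 left_of_trans[of P X Y] by (auto simp: before_def)
    show "interior X \<inter> interior Y = {}"
      using that pieces o1 o2 by (intro separated_by_piece[of X P Y]) auto
  qed
  then have "sorted_wrt before (as @ P # ds)"
    using o1 o2 by (auto simp: sorted_wrt_append)
  moreover have "\<Union>(set (as @ P # ds)) = strip"
  proof
    show "\<Union>(set (as @ P # ds)) \<subseteq> strip"
      by (rule Union_least, rule piece_strip) (use pieces in auto)
    show "strip \<subseteq> \<Union>(set (as @ P # ds))"
    proof (rule ccontr)
      let ?C = "\<Union>(set (as @ P # ds))"
      assume "\<not> strip \<subseteq> ?C"
      then obtain z where z: "z \<in> strip" "z \<notin> ?C" by blast
      have opn: "open (- ?C)"
        by (intro open_Compl closed_Union ballI piece_closed) (use pieces in auto)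
      have "z \<in> \<Union>(set (as @ P # bs))" using r1 z(1) unfolding row_def by blast
      then obtain X where X: "X \<in> set bs" "z \<in> X" using z(2) by auto
      then obtain y where y: "y \<in> - ?C" "y \<in> interior X"
        using piece_meets[OF _ opn, of X z] pieces z(2) by auto
      then have "y \<in> strip" using pieces X(1) interior_subset[of X] piece_strip by blast
      then have "y \<in> \<Union>(set (cs @ P # ds))" using r2 unfolding row_def by blast
      then obtain Y where Y: "Y \<in> set cs" "y \<in> Y" using y by auto
      then obtain x where "x \<in> interior X" "x \<in> interior Y"
        using piece_meets[OF _ open_interior y(2)] pieces by blast
      moreover have "interior Y \<inter> interior X = {}"
        using X Y pieces o1 o2 by (intro separated_by_piece[of Y P X]) auto
      ultimately show False by blast
    qed
  qed
  ultimately show ?thesis using pieces by (auto simp: row_def)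
qed

text \<open>A point of the bottom line in a gap would belong to a third piece, whose own bottom
  accumulates there by the last clause of \<open>piece\<close>. But such a piece lies to the left of
  \<open>P\<close> or to the right of \<open>Q\<close>. Hence order and widths determine all
  positions.\<close>

lemma row_adjacent:
  assumes "row (as @ P # Q # bs)"
  shows "Sup (lower P) = Inf (lower Q)"
proof -
  let ?u = "Sup (lower P)" and ?v = "Inf (lower Q)"
  have pieces: "\<forall>X\<in>set as \<union> {P, Q} \<union> set bs. piece X" using assms by (auto simp: row_def)
  have o: "left_of P Q" "\<forall>X\<in>set as. left_of X P" "\<forall>X\<in>set bs. left_of Q X"
    using assms by (auto simp: row_def sorted_wrt_append before_def)
  have ne: "lower P \<noteq> {}" "lower Q \<noteq> {}" using pieces by (auto simp: piece_def)
  have bdd: "bdd_above (lower P)" "bdd_below (lower Q)"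
    using o(1) ne unfolding left_of_def bdd_above_def bdd_below_def by (meson ex_in_conv less_imp_le)+
  have "?u \<le> ?v"
    using o(1) ne by (intro cSup_least cInf_greatest) (auto simp: left_of_def intro: less_imp_le)
  moreover have "\<not> ?u < ?v"
  proof
    assume "?u < ?v"
    define x where "x = (?u + ?v) / 2"
    have x: "?u < x" "x < ?v" using \<open>?u < ?v\<close> by (auto simp: x_def)
    have "(x, 0) \<in> \<Union>(set (as @ P # Q # bs))" using assms by (auto simp: row_def)
    then obtain R where R: "R \<in> set as \<union> {P, Q} \<union> set bs" "(x, 0) \<in> R" by auto
    then have "x \<in> closure (lower R)" using pieces by (auto simp: piece_def)
    then have "{?u<..<?v} \<inter> lower R \<noteq> {}"
      using open_Int_closure_eq_empty[of "{?u<..<?v}" "lower R"] x by auto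
    then obtain y where y: "?u < y" "y < ?v" "y \<in> lower R" by auto
    have "y \<notin> lower P" using y bdd cSup_upper[of y "lower P"] by auto
    moreover have "y \<notin> lower Q" using y bdd cInf_lower[of y "lower Q"] by auto
    ultimately consider "R \<in> set as" | "R \<in> set bs" using R y by auto
    then show False
    proof cases
      case 1
      obtain p where p: "p \<in> lower P" using ne by auto
      then have "y < p" using 1 o y by (auto simp: left_of_def)
      moreover have "p \<le> ?u" using p bdd by (intro cSup_upper)
      ultimately show False using y by simp
    next
      case 2
      obtain q where q: "q \<in> lower Q" using ne by auto
      then have "q < y" using 2 o y by (auto simp: left_of_def)
      moreover have "?v \<le> q" using q bdd by (intro cInf_lower)
      ultimately show False using y by simp
    qed
  qed
  ultimately show ?thesis by simp
qed

section \<open>Horizontal translations\<close>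

definition shift :: "real \<Rightarrow> region \<Rightarrow> region" where
  "shift s P = (+) (s, 0) ` P"

lemma shift_shift [simp]: "shift s (shift t P) = shift (s + t) P"
  by (simp add: shift_def image_image add.assoc[symmetric])

lemma shift_0 [simp]: "shift 0 P = P"
  by (simp add: shift_def zero_prod_def[symmetric])

lemma mem_shift: "(x, y) \<in> shift s P \<longleftrightarrow> (x - s, y) \<in> P"
  unfolding shift_def by (auto intro: image_eqI[of _ _ "(x - s, y)"])

lemma shift_subset_strip [simp]: "shift s P \<subseteq> strip \<longleftrightarrow> P \<subseteq> strip"
proof -
  have "shift s P \<subseteq> strip" if "P \<subseteq> strip" for s P
    using that by (auto simp: subset_iff mem_shift)
  from this[of P s] this[of "shift s P" "-s"] show ?thesis by auto
qed

lemma interior_shift: "interior (shift s P) = shift s (interior P)"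
  unfolding shift_def by (rule interior_translation)

lemma closure_shift: "closure (shift s P) = shift s (closure P)"
  unfolding shift_def by (rule closure_translation)

lemma foot_shift: "foot (shift s U) = (+) s ` foot U"
proof -
  have *: "(+) s ` foot U \<subseteq> foot (shift s U)" for s U
  proof
    fix q assume "q \<in> (+) s ` foot U"
    then obtain p where p: "q = s + p" "p \<in> foot U" by auto
    then obtain d where d: "d > 0" "{p-d<..<p+d} \<times> {0<..<d} \<subseteq> U" by (auto simp: foot_def)
    have "{q-d<..<q+d} \<times> {0<..<d} \<subseteq> shift s U"
    proof clarify
      fix x y assume "x \<in> {q-d<..<q+d}" "y \<in> {0<..<d}"
      then have "(x - s, y) \<in> {p-d<..<p+d} \<times> {0<..<d}" using p by auto
      then show "(x, y) \<in> shift s U" using d(2) unfolding mem_shift by blast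
    qed
    then show "q \<in> foot (shift s U)" using d(1) by (auto simp: foot_def)
  qed
  have "foot (shift s U) = (+) s ` (+) (- s) ` foot (shift s U)" by (simp add: image_image)
  also have "\<dots> \<subseteq> (+) s ` foot (shift (- s) (shift s U))" by (intro image_mono *)
  finally show ?thesis using *[of s U] by auto
qed

lemma lower_shift: "lower (shift s P) = (+) s ` lower P"
  by (simp add: lower_def interior_shift foot_shift)

lemma piece_shift: "piece P \<Longrightarrow> piece (shift s P)"
  unfolding piece_def
proof (elim conjE, intro conjI allI impI)
  assume P: "closed P" "P \<subseteq> strip" "P \<subseteq> closure (interior P)" "connected (interior P)"
    "lower P \<noteq> {}" "\<exists>x. (x, 1) \<in> P" "\<forall>x. (x, 0) \<in> P \<longrightarrow> x \<in> closure (lower P)"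
  show "closed (shift s P)" unfolding shift_def by (rule closed_translation) (rule P)
  show "shift s P \<subseteq> strip" using P by simp
  show "shift s P \<subseteq> closure (interior (shift s P))"
    unfolding interior_shift closure_shift using P(3) by (auto simp: shift_def)
  show "connected (interior (shift s P))"
    unfolding interior_shift unfolding shift_def using P(4)
    by (intro connected_continuous_image continuous_intros)
  show "lower (shift s P) \<noteq> {}" using P by (simp add: lower_shift)
  obtain x where "(x, 1) \<in> P" using P(6) by blast
  then have "(s + x, 1) \<in> shift s P" by (simp add: mem_shift)
  then show "\<exists>x. (x, 1) \<in> shift s P" ..
  fix x assume "(x, 0) \<in> shift s P"
  then have "x - s \<in> closure (lower P)" using P(7) by (simp add: mem_shift)
  then have "s + (x - s) \<in> (+) s ` closure (lower P)" by blast
  then show "x \<in> closure (lower (shift s P))" by (simp add: lower_shift closure_translation)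
qed

lemma before_shift: "before P Q \<Longrightarrow> before (shift s P) (shift s Q)"
  unfolding before_def left_of_def
  by (auto simp: lower_shift interior_shift) (auto simp: shift_def)

lemma shift_strip: "shift s strip = strip"
  by (auto simp: mem_shift set_eq_iff)

lemma row_shift: "row xs \<Longrightarrow> row (map (shift s) xs)"
  unfolding row_def
proof (elim conjE, intro conjI)
  assume xs: "\<forall>P\<in>set xs. piece P" "sorted_wrt before xs" "\<Union>(set xs) = strip"
  show "\<forall>P\<in>set (map (shift s) xs). piece P" using xs(1) piece_shift by auto
  show "sorted_wrt before (map (shift s) xs)"
    unfolding sorted_wrt_map by (rule sorted_wrt_mono_rel[OF _ xs(2)]) (rule before_shift)
  have "\<Union>(set (map (shift s) xs)) = shift s (\<Union>(set xs))" by (auto simp: shift_def)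
  then show "\<Union>(set (map (shift s) xs)) = strip" by (simp only: xs(3) shift_strip)
qed

section \<open>Layered pieces\<close>

definition level :: "nat \<Rightarrow> nat \<Rightarrow> real set" where
  "level N b = {real b / real N .. (real b + 1) / real N}"

text \<open>A common form for half strips (one level) and jigsaw tiles (many levels), in which
  topological questions reduce to the sections on the line.\<close>

definition layered :: "nat \<Rightarrow> (nat \<Rightarrow> real set) \<Rightarrow> region" where
  "layered N A = (\<Union>b<N. A b \<times> level N b)"

text \<open>The abscissa \<open>c\<close> gives a vertical line crossed by all bars; connectedness
  and contractibility are obtained by sliding horizontally to it.\<close>

definition sections :: "nat \<Rightarrow> (nat \<Rightarrow> real set) \<Rightarrow> bool" where
  "sections N A \<longleftrightarrow> N > 0 \<and> (\<forall>b<N. closed (A b) \<and> convex (A b)) \<and> (\<exists>c. \<forall>b<N. c \<in> interior (A b))"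

lemma level_strip: "b < N \<Longrightarrow> level N b \<subseteq> {0..1}"
  by (auto simp: level_def field_simps)

lemma interior_level: "interior (level N b) = {real b / real N <..< (real b + 1) / real N}"
  by (simp add: level_def)

lemma closure_interior_level: "N > 0 \<Longrightarrow> closure (interior (level N b)) = level N b"
  by (simp add: interior_level) (simp add: level_def divide_strict_right_mono)

lemma interior_levels_disjoint:
  assumes "y \<in> interior (level N b)" "y \<in> interior (level N b')" "N > 0"
  shows "b = b'"
proof -
  have "real b < y * N" "y * N < real b + 1" "real b' < y * N" "y * N < real b' + 1"
    using assms by (auto simp: interior_level field_simps)
  then have "real b < real b' + 1" "real b' < real b + 1" by linarith+
  then show ?thesis by linarith
qed

lemma ex_level:
  assumes "0 \<le> y" "y \<le> 1" "N > 0"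
  shows "\<exists>b<N. y \<in> level N b"
proof (cases "y = 1")
  case True
  then show ?thesis using assms(3) by (intro exI[of _ "N - 1"]) (auto simp: level_def field_simps of_nat_diff)
next
  case False
  define b where "b = nat \<lfloor>y * N\<rfloor>"
  have "real b \<le> y * N" "y * N < real b + 1"
    using assms by (auto simp: b_def)
  moreover have "y * N < N" using False assms by simp
  moreover from calculation have "real b < real N" by linarith
  ultimately have "b < N" "y \<in> level N b" using assms(3) by (auto simp: level_def field_simps)
  then show ?thesis by blast
qed

lemma interior_layered_supset: "b < N \<Longrightarrow> interior (A b) \<times> interior (level N b) \<subseteq> interior (layered N A)"
  by (rule interior_maximal) (use interior_subset in \<open>fastforce simp: layered_def intro: open_Times\<close>)+

lemma layered_subset_closure:
  assumes "sections N A"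
  shows "layered N A \<subseteq> closure (\<Union>b<N. interior (A b) \<times> interior (level N b))"
proof -
  have "A b \<times> level N b \<subseteq> closure (\<Union>b<N. interior (A b) \<times> interior (level N b))" if "b < N" for b
  proof -
    have "interior (A b) \<noteq> {}" "convex (A b)" "closed (A b)"
      using assms that by (auto simp: sections_def)
    then have "A b = closure (interior (A b))" by (simp add: convex_closure_interior)
    moreover have "level N b = closure (interior (level N b))"
      using assms by (simp add: closure_interior_level sections_def)
    ultimately have "A b \<times> level N b = closure (interior (A b) \<times> interior (level N b))"
      by (metis closure_Times)
    also have "\<dots> \<subseteq> closure (\<Union>b<N. interior (A b) \<times> interior (level N b))"
      using that by (intro closure_mono) auto
    finally show ?thesis .
  qed
  then show ?thesis by (auto simp: layered_def)
qed

lemma layered_subset_strip: "layered N A \<subseteq> strip"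
  unfolding layered_def using level_strip by (intro UN_least Sigma_mono) auto

lemma interior_layered_column:
  assumes A: "sections N A" and c: "\<And>b. b < N \<Longrightarrow> c \<in> interior (A b)" and y: "0 < y" "y < 1"
  shows "(c, y) \<in> interior (layered N A)"
proof -
  define I where "I = (\<Inter>b<N. interior (A b))"
  have "I \<times> {0<..<1} \<subseteq> interior (layered N A)"
  proof (rule interior_maximal)
    show "open (I \<times> {0<..<1::real})" unfolding I_def by (intro open_Times open_INT) auto
    show "I \<times> {0<..<1} \<subseteq> layered N A"
    proof clarify
      fix x y :: real assume xy: "x \<in> I" "y \<in> {0<..<1}"
      then obtain b where "b < N" "y \<in> level N b" using ex_level[of y N] A by (auto simp: sections_def)
      moreover from this have "x \<in> A b" using xy interior_subset by (auto simp: I_def)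
      ultimately show "(x, y) \<in> layered N A" by (auto simp: layered_def)
    qed
  qed
  then show ?thesis using c y by (auto simp: I_def)
qed

text \<open>Each interior point is joined to the column at \<open>c\<close> by a horizontal segment.
  The segment stays in the interior because horizontal contraction towards the column maps the set
  into itself and, short of the column, is a homeomorphism of the plane.\<close>

lemma connected_interior_layered:
  assumes A: "sections N A"
  shows "connected (interior (layered N A))"
proof -
  obtain c where c: "\<And>b. b < N \<Longrightarrow> c \<in> interior (A b)" using A by (auto simp: sections_def)
  let ?U = "interior (layered N A)"
  have col: "{c} \<times> {0<..<1} \<subseteq> ?U" using interior_layered_column[OF A c] by auto
  have band: "?U \<subseteq> UNIV \<times> {0<..<1}" by (rule interior_strip[OF layered_subset_strip])
  define L where "L z = closed_segment (fst z) c \<times> {snd z} \<union> {c} \<times> {0<..<1}" for z :: "real \<times> real"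
  have seg: "((1 - t) * x + t * c, y) \<in> ?U" if xy: "(x, y) \<in> ?U" and t: "0 \<le> t" "t \<le> 1" for x y t
  proof (cases "t = 1")
    case True
    then show ?thesis using col band xy by auto
  next
    case False
    \<comment> \<open>The image of the interior under contraction by the factor
      \<open>1 - t\<close>, written as a preimage under the inverse map so that openness is
      immediate.\<close>
    define W where "W = (\<lambda>w. ((fst w - t * c) / (1 - t), snd w)) -` ?U"
    have "open W" unfolding W_def
      by (intro open_vimage continuous_intros open_interior) (use False in auto)
    moreover have "W \<subseteq> layered N A"
    proof
      fix w assume "w \<in> W"
      then have "((fst w - t * c) / (1 - t), snd w) \<in> layered N A"
        using interior_subset by (auto simp: W_def)
      then obtain b where b: "b < N" "(fst w - t * c) / (1 - t) \<in> A b" "snd w \<in> level N b"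
        by (auto simp: layered_def)
      have "c \<in> A b" using c[OF b(1)] interior_subset by blast
      then have "(1 - t) *\<^sub>R ((fst w - t * c) / (1 - t)) + t *\<^sub>R c \<in> A b"
        using A b t by (intro convexD) (auto simp: sections_def)
      then have "fst w \<in> A b" using False by simp
      then show "w \<in> layered N A" using b by (cases w) (auto simp: layered_def)
    qed
    ultimately have "W \<subseteq> ?U" by (intro interior_maximal)
    moreover have "((1 - t) * x + t * c, y) \<in> W" using xy False by (simp add: W_def)
    ultimately show ?thesis by blast
  qed
  have "L z \<subseteq> ?U" if "z \<in> ?U" for z
  proof -
    have "closed_segment (fst z) c \<times> {snd z} \<subseteq> ?U"
      using seg[of "fst z" "snd z"] that by (auto simp: in_segment)
    then show ?thesis using col by (auto simp: L_def)
  qed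
  moreover have "z \<in> L z" for z by (cases z) (auto simp: L_def)
  ultimately have U: "?U = (\<Union>z\<in>?U. L z)" by blast
  have "connected (L z)" if "z \<in> ?U" for z
    unfolding L_def
  proof (intro connected_Un connected_Times)
    have "(c, snd z) \<in> closed_segment (fst z) c \<times> {snd z} \<inter> {c} \<times> {0<..<1}"
      using subsetD[OF band that] by (cases z) auto
    then show "closed_segment (fst z) c \<times> {snd z} \<inter> {c} \<times> {0<..<1} \<noteq> {}" by blast
  qed auto
  moreover have "(c, 1/2) \<in> L z" for z by (auto simp: L_def)
  ultimately show ?thesis by (subst U, intro connected_Union) blast+
qed

lemma lower_layered:
  assumes A: "sections N A"
  shows "lower (layered N A) = interior (A 0)"
proof
  have N: "N > 0" using A by (simp add: sections_def)
  show "lower (layered N A) \<subseteq> interior (A 0)"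
  proof
    fix p assume "p \<in> lower (layered N A)"
    then obtain \<delta> where \<delta>: "\<delta> > 0" "{p-\<delta><..<p+\<delta>} \<times> {0<..<\<delta>} \<subseteq> interior (layered N A)"
      by (auto simp: lower_def foot_def)
    have "{p-\<delta><..<p+\<delta>} \<subseteq> A 0"
    proof
      fix x assume x: "x \<in> {p-\<delta><..<p+\<delta>}"
      define e where "e = 1 / real N"
      define y where "y = min \<delta> e / 2"
      have "e > 0" using N by (simp add: e_def)
      then have y: "0 < y" "y < \<delta>" "y < e" using \<delta>(1) by (auto simp: y_def)
      then have "(x, y) \<in> {p-\<delta><..<p+\<delta>} \<times> {0<..<\<delta>}" using x by simp
      then have "(x, y) \<in> layered N A" using \<delta>(2) interior_subset by blast
      then obtain b where b: "b < N" "x \<in> A b" "y \<in> level N b" by (auto simp: layered_def)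
      then have "real b / N < 1 / N" using y(3) unfolding e_def level_def by simp
      then have "b = 0" using N by (simp add: divide_less_cancel)
      then show "x \<in> A 0" using b by simp
    qed
    then have "{p-\<delta><..<p+\<delta>} \<subseteq> interior (A 0)" by (intro interior_maximal) auto
    then show "p \<in> interior (A 0)" using \<delta>(1) by auto
  qed
  show "interior (A 0) \<subseteq> lower (layered N A)"
  proof
    fix p assume "p \<in> interior (A 0)"
    then obtain \<delta> where \<delta>: "\<delta> > 0" "ball p \<delta> \<subseteq> interior (A 0)"
      using open_interior open_contains_ball by metis
    define \<epsilon> where "\<epsilon> = min \<delta> (1 / N)"
    have "{p-\<epsilon><..<p+\<epsilon>} \<subseteq> ball p \<delta>" by (auto simp: \<epsilon>_def dist_real_def)
    then have "{p-\<epsilon><..<p+\<epsilon>} \<times> {0<..<\<epsilon>} \<subseteq> interior (A 0) \<times> interior (level N 0)"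
      using \<delta> N by (auto simp: interior_level \<epsilon>_def)
    also have "\<dots> \<subseteq> interior (layered N A)" by (rule interior_layered_supset[OF N])
    finally show "p \<in> lower (layered N A)"
      unfolding lower_def foot_def using \<delta>(1) N by (intro CollectI exI[of _ \<epsilon>]) (auto simp: \<epsilon>_def)
  qed
qed

lemma piece_layered:
  assumes A: "sections N A"
  shows "piece (layered N A)"
  unfolding piece_def
proof (intro conjI allI impI)
  have N: "N > 0" using A by (simp add: sections_def)
  obtain c where c: "\<And>b. b < N \<Longrightarrow> c \<in> interior (A b)" using A by (auto simp: sections_def)
  show "closed (layered N A)"
    unfolding layered_def level_def using A
    by (intro closed_UN ballI closed_Times closed_atLeastAtMost) (auto simp: sections_def)
  show "layered N A \<subseteq> strip" by (rule layered_subset_strip)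
  have "(\<Union>b<N. interior (A b) \<times> interior (level N b)) \<subseteq> interior (layered N A)"
    using interior_layered_supset by blast
  then show "layered N A \<subseteq> closure (interior (layered N A))"
    using layered_subset_closure[OF A] closure_mono by blast
  show "connected (interior (layered N A))" by (rule connected_interior_layered[OF A])
  show "lower (layered N A) \<noteq> {}" using lower_layered[OF A] c[OF N] by auto
  have "c \<in> A (N - 1)" "1 \<in> level N (N - 1)"
    using c[of "N - 1"] N interior_subset by (auto simp: level_def of_nat_diff)
  then have "(c, 1) \<in> layered N A" using N unfolding layered_def by force
  then show "\<exists>x. (x, 1) \<in> layered N A" ..
  fix x assume "(x, 0) \<in> layered N A"
  then obtain b where b: "b < N" "x \<in> A b" "0 \<in> level N b" by (auto simp: layered_def)
  then have "b = 0" using N by (auto simp: level_def divide_le_0_iff)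
  then have "x \<in> A 0" using b by simp
  also have "A 0 = closure (interior (A 0))"
    using A N c[OF N] by (subst convex_closure_interior) (auto simp: sections_def)
  finally show "x \<in> closure (lower (layered N A))" using lower_layered[OF A] by simp
qed

lemma open_subset_closure_meets:
  assumes "open W" "W \<noteq> {}" "W \<subseteq> closure A"
  shows "W \<inter> A \<noteq> {}"
  using open_Int_closure_eq_empty[OF assms(1), of A] assms(2,3) by (simp add: Int_absorb2)

text \<open>Open bars are dense in a layered set, so a nonempty open overlap would contain a point
  of open bars of both sets, necessarily at the same level. The edges between levels need no
  separate treatment.\<close>

lemma interior_layered_disjoint:
  assumes A: "sections N A" and B: "sections N B"
    and disj: "\<And>b. b < N \<Longrightarrow> interior (A b) \<inter> interior (B b) = {}"
  shows "interior (layered N A) \<inter> interior (layered N B) = {}"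
proof (rule ccontr)
  let ?A = "\<Union>b<N. interior (A b) \<times> interior (level N b)"
  let ?B = "\<Union>b<N. interior (B b) \<times> interior (level N b)"
  let ?W = "interior (layered N A) \<inter> interior (layered N B)"
  assume ne: "?W \<noteq> {}"
  have "?W \<subseteq> closure ?A" using layered_subset_closure[OF A] interior_subset by blast
  then have "?W \<inter> ?A \<noteq> {}"
    using ne by (intro open_subset_closure_meets[OF open_Int[OF open_interior open_interior]])
  moreover have "?W \<inter> ?A \<subseteq> closure ?B" using layered_subset_closure[OF B] interior_subset by blast
  moreover have "open (?W \<inter> ?A)" by (intro open_Int open_UN ballI open_Times) auto
  ultimately have "(?W \<inter> ?A) \<inter> ?B \<noteq> {}" by (rule open_subset_closure_meets[rotated 1])
  then obtain x y b b' where xy: "b < N" "b' < N" "x \<in> interior (A b)" "y \<in> interior (level N b)"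
    "x \<in> interior (B b')" "y \<in> interior (level N b')" by auto
  then have "b = b'" using interior_levels_disjoint A by (auto simp: sections_def)
  then show False using xy disj by blast
qed

section \<open>Half strips and finite unions of rectangles as pieces\<close>

definition left_half :: "real \<Rightarrow> region" where
  "left_half a = {..a} \<times> {0..1}"

definition right_half :: "real \<Rightarrow> region" where
  "right_half a = {a..} \<times> {0..1}"

lemma sections_1: "closed X \<Longrightarrow> convex X \<Longrightarrow> interior X \<noteq> {} \<Longrightarrow> sections 1 (\<lambda>_. X)"
  by (auto simp: sections_def)

lemma layered_1: "layered 1 (\<lambda>_. X) = X \<times> {0..1}"
  by (auto simp: layered_def level_def)

lemma piece_left_half [simp]: "piece (left_half a)" and lower_left_half [simp]: "lower (left_half a) = {..<a}"
  using piece_layered[OF sections_1[of "{..a}"]] lower_layered[OF sections_1[of "{..a}"]]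
  unfolding layered_1 left_half_def by (auto simp: not_less lt_ex)

lemma piece_right_half [simp]: "piece (right_half a)" and lower_right_half [simp]: "lower (right_half a) = {a<..}"
  using piece_layered[OF sections_1[of "{a..}"]] lower_layered[OF sections_1[of "{a..}"]]
  unfolding layered_1 right_half_def by (auto simp: gt_ex)

lemma shift_right_half [simp]: "shift s (right_half a) = right_half (s + a)"
  by (auto simp: right_half_def mem_shift)

text \<open>A rectangle inside the strip that has a point at height 0 must have its lower edge
  there, so its open base consists of foot points. This yields the bottom clauses of
  \<open>piece\<close>.\<close>

lemma rectangles_piece:
  assumes B: "finite B" "\<And>R. R \<in> B \<Longrightarrow> \<exists>a b c d. a < b \<and> c < d \<and> R = {a..b} \<times> {c..d :: real}"
    and S: "S = \<Union>B" "connected (interior S)" "S \<subseteq> strip" "0 \<in> snd ` S" "1 \<in> snd ` S"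
  shows "piece S" and "bounded S"
proof -
  have "closed R \<and> bounded R" if "R \<in> B" for R
    using B(2)[OF that] by (auto intro: closed_Times bounded_Times)
  then have "closed S" and "bounded S" using B(1) S(1) by auto
  then show "bounded S" by simp
  have cl: "R \<subseteq> closure (interior S)" if "R \<in> B" for R
  proof -
    from B(2)[OF that] obtain a b c d where R: "a < b" "c < d" "R = {a..b} \<times> {c..d}" by auto
    then have "R = closure (interior R)" by (simp add: interior_Times closure_Times)
    also have "\<dots> \<subseteq> closure (interior S)" using that S(1) by (intro closure_mono interior_mono) auto
    finally show ?thesis .
  qed
  have bot: "x \<in> closure (lower S)" "lower S \<noteq> {}" if x: "(x, 0) \<in> S" for x
  proof -
    obtain R where "R \<in> B" "(x, 0) \<in> R" using x S(1) by auto
    moreover from B(2)[OF this(1)] obtain a b c d where R: "a < b" "c < d" "R = {a..b} \<times> {c..d}" by auto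
    ultimately have ab: "a \<le> x" "x \<le> b" "c \<le> 0" "0 \<le> d" and sub: "{a..b} \<times> {c..d} \<subseteq> S"
      using S(1) by auto
    have "(a, c) \<in> strip" using sub S(3) R by (meson SigmaI atLeastAtMost_iff less_imp_le order_refl subsetD)
    then have "c = 0" using ab by simp
    have "{a<..<b} \<subseteq> lower S"
    proof
      fix p assume p: "p \<in> {a<..<b}"
      define \<delta> where "\<delta> = min (min (p - a) (b - p)) d"
      have "{p-\<delta><..<p+\<delta>} \<times> {0<..<\<delta>} \<subseteq> {a..b} \<times> {c..d}" using \<open>c = 0\<close> by (auto simp: \<delta>_def)
      then have "{p-\<delta><..<p+\<delta>} \<times> {0<..<\<delta>} \<subseteq> interior S"
        using sub by (intro interior_maximal open_Times) auto
      moreover have "\<delta> > 0" using p R \<open>c = 0\<close> by (simp add: \<delta>_def)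
      ultimately show "p \<in> lower S" by (auto simp: lower_def foot_def)
    qed
    moreover from this have "closure {a<..<b} \<subseteq> closure (lower S)" by (rule closure_mono)
    ultimately show "x \<in> closure (lower S)" "lower S \<noteq> {}" using R(1) ab by auto
  qed
  have top: "\<exists>x. (x, 1) \<in> S" using S(5) by auto
  obtain x where x: "(x, 0) \<in> S" using S(4) by auto
  show "piece S"
    unfolding piece_def using \<open>closed S\<close> S bot bot(2)[OF x] top cl by blast
qed

section \<open>Tilings as words\<close>

text \<open>The right end of the bottom. It is the length of the extent of the bottom when this
  starts at 0, as in \<open>prototile\<close>; for a left half strip it is the place where the next
  piece starts.\<close>

definition width :: "region \<Rightarrow> real" where
  "width P = Sup (lower P)"

fun place :: "real \<Rightarrow> region list \<Rightarrow> region list" where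
  "place s [] = []"
| "place s (t # ts) = shift s t # place (s + width t) ts"

lemma interior_left_half: "interior (left_half a) = {..<a} \<times> {0<..<1}"
  by (simp add: left_half_def interior_Times)

lemma interior_right_half: "interior (right_half a) = {a<..} \<times> {0<..<1}"
  by (simp add: right_half_def interior_Times)

lemma before_halves: "a \<le> b \<Longrightarrow> before (left_half a) (right_half b)"
  by (auto simp: before_def left_of_def interior_left_half interior_right_half)

lemma row_halves: "row [left_half a, right_half a]"
proof -
  have "left_half a \<union> right_half a = strip" by (auto simp: left_half_def right_half_def)
  then show ?thesis by (simp add: row_def before_halves)
qed

lemma width_left_half [simp]: "width (left_half a) = a"
  by (simp add: width_def)

lemma Sup_translate:
  fixes A :: "real set"
  assumes "A \<noteq> {}" "bdd_above A"
  shows "Sup ((+) s ` A) = s + Sup A"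
  using Sup_add_eq[of "\<lambda>x. x" A s] assms by simp

lemma Inf_translate:
  fixes A :: "real set"
  assumes "A \<noteq> {}" "bdd_below A"
  shows "Inf ((+) s ` A) = s + Inf A"
  using Inf_add_eq[of "\<lambda>x. x" A s] assms by simp

definition prototile :: "region \<Rightarrow> bool" where
  "prototile P \<longleftrightarrow> piece P \<and> bounded P \<and> Inf (lower P) = 0"

lemma bounded_lower: "bounded P \<Longrightarrow> bounded (lower P)"
proof -
  assume "bounded P"
  then have "bounded (fst ` P)" by (rule bounded_fst)
  moreover have "lower P \<subseteq> fst ` P"
  proof
    fix p assume "p \<in> lower P"
    then obtain \<delta> where "0 < \<delta>" "{p} \<times> {0<..\<delta>} \<subseteq> interior P"
      using foot_vertical[of p "interior P"] unfolding lower_def by metis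
    then have "(p, \<delta>) \<in> P" using interior_subset by fastforce
    then show "p \<in> fst ` P" by force
  qed
  ultimately show ?thesis by (rule bounded_subset)
qed

lemma prototile_lower:
  assumes "prototile P"
  shows "lower P \<noteq> {}" "bdd_above (lower P)" "bdd_below (lower P)"
    and "Sup (lower (shift s P)) = s + width P" "Inf (lower (shift s P)) = s"
proof -
  show ne: "lower P \<noteq> {}" using assms by (simp add: prototile_def piece_def)
  have "bounded (lower P)" using assms by (simp add: prototile_def bounded_lower)
  then show b: "bdd_above (lower P)" "bdd_below (lower P)"
    by (auto intro: bounded_imp_bdd_above bounded_imp_bdd_below)
  show "Sup (lower (shift s P)) = s + width P" "Inf (lower (shift s P)) = s"
    using assms by (simp_all add: lower_shift Sup_translate Inf_translate ne b width_def prototile_def)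
qed

lemma prototile_width_pos:
  assumes "prototile P"
  shows "0 < width P"
proof -
  obtain p where p: "p \<in> lower P" using prototile_lower(1)[OF assms] by auto
  have "open (lower P)" unfolding lower_def by (rule open_foot)
  then obtain e where e: "e > 0" "ball p e \<subseteq> lower P" using p open_contains_ball by blast
  then have "p + e / 2 \<in> lower P" by (auto simp: dist_real_def subset_iff)
  then have "p + e / 2 \<le> width P" unfolding width_def using prototile_lower(2)[OF assms] by (rule cSup_upper)
  moreover have "0 \<le> p" using cInf_lower[OF p prototile_lower(3)[OF assms]] assms by (simp add: prototile_def)
  ultimately show ?thesis using e(1) by linarith
qed

lemma shift_inj: "shift s P = shift s Q \<longleftrightarrow> P = Q"
proof
  assume "shift s P = shift s Q"
  then have "shift (- s) (shift s P) = shift (- s) (shift s Q)" by simp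
  then show "P = Q" by simp
qed simp

lemma place_inj: "place s ws = place s ws' \<Longrightarrow> ws = ws'"
proof (induction ws arbitrary: s ws')
  case Nil
  then show ?case by (cases ws') auto
next
  case (Cons t ws)
  then show ?case by (cases ws') (auto simp: shift_inj)
qed

text \<open>By \<open>row_adjacent\<close> every tile starts where its predecessor ends, so the
  offsets found in the row are those computed by \<open>place\<close>.\<close>

lemma row_imp_place:
  assumes "row (as @ y # xs @ [right_half a])" "\<forall>x\<in>set xs. \<exists>s. \<exists>t\<in>T. x = shift s t"
    and "\<forall>t\<in>T. prototile t"
  shows "\<exists>ws. set ws \<subseteq> T \<and> xs = place (Sup (lower y)) ws \<and> Sup (lower y) + (\<Sum>t\<leftarrow>ws. width t) = a"
  using assms(1,2)
proof (induction xs arbitrary: as y)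
  case Nil
  then have "Sup (lower y) = a" using row_adjacent[of as y "right_half a" "[]"] by simp
  then show ?case by (intro exI[of _ "[]"]) simp
next
  case (Cons x xs)
  obtain s t where t: "t \<in> T" "x = shift s t" using Cons.prems(2) by auto
  then have pt: "prototile t" using assms(3) by simp
  have "Sup (lower y) = Inf (lower x)"
    using Cons.prems(1) row_adjacent[of as y x "xs @ [right_half a]"] by simp
  then have s: "Sup (lower y) = s" using prototile_lower(5)[OF pt] t by simp
  have "row ((as @ [y]) @ x # xs @ [right_half a])" using Cons.prems(1) by simp
  from Cons.IH[OF this] Cons.prems(2) obtain ws where
    ws: "set ws \<subseteq> T" "xs = place (Sup (lower x)) ws" "Sup (lower x) + (\<Sum>t\<leftarrow>ws. width t) = a"
    by auto
  then show ?case using t s prototile_lower(4)[OF pt]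
    by (intro exI[of _ "t # ws"]) (auto simp: add.assoc)
qed

lemma sorted_before_unique:
  assumes "sorted_wrt before xs" "sorted_wrt before ys" "set xs = set ys" "\<forall>P\<in>set xs. piece P"
  shows "xs = ys"
  using assms
proof (induction xs arbitrary: ys)
  case (Cons x xs)
  then obtain y ys' where ys: "ys = y # ys'" by (cases ys) auto
  have irr: "\<not> before P P" if "piece P" for P
    using left_of_asym[OF that that] by (auto simp: before_def)
  have asym: "\<not> before Q P" if "piece P" "piece Q" "before P Q" for P Q
    using left_of_asym[OF that(1,2)] that(3) by (auto simp: before_def)
  have "x = y"
  proof (rule ccontr)
    assume "x \<noteq> y"
    then have "x \<in> set ys'" "y \<in> set xs" using Cons.prems(3) ys by auto
    then have "before x y" "before y x" using Cons.prems ys by auto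
    then show False using asym[of x y] Cons.prems(3,4) ys by auto
  qed
  moreover have "piece x" using Cons.prems(4) by simp
  then have "x \<notin> set xs" "x \<notin> set ys'" using Cons.prems(1,2) irr[of x] ys \<open>x = y\<close> by auto
  ultimately have "set xs = set ys'" using Cons.prems(3) ys by auto
  then show ?case using Cons.IH[of ys'] Cons.prems ys \<open>x = y\<close> by auto
qed simp

text \<open>Sorting by an arbitrarily chosen bottom point suffices, since by
  \<open>left_of_total\<close> one comparison between two bottoms decides all of them.\<close>

lemma row_exists:
  assumes "finite \<Q>" "\<forall>P\<in>\<Q>. piece P" "pairwise (\<lambda>P Q. interior P \<inter> interior Q = {}) \<Q>" "\<Union>\<Q> = strip"
  obtains xs where "row xs" "set xs = \<Q>" "distinct xs"
proof -
  define key where "key P = (SOME p. p \<in> lower P)" for P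
  have key: "key P \<in> lower P" if "P \<in> \<Q>" for P
  proof -
    have "\<exists>p. p \<in> lower P" using assms(2) that by (auto simp: piece_def)
    then show ?thesis unfolding key_def by (rule someI_ex)
  qed
  obtain ys where ys: "set ys = \<Q>" "distinct ys" using finite_distinct_list[OF assms(1)] by blast
  define xs where "xs = sort_key key ys"
  have xs: "set xs = \<Q>" "distinct xs" "sorted (map key xs)" using ys by (simp_all add: xs_def)
  have "before (xs ! i) (xs ! j)" if "i < j" "j < length xs" for i j
  proof -
    let ?P = "xs ! i" and ?Q = "xs ! j"
    have PQ: "?P \<in> \<Q>" "?Q \<in> \<Q>" "?P \<noteq> ?Q"
      using that xs nth_eq_iff_index_eq[OF xs(2), of i j] nth_mem[of i xs] nth_mem[of j xs] by auto
    then have disj: "interior ?P \<inter> interior ?Q = {}" using assms(3) by (auto simp: pairwise_def)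
    have "key ?P \<le> key ?Q" using xs(3) that by (simp add: sorted_wrt_map sorted_wrt_iff_nth_less)
    then have "\<not> left_of ?Q ?P" using key[OF PQ(1)] key[OF PQ(2)] by (force simp: left_of_def)
    then have "left_of ?P ?Q" using left_of_total[of ?P ?Q] PQ assms(2) disj by auto
    then show ?thesis using disj by (simp add: before_def)
  qed
  then have "sorted_wrt before xs" by (simp add: sorted_wrt_iff_nth_less)
  then show thesis using that[of xs] xs assms by (simp add: row_def)
qed

lemma row_left_half_first:
  assumes "row (as @ left_half a # bs)"
  shows "as = []"
proof (rule ccontr)
  assume "as \<noteq> []"
  then obtain x where x: "x \<in> set as" by (cases as) auto
  then have "piece x" "left_of x (left_half a)" using assms by (auto simp: row_def sorted_wrt_append before_def)
  then obtain p where "p \<in> lower x" "\<forall>q<a. p < q" by (auto simp: piece_def left_of_def)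
  moreover have "min p a - 1 < a" by simp
  ultimately have "p < min p a - 1" by blast
  then show False by simp
qed

lemma row_right_half_last:
  assumes "row (as @ right_half a # bs)"
  shows "bs = []"
proof (rule ccontr)
  assume "bs \<noteq> []"
  then obtain x where x: "x \<in> set bs" by (cases bs) auto
  then have "piece x" "left_of (right_half a) x" using assms by (auto simp: row_def sorted_wrt_append before_def)
  then obtain p where "p \<in> lower x" "\<forall>q>a. q < p" by (auto simp: piece_def left_of_def)
  moreover have "a < max p a + 1" by simp
  ultimately have "max p a + 1 < p" by blast
  then show False by simp
qed

text \<open>The vertical correction comes first, because \<open>lower\<close> reads off contact with
  the line at height 0 only.\<close>

definition norm_tile :: "region \<Rightarrow> region" where
  "norm_tile t = (let t' = (+) (0, - Inf (snd ` t)) ` t in shift (- Inf (lower t')) t')"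

text \<open>Height exactly 1 leaves a single vertical position inside the strip, so all translates
  that can occur are horizontal shifts of one prototile.\<close>

lemma tall_tile_translate_strip:
  assumes t: "tall_tile t" and P: "P = (+) v ` t" "P \<subseteq> strip"
  shows "prototile (norm_tile t)" "\<exists>s. P = shift s (norm_tile t)"
proof -
  obtain B where B: "finite B" "B \<noteq> {}" "\<forall>R\<in>B. \<exists>a b c d. a < b \<and> c < d \<and> R = {a..b} \<times> {c..d}"
    and tB: "t = \<Union>B" and conn: "connected (interior t)" and h: "height t = 1"
    using t by (auto simp: tall_tile_def tile_def axis_parallel_polygon_def)
  have "compact R \<and> R \<noteq> {}" if "R \<in> B" for R
  proof -
    from bspec[OF B(3) \<open>R \<in> B\<close>] obtain a b c d where "a < b" "c < d" "R = {a..b} \<times> {c..d}"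
      by (elim exE conjE)
    then show ?thesis by (auto intro: compact_Times)
  qed
  then have "compact t" "t \<noteq> {}" using B(1,2) tB by (auto intro: compact_Union)
  define m where "m = Inf (snd ` t)"
  have cs: "compact (snd ` t)" using \<open>compact t\<close> by (intro compact_continuous_image continuous_on_snd continuous_on_id)
  then have ms: "m \<in> snd ` t"
    unfolding m_def using \<open>t \<noteq> {}\<close>
    by (intro closed_contains_Inf) (auto intro: compact_imp_closed bounded_imp_bdd_below compact_imp_bounded)
  have Ms: "m + 1 \<in> snd ` t"
  proof -
    have "Sup (snd ` t) \<in> snd ` t" using cs \<open>t \<noteq> {}\<close>
      by (intro closed_contains_Sup) (auto intro: compact_imp_closed bounded_imp_bdd_above compact_imp_bounded)
    then show ?thesis using h by (simp add: height_def m_def algebra_simps)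
  qed
  have "0 \<le> snd v + y \<and> snd v + y \<le> 1" if "y \<in> snd ` t" for y
  proof -
    obtain x where "(x, y) \<in> t" using \<open>y \<in> snd ` t\<close> by auto
    then have "v + (x, y) \<in> strip" using P by blast
    then show ?thesis by (cases v) simp
  qed
  \<comment> \<open>The extreme heights \<open>m\<close> and \<open>m + 1\<close> are attained and
    both must land between 0 and 1.\<close>
  from this[OF ms] this[OF Ms] have v: "snd v = - m" by linarith
  define t' where "t' = (+) (0, - m) ` t"
  have P_eq: "P = shift (fst v) t'"
    unfolding P t'_def shift_def image_image using v by (cases v) (auto simp: algebra_simps)
  have strip': "t' \<subseteq> strip" using P(2) unfolding P_eq by simp
  have int': "interior t' = (+) (0, - m) ` interior t" unfolding t'_def by (rule interior_translation)
  define B' where "B' = (`) ((+) (0, - m)) ` B"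
  have B': "finite B'" "\<exists>a b c d. a < b \<and> c < d \<and> R = {a..b} \<times> {c..d :: real}" if "R \<in> B'" for R
  proof -
    show "finite B'" using B by (simp add: B'_def)
    from \<open>R \<in> B'\<close> obtain R0 where R0: "R0 \<in> B" "R = (+) (0, - m) ` R0" by (auto simp: B'_def)
    from bspec[OF B(3) R0(1)] obtain a b c d where abcd: "a < b" "c < d" "R0 = {a..b} \<times> {c..d}"
      by (elim exE conjE)
    have "R = {a..b} \<times> {c - m..d - m}"
    proof
      show "R \<subseteq> {a..b} \<times> {c - m..d - m}" using R0 abcd by auto
      show "{a..b} \<times> {c - m..d - m} \<subseteq> R"
      proof clarify
        fix x y assume "x \<in> {a..b}" "y \<in> {c - m..d - m}"
        then have "(x, y + m) \<in> R0" using abcd by auto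
        then have "(0, - m) + (x, y + m) \<in> R" unfolding R0(2) by (rule imageI)
        then show "(x, y) \<in> R" by simp
      qed
    qed
    moreover have "c - m < d - m" using abcd(2) by simp
    ultimately show "\<exists>a b c d. a < b \<and> c < d \<and> R = {a..b} \<times> {c..d}" using abcd(1) by blast
  qed
  have "finite B'" using B by (simp add: B'_def)
  moreover have "t' = \<Union>B'" by (auto simp: t'_def B'_def tB)
  moreover have "connected (interior t')"
    unfolding int' using conn by (intro connected_continuous_image continuous_intros)
  moreover have "0 \<in> snd ` t'" "1 \<in> snd ` t'"
    using ms Ms by (force simp: t'_def image_image)+
  ultimately have t': "piece t'" "bounded t'" using rectangles_piece[of B' t'] B'(2) strip' by blast+
  have nt: "norm_tile t = shift (- Inf (lower t')) t'"
    by (simp add: norm_tile_def t'_def m_def Let_def)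
  have ne: "lower t' \<noteq> {}" "bdd_below (lower t')"
    using t' bounded_lower[OF t'(2)] by (auto simp: piece_def intro: bounded_imp_bdd_below)
  have "Inf (lower (norm_tile t)) = 0" unfolding nt lower_shift Inf_translate[OF ne] by simp
  moreover have "bounded (norm_tile t)" unfolding nt shift_def using t'(2) by (rule bounded_translation)
  ultimately show "prototile (norm_tile t)" by (simp add: prototile_def nt piece_shift t')
  have "P = shift (fst v + Inf (lower t')) (norm_tile t)" by (simp add: nt P_eq)
  then show "\<exists>s. P = shift s (norm_tile t)" ..
qed

lemma norm_tile_translate: "\<exists>v. shift s (norm_tile t) = (+) v ` t"
proof -
  define t' where "t' = (+) (0, - Inf (snd ` t)) ` t"
  have "shift s (norm_tile t) = (+) (s - Inf (lower t'), - Inf (snd ` t)) ` t"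
    unfolding norm_tile_def Let_def t'_def[symmetric]
    by (simp add: shift_shift) (simp add: shift_def t'_def image_image add.assoc[symmetric])
  then show ?thesis ..
qed

text \<open>The bottom of \<open>t\<close> contains an interval of radius \<open>e\<close>, so
  offsets closer than \<open>e\<close> give overlapping interiors. Offsets in a bounded interval
  that are \<open>e\<close> apart have distinct integer parts after division by
  \<open>e\<close>.\<close>

lemma finite_disjoint_shifts:
  assumes "prototile t" and P: "\<And>P. P \<in> \<P> \<Longrightarrow> P \<subseteq> rect a"
    and disj: "pairwise (\<lambda>P Q. interior P \<inter> interior Q = {}) \<P>"
  shows "finite {P \<in> \<P>. \<exists>s. P = shift s t}"
proof -
  define X where "X = {s. shift s t \<in> \<P>}"
  obtain p where p: "p \<in> lower t" using prototile_lower(1)[OF assms(1)] by auto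
  have "open (lower t)" unfolding lower_def by (rule open_foot)
  then obtain e where e: "e > 0" "ball p e \<subseteq> lower t" using p open_contains_ball by blast
  have close: "s = s'" if "s \<in> X" "s' \<in> X" "\<bar>s - s'\<bar> < e" for s s'
  proof (rule ccontr)
    assume "s \<noteq> s'"
    have "p + (s - s') \<in> lower t" using e that(3) by (auto simp: dist_real_def subset_iff)
    then have "p + s \<in> lower (shift s' t)" "p + s \<in> lower (shift s t)"
      using p by (auto simp: lower_shift intro: image_eqI[of _ _ "p + (s - s')"])
    then have "interior (shift s t) \<inter> interior (shift s' t) \<noteq> {}"
      using foot_disjoint unfolding lower_def by blast
    moreover have "shift s t \<noteq> shift s' t"
      using \<open>s \<noteq> s'\<close> prototile_lower(5)[OF assms(1)] by metis
    ultimately show False using disj that(1,2) unfolding X_def pairwise_def by blast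
  qed
  obtain y where "0 < y" "{p} \<times> {0<..y} \<subseteq> interior t" using foot_vertical p unfolding lower_def by metis
  then have xy: "(p, y) \<in> t" using interior_subset by fastforce
  have X: "X \<subseteq> {-p..a - p}"
  proof
    fix s assume "s \<in> X"
    then have "(s + p, y) \<in> rect a" using P[of "shift s t"] xy by (auto simp: X_def mem_shift subset_iff)
    then show "s \<in> {-p..a - p}" by (auto simp: rect_def)
  qed
  have "inj_on (\<lambda>s. \<lfloor>s / e\<rfloor>) X"
  proof (rule inj_onI)
    fix s s' assume s: "s \<in> X" "s' \<in> X" "\<lfloor>s / e\<rfloor> = \<lfloor>s' / e\<rfloor>"
    have "\<bar>s / e - s' / e\<bar> < 1" using s(3) by linarith
    then have "\<bar>s - s'\<bar> / e < 1" using e(1) by (simp add: diff_divide_distrib[symmetric])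
    then show "s = s'" using close[OF s(1,2)] e(1) by simp
  qed
  moreover have "(\<lambda>s. \<lfloor>s / e\<rfloor>) ` X \<subseteq> {\<lfloor>-p / e\<rfloor>..\<lfloor>(a - p) / e\<rfloor>}"
  proof (rule image_subsetI)
    fix s assume "s \<in> X"
    then have "-p \<le> s" "s \<le> a - p" using X by auto
    then show "\<lfloor>s / e\<rfloor> \<in> {\<lfloor>-p / e\<rfloor>..\<lfloor>(a - p) / e\<rfloor>}"
      unfolding atLeastAtMost_iff using e(1) by (intro conjI floor_mono divide_right_mono) auto
  qed
  ultimately have "finite X" using finite_imageD finite_subset finite_atLeastAtMost_int by metis
  moreover have "{P \<in> \<P>. \<exists>s. P = shift s t} \<subseteq> (\<lambda>s. shift s t) ` X" by (auto simp: X_def)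
  ultimately show ?thesis using finite_subset by blast
qed

text \<open>Tiles are closures of their interiors, so for the inclusion into the rectangle
  disjointness from the half strips is enough. Conversely the half strips miss the abscissae
  strictly between 0 and \<open>a\<close>, and closing up adds the vertical edges.\<close>

lemma row_covers_rect:
  assumes "a > 0" "row (left_half 0 # xs @ [right_half a])"
  shows "\<Union>(set xs) = rect a"
proof
  have pieces: "\<forall>P\<in>set xs. piece P" using assms(2) by (auto simp: row_def)
  have sep: "\<forall>P\<in>set xs. before (left_half 0) P \<and> before P (right_half a)"
    using assms(2) by (auto simp: row_def sorted_wrt_append)
  show "\<Union>(set xs) \<subseteq> rect a"
  proof
    fix z assume "z \<in> \<Union>(set xs)"
    then obtain P where P: "P \<in> set xs" "z \<in> P" by auto
    have "interior P \<subseteq> rect a"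
    proof clarify
      fix x y assume xy: "(x, y) \<in> interior P"
      then have "0 < y" "y < 1" using piece_interior[of P] pieces P by auto
      moreover have "(x, y) \<notin> interior (left_half 0)" "(x, y) \<notin> interior (right_half a)"
        using sep P xy by (auto simp: before_def)
      ultimately show "(x, y) \<in> rect a" by (auto simp: rect_def interior_left_half interior_right_half)
    qed
    then have "closure (interior P) \<subseteq> rect a"
      by (rule closure_minimal) (auto simp: rect_def intro: closed_Times)
    then show "z \<in> rect a" using P pieces unfolding piece_def by blast
  qed
  have "{0<..<a} \<times> {0..1} \<subseteq> \<Union>(set xs)"
  proof
    fix z :: "real \<times> real" assume z: "z \<in> {0<..<a} \<times> {0..1}"
    then have "z \<in> \<Union>(set (left_half 0 # xs @ [right_half a]))" using assms(2) by (auto simp: row_def)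
    then show "z \<in> \<Union>(set xs)" using z by (auto simp: left_half_def right_half_def)
  qed
  moreover have "closed (\<Union>(set xs))" using pieces by (auto simp: piece_def)
  ultimately have "closure ({0<..<a} \<times> {0..1::real}) \<subseteq> \<Union>(set xs)" by (rule closure_minimal)
  then show "rect a \<subseteq> \<Union>(set xs)" using assms(1) by (simp add: closure_Times rect_def)
qed

text \<open>Together with two half strips the tiling covers the strip and can be sorted into a row.
  The half strips come out at the ends because their bottoms are unbounded.\<close>

lemma tiling_imp_row:
  assumes T: "finite T" "\<forall>t\<in>T. tall_tile t" and a: "a > 0" and til: "tiling T a \<P>"
  shows "\<exists>xs. row (left_half 0 # xs @ [right_half a]) \<and> set xs = \<P> \<and> (\<forall>P\<in>\<P>. \<exists>s. \<exists>t\<in>{t \<in> norm_tile ` T. prototile t}. P = shift s t)"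
proof -
  \<comment> \<open>The restriction to prototiles loses no tile of the tiling: having a translate
    inside the strip is what makes the normal form a prototile.\<close>
  let ?T = "{t \<in> norm_tile ` T. prototile t}"
  have til': "\<forall>P\<in>\<P>. \<exists>t\<in>T. \<exists>v. P = (+) v ` t" "pairwise (\<lambda>P Q. interior P \<inter> interior Q = {}) \<P>" "\<Union>\<P> = rect a"
    using til a by (auto simp: tiling_def)
  have sub: "P \<subseteq> rect a" if "P \<in> \<P>" for P using til'(3) that by auto
  have "rect a \<subseteq> strip" by (auto simp: rect_def)
  have shifts: "\<exists>s. \<exists>t\<in>?T. P = shift s t" if "P \<in> \<P>" for P
  proof -
    obtain t v where t: "t \<in> T" "P = (+) v ` t" using til'(1) \<open>P \<in> \<P>\<close> by blast
    moreover have "tall_tile t" "P \<subseteq> strip" using T t sub[OF \<open>P \<in> \<P>\<close>] \<open>rect a \<subseteq> strip\<close> by auto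
    ultimately show ?thesis using tall_tile_translate_strip[of t P v] by blast
  qed
  have "finite (\<Union>t\<in>?T. {P \<in> \<P>. \<exists>s. P = shift s t})"
    using T(1) sub til'(2) by (intro finite_UN_I finite_disjoint_shifts[where a = a]) auto
  moreover have "\<P> \<subseteq> (\<Union>t\<in>?T. {P \<in> \<P>. \<exists>s. P = shift s t})" using shifts by blast
  ultimately have fin: "finite \<P>" by (rule finite_subset[rotated])
  have pieces: "\<forall>P\<in>\<P>. piece P" using shifts piece_shift by (fastforce simp: prototile_def)
  define \<Q> where "\<Q> = {left_half 0, right_half a} \<union> \<P>"
  have int_sub: "interior P \<subseteq> {0<..<a} \<times> {0<..<1}" if "P \<in> \<P>" for P
    using interior_mono[OF sub[OF that]] by (simp add: rect_def interior_Times)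
  have "pairwise (\<lambda>P Q. interior P \<inter> interior Q = {}) \<Q>"
    unfolding \<Q>_def pairwise_def
    using til'(2) int_sub a by (fastforce simp: pairwise_def interior_left_half interior_right_half)
  moreover have "\<Union>\<Q> = strip"
  proof -
    have "strip = left_half 0 \<union> right_half a \<union> rect a" using a
      by (auto simp: left_half_def right_half_def rect_def)
    then show ?thesis using til'(3) by (auto simp: \<Q>_def)
  qed
  moreover have "finite \<Q>" "\<forall>P\<in>\<Q>. piece P" using fin pieces by (auto simp: \<Q>_def)
  ultimately obtain zs where zs: "row zs" "set zs = \<Q>" "distinct zs" using row_exists by metis
  have "left_half 0 \<in> set zs" using zs by (simp add: \<Q>_def)
  then obtain as ys where "zs = as @ left_half 0 # ys" by (meson split_list)
  then have ys: "zs = left_half 0 # ys" using row_left_half_first zs(1) by auto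
  have "-1 \<in> lower (left_half 0)" "-1 \<notin> lower (right_half a)" using a by simp_all
  then have "left_half 0 \<noteq> right_half a" by metis
  then have "right_half a \<in> set ys" using zs(2) ys by (auto simp: \<Q>_def)
  then obtain xs bs where "ys = xs @ right_half a # bs" by (meson split_list)
  then have xs: "zs = left_half 0 # xs @ [right_half a]"
    using row_right_half_last[of "left_half 0 # xs"] zs(1) ys by auto
  have "left_half 0 \<notin> \<P>"
  proof
    assume "left_half 0 \<in> \<P>"
    from subsetD[OF int_sub[OF this], of "(-1, 1/2)"] show False by (simp add: interior_left_half)
  qed
  moreover have "right_half a \<notin> \<P>"
  proof
    assume "right_half a \<in> \<P>"
    from subsetD[OF int_sub[OF this], of "(a + 1, 1/2)"] show False by (simp add: interior_right_half)
  qed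
  ultimately have "\<P> = \<Q> - {left_half 0, right_half a}" unfolding \<Q>_def by blast
  moreover have "set xs = set zs - {left_half 0, right_half a}" using zs(3) unfolding xs by auto
  ultimately have "set xs = \<P>" using zs(2) by simp
  then show ?thesis using zs(1) xs shifts by blast
qed

lemma set_place: "set (place s ws) \<subseteq> {shift s t | s t. t \<in> set ws}"
  by (induction ws arbitrary: s) fastforce+

lemma total_width_nonneg: "\<forall>t\<in>set ws. prototile t \<Longrightarrow> 0 \<le> (\<Sum>t\<leftarrow>ws. width t)"
  by (induction ws) (auto dest!: prototile_width_pos)

definition tiling_words :: "region set \<Rightarrow> real \<Rightarrow> region list set" where
  "tiling_words T0 a = {ws. set ws \<subseteq> T0 \<and> (\<Sum>t\<leftarrow>ws. width t) = a \<and>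
    row (left_half 0 # place 0 ws @ [right_half a])}"

lemma card_tilings:
  assumes T: "finite T" "\<forall>t\<in>T. tall_tile t" and a: "a \<ge> 0"
  defines "T0 \<equiv> {t \<in> norm_tile ` T. prototile t}"
  shows "card {\<P>. tiling T a \<P>} = card (tiling_words T0 a)"
proof (cases "a = 0")
  case True
  \<comment> \<open>The convention for length 0 agrees with the words: positive widths leave only
    the empty word, and the two half strips alone form a row.\<close>
  have "ws = []" if "set ws \<subseteq> T0" "(\<Sum>t\<leftarrow>ws. width t) = 0" for ws
  proof (cases ws)
    case (Cons t ws')
    then have "0 < width t" "0 \<le> (\<Sum>t\<leftarrow>ws'. width t)"
      using that(1) prototile_width_pos total_width_nonneg[of ws'] by (auto simp: T0_def)
    then show ?thesis using that(2) Cons by simp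
  qed
  then have "tiling_words T0 a = {[]}"
    using True row_halves by (auto simp: tiling_words_def)
  moreover have "{\<P>. tiling T a \<P>} = {{}}" using True by (auto simp: tiling_def)
  ultimately show ?thesis by simp
next
  case False
  then have "a > 0" using a by simp
  let ?W = "tiling_words T0 a"
  have T0: "\<forall>t\<in>T0. prototile t" by (simp add: T0_def)
  have "bij_betw (\<lambda>ws. set (place 0 ws)) ?W {\<P>. tiling T a \<P>}"
    unfolding bij_betw_def
  proof
    show "inj_on (\<lambda>ws. set (place 0 ws)) ?W"
    proof (rule inj_onI)
      fix ws ws' assume ws: "ws \<in> ?W" "ws' \<in> ?W" "set (place 0 ws) = set (place 0 ws')"
      have r: "row (left_half 0 # place 0 ws @ [right_half a])" "row (left_half 0 # place 0 ws' @ [right_half a])"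
        using ws by (auto simp: tiling_words_def)
      have "left_half 0 # place 0 ws @ [right_half a] = left_half 0 # place 0 ws' @ [right_half a]"
        using r ws(3) by (intro sorted_before_unique) (auto simp: row_def)
      then show "ws = ws'" using place_inj by simp
    qed
    show "(\<lambda>ws. set (place 0 ws)) ` ?W = {\<P>. tiling T a \<P>}"
    proof (intro equalityI subsetI)
      fix \<P> assume "\<P> \<in> (\<lambda>ws. set (place 0 ws)) ` ?W"
      then obtain ws where ws: "set ws \<subseteq> T0" "row (left_half 0 # place 0 ws @ [right_half a])"
        and P: "\<P> = set (place 0 ws)" by (auto simp: tiling_words_def)
      have "\<forall>P\<in>\<P>. \<exists>t\<in>T. \<exists>v. P = (+) v ` t"
      proof
        fix P assume "P \<in> \<P>"
        then obtain s t where "P = shift s t" "t \<in> T0" using set_place[of 0 ws] P ws(1) by blast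
        then obtain t' where "t' \<in> T" "P = shift s (norm_tile t')" by (auto simp: T0_def)
        then show "\<exists>t\<in>T. \<exists>v. P = (+) v ` t" using norm_tile_translate by metis
      qed
      moreover have "pairwise (\<lambda>P Q. interior P \<inter> interior Q = {}) \<P>"
      proof (rule pairwiseI)
        fix P Q assume PQ: "P \<in> \<P>" "Q \<in> \<P>" "P \<noteq> Q"
        have "sorted_wrt before (place 0 ws)" using ws(2) by (simp add: row_def sorted_wrt_append)
        moreover obtain i j where "i < length (place 0 ws)" "P = place 0 ws ! i"
          "j < length (place 0 ws)" "Q = place 0 ws ! j"
          using PQ unfolding P in_set_conv_nth by auto
        ultimately have "before P Q \<or> before Q P"
          using PQ(3) unfolding sorted_wrt_iff_nth_less by (metis linorder_neqE_nat)
        then show "interior P \<inter> interior Q = {}" by (auto simp: before_def)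
      qed
      moreover have "\<Union>\<P> = rect a" unfolding P by (rule row_covers_rect[OF \<open>a > 0\<close> ws(2)])
      ultimately show "\<P> \<in> {\<P>. tiling T a \<P>}" using \<open>a > 0\<close> by (simp add: tiling_def)
    next
      fix \<P> assume "\<P> \<in> {\<P>. tiling T a \<P>}"
      then have "tiling T a \<P>" by simp
      from tiling_imp_row[OF T \<open>a > 0\<close> this] obtain xs where
        xs: "row (left_half 0 # xs @ [right_half a])" "set xs = \<P>" "\<forall>P\<in>\<P>. \<exists>s. \<exists>t\<in>T0. P = shift s t"
        unfolding T0_def by (elim exE conjE)
      have "Sup (lower (left_half 0)) = (0 :: real)" by simp
      then obtain ws where "set ws \<subseteq> T0" "xs = place 0 ws" "(\<Sum>t\<leftarrow>ws. width t) = a"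
        using row_imp_place[of "[]" "left_half 0" xs a T0] xs T0 by auto
      then show "\<P> \<in> (\<lambda>ws. set (place 0 ws)) ` ?W"
        using xs unfolding tiling_words_def by blast
    qed
  qed
  then show ?thesis by (simp add: bij_betw_same_card)
qed

text \<open>The other pieces of the witnessing row are arbitrary. By \<open>row_glue\<close> they
  can be replaced, so this relation on pairs already describes all rows, which makes the language of
  tilings local.\<close>

definition fits :: "region \<Rightarrow> region \<Rightarrow> bool" where
  "fits P Q \<longleftrightarrow> (\<exists>as bs. row (as @ P # shift (width P) Q # bs))"

lemma fits_shift:
  assumes "row (as @ shift s P # shift (s + width P) Q # bs)"
  shows "fits P Q"
proof -
  have "row (map (shift (- s)) (as @ shift s P # shift (s + width P) Q # bs))"
    using assms by (rule row_shift)
  then have "row (map (shift (- s)) as @ P # shift (width P) Q # map (shift (- s)) bs)" by simp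
  then show ?thesis unfolding fits_def by blast
qed

lemma row_extend:
  assumes "row (as @ shift s P # bs)" "fits P Q"
  obtains bs' where "row ((as @ [shift s P]) @ shift (s + width P) Q # bs')"
proof -
  obtain cs ds where "row (cs @ P # shift (width P) Q # ds)" using assms(2) by (auto simp: fits_def)
  then have "row (map (shift s) (cs @ P # shift (width P) Q # ds))" by (rule row_shift)
  then have "row (map (shift s) cs @ shift s P # shift (s + width P) Q # map (shift s) ds)" by simp
  from row_glue[OF assms(1) this] show thesis using that by simp
qed

lemma row_imp_words:
  "row (as @ shift s x # place (s + width x) ws @ [right_half (s + width x + (\<Sum>t\<leftarrow>ws. width t))]) \<Longrightarrow>
    set ws \<subseteq> T0 \<Longrightarrow> ws \<in> words T0 fits (\<lambda>x. fits x (right_half 0)) x"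
proof (induction ws arbitrary: as s x)
  case Nil
  then show ?case using fits_shift[of as s x "right_half 0" "[]"] by simp
next
  case (Cons t ws)
  have "fits x t" using Cons.prems(1) fits_shift[of as s x t] by simp
  moreover have "ws \<in> words T0 fits (\<lambda>x. fits x (right_half 0)) t"
    using Cons.prems Cons.IH[of "as @ [shift s x]" "s + width x" t] by (simp add: add.assoc)
  ultimately show ?case using Cons.prems(2) by simp
qed

text \<open>The tail \<open>bs\<close> is arbitrary. Each letter is appended by gluing, which
  replaces everything to its right, until the final fit with the right half strip leaves nothing
  behind it.\<close>

lemma words_imp_row:
  "row (as @ shift s x # bs) \<Longrightarrow> ws \<in> words T0 fits (\<lambda>x. fits x (right_half 0)) x \<Longrightarrow>
    row (as @ shift s x # place (s + width x) ws @ [right_half (s + width x + (\<Sum>t\<leftarrow>ws. width t))])"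
proof (induction ws arbitrary: as s x bs)
  case Nil
  then have "fits x (right_half 0)" by simp
  then obtain bs' where r: "row ((as @ [shift s x]) @ shift (s + width x) (right_half 0) # bs')"
    using row_extend[OF Nil(1)] by metis
  then have "bs' = []" using row_right_half_last[of "as @ [shift s x]" "s + width x"] by simp
  then show ?case using r by simp
next
  case (Cons t ws)
  then have "fits x t" "ws \<in> words T0 fits (\<lambda>x. fits x (right_half 0)) t" by simp_all
  then obtain bs' where "row ((as @ [shift s x]) @ shift (s + width x) t # bs')"
    using row_extend[OF Cons.prems(1)] by metis
  from Cons.IH[OF this \<open>ws \<in> _\<close>] show ?case by (simp add: add.assoc)
qed

theorem tile_count_diagonal:
  assumes "finite T" "\<forall>t\<in>T. tall_tile t" "0 \<le> \<epsilon>"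
  shows "\<exists>k\<ge>1. \<exists>F\<in>N_rational k. \<forall>n. tile_count T \<epsilon> n = F (diag_monomial k n)"
proof -
  define T0 where "T0 = {t \<in> norm_tile ` T. prototile t}"
  have T0: "finite T0" "\<forall>t\<in>T0. 0 < width t" using assms(1) prototile_width_pos by (auto simp: T0_def)
  \<comment> \<open>The left half strip serves as the letter in front of the word; its bottom ends
    at 0, where the first tile starts.\<close>
  define L where "L = left_half 0"
  define E where "E x = fits x (right_half 0)" for x
  have "tile_count T \<epsilon> n = card {ws \<in> words T0 fits E L. (\<Sum>t\<leftarrow>ws. width t) = real n + \<epsilon>}" for n
  proof -
    have "row (left_half 0 # place 0 ws @ [right_half a]) \<longleftrightarrow> ws \<in> words T0 fits E L"
      if "set ws \<subseteq> T0" "(\<Sum>t\<leftarrow>ws. width t) = a" for ws a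
    proof
      assume "row (left_half 0 # place 0 ws @ [right_half a])"
      then show "ws \<in> words T0 fits E L"
        using row_imp_words[of "[]" 0 L ws T0] that unfolding L_def E_def by simp
    next
      assume "ws \<in> words T0 fits E L"
      then show "row (left_half 0 # place 0 ws @ [right_half a])"
        using words_imp_row[of "[]" 0 L "[right_half 0]" ws T0] that row_halves[of 0]
        unfolding L_def E_def by simp
    qed
    moreover have "set ws \<subseteq> T0" if "ws \<in> words T0 fits E L" for ws using that by (simp add: words_def)
    ultimately have "tiling_words T0 (real n + \<epsilon>) = {ws \<in> words T0 fits E L. (\<Sum>t\<leftarrow>ws. width t) = real n + \<epsilon>}"
      unfolding tiling_words_def by blast
    then show ?thesis
      using card_tilings[OF assms(1,2), of "real n + \<epsilon>"] assms(3)
      by (simp add: tile_count_def T0_def)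
  qed
  then show ?thesis
    using real_word_count_diagonal[OF T0 assms(3), of fits E L] by presburger
qed

section \<open>Automata for rational series\<close>

abbreviation xvar :: "nat \<Rightarrow> nat pser" where
  "xvar v \<equiv> pmono (Poly_Mapping.single v 1)"

definition nspan :: "nat pser set \<Rightarrow> nat pser set" where
  "nspan X = {F. \<exists>a. F = (\<Sum>x\<in>X. of_nat (a x) * x)}"

abbreviation var_sum :: "nat \<Rightarrow> (nat \<Rightarrow> nat pser) \<Rightarrow> nat pser" where
  "var_sum k Y \<equiv> \<Sum>v\<in>{1..k}. xvar v * Y v"

text \<open>The form of a transition in a weighted automaton: stop with weight \<open>c\<close>, or
  read one variable and continue with a combination of states. The variables commute, so such a
  decomposition is not unique, and any one serves.\<close>

definition step :: "nat \<Rightarrow> nat pser set \<Rightarrow> nat pser \<Rightarrow> bool" where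
  "step k X F \<longleftrightarrow> (\<exists>c Y. (\<forall>v. Y v \<in> nspan X) \<and> F = of_nat c + var_sum k Y)"

text \<open>A finite weighted automaton whose states are named by the series they generate.\<close>

definition stable :: "nat \<Rightarrow> nat pser set \<Rightarrow> bool" where
  "stable k X \<longleftrightarrow> finite X \<and> (\<forall>x\<in>X. step k X x)"

lemma nspan_zero: "0 \<in> nspan X"
  unfolding nspan_def by (intro CollectI exI[of _ "\<lambda>_. 0"]) simp

lemma nspan_base: "finite X \<Longrightarrow> x \<in> X \<Longrightarrow> x \<in> nspan X"
proof -
  assume X: "finite X" "x \<in> X"
  have "(\<Sum>y\<in>X. of_nat (if y = x then 1 else 0) * y) = (\<Sum>y\<in>X. if y = x then y else 0)"
    by (rule sum.cong) auto
  also have "\<dots> = x" using X by simp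
  finally show ?thesis unfolding nspan_def by (intro CollectI exI[of _ "\<lambda>y. if y = x then 1 else 0"]) simp
qed

lemma nspan_add: "F \<in> nspan X \<Longrightarrow> G \<in> nspan X \<Longrightarrow> F + G \<in> nspan X"
proof -
  assume "F \<in> nspan X" "G \<in> nspan X"
  then obtain a b where "F = (\<Sum>x\<in>X. of_nat (a x) * x)" "G = (\<Sum>x\<in>X. of_nat (b x) * x)"
    by (auto simp: nspan_def)
  then have "F + G = (\<Sum>x\<in>X. of_nat (a x + b x) * x)"
    by (simp add: sum.distrib distrib_right)
  then show ?thesis unfolding nspan_def by (intro CollectI exI)
qed

lemma nspan_induct_in:
  assumes "F \<in> nspan X" "P 0" "\<And>F G. P F \<Longrightarrow> P G \<Longrightarrow> P (F + G)" "\<And>x. x \<in> X \<Longrightarrow> P x"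
  shows "P F"
proof -
  obtain a where a: "F = (\<Sum>x\<in>X. of_nat (a x) * x)" using assms(1) by (auto simp: nspan_def)
  have scale: "P (of_nat n * x)" if "x \<in> X" for n x
    using assms(2-4) that by (induction n) (auto simp: distrib_right)
  have "P (\<Sum>x\<in>Y. of_nat (a x) * x)" if "Y \<subseteq> X" for Y
    using that by (induction Y rule: infinite_finite_induct) (auto intro: assms(2,3) scale)
  then show ?thesis using a by simp
qed

lemma nspan_mono: "finite Y \<Longrightarrow> X \<subseteq> Y \<Longrightarrow> F \<in> nspan X \<Longrightarrow> F \<in> nspan Y"
  by (erule nspan_induct_in) (auto intro: nspan_zero nspan_add nspan_base)

lemma nspan_mult:
  assumes "finite X" "F \<in> nspan X"
  shows "F * G \<in> nspan ((\<lambda>x. x * G) ` X)"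
  using assms(2) by (rule nspan_induct_in)
    (auto simp: distrib_right intro: nspan_zero nspan_add nspan_base assms(1))

lemma step_zero: "step k X 0"
  unfolding step_def by (rule exI[of _ 0], rule exI[of _ "\<lambda>_. 0"]) (simp add: nspan_zero)

lemma step_of_nat: "step k X (of_nat c)"
  unfolding step_def by (rule exI[of _ c], rule exI[of _ "\<lambda>_. 0"]) (simp add: nspan_zero)

lemma step_sum_vars: "(\<And>v. Y v \<in> nspan X) \<Longrightarrow> step k X (\<Sum>v\<in>{1..k}. xvar v * Y v)"
  unfolding step_def by (rule exI[of _ 0], rule exI[of _ Y]) simp

lemma step_add: "step k X F \<Longrightarrow> step k X G \<Longrightarrow> step k X (F + G)"
  unfolding step_def
proof (elim exE conjE)
  fix c Y c' Y'
  assume "\<forall>v. Y v \<in> nspan X" "F = of_nat c + var_sum k Y"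
    "\<forall>v. Y' v \<in> nspan X" "G = of_nat c' + var_sum k Y'"
  then show "\<exists>c Y. (\<forall>v. Y v \<in> nspan X) \<and> F + G = of_nat c + var_sum k Y"
    by (intro exI[of _ "c + c'"] exI[of _ "\<lambda>v. Y v + Y' v"])
       (simp add: nspan_add distrib_left sum.distrib algebra_simps)
qed

lemma step_scale: "step k X F \<Longrightarrow> step k X (of_nat n * F)"
  by (induction n) (simp_all add: step_zero step_add distrib_right)

lemma step_mono: "finite Y \<Longrightarrow> X \<subseteq> Y \<Longrightarrow> step k X F \<Longrightarrow> step k Y F"
  unfolding step_def using nspan_mono by blast

lemma step_nspan: "stable k X \<Longrightarrow> F \<in> nspan X \<Longrightarrow> step k X F"
  by (erule nspan_induct_in) (auto simp: stable_def intro: step_zero step_add)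

lemma pcoeff_of_nat: "pcoeff (of_nat c) m = (if m = 0 then c else 0)"
  by (induction c) (auto simp: pcoeff_one)

lemma pcoeff_of_nat_mult: "pcoeff (of_nat n * F) m = n * pcoeff F m"
  by (induction n) (simp_all add: distrib_right)

lemma pcoeff_step_0: "pcoeff (of_nat c + var_sum k Y) 0 = c"
proof -
  have "Poly_Mapping.single v (1 :: nat) \<noteq> 0" for v :: nat
    by (metis lookup_single_eq lookup_zero one_neq_zero)
  then have "pcoeff (xvar v) 0 = 0" for v by (metis pcoeff_pmono)
  then show ?thesis by (simp add: pcoeff_of_nat pcoeff_sum)
qed

text \<open>Concatenation: a transition of \<open>x\<close> is followed with \<open>G\<close> kept
  as a right factor, and where \<open>x\<close> may stop, its constant term hands over to
  \<open>G\<close>.\<close>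

lemma step_mult:
  assumes X: "stable k X" and x: "x \<in> X" and Z: "finite Z" "(\<lambda>x. x * G) ` X \<subseteq> Z" and G: "step k Z G"
  shows "step k Z (x * G)"
proof -
  obtain c Y where Y: "\<forall>v. Y v \<in> nspan X" "x = of_nat c + var_sum k Y"
    using X x by (auto simp: stable_def step_def)
  have "x * G = of_nat c * G + (\<Sum>v\<in>{1..k}. xvar v * (Y v * G))"
    by (subst Y(2)) (simp add: distrib_right sum_distrib_right mult.assoc)
  moreover have "Y v * G \<in> nspan Z" for v
    using nspan_mult[of X "Y v" G] Y(1) X Z by (auto simp: stable_def intro: nspan_mono)
  ultimately show ?thesis by (simp only:) (intro step_add step_scale G step_sum_vars)
qed

text \<open>One half of Kleene's theorem, with series as states. A product has the states
  \<open>x * G\<close> followed by those of the second factor; a star has the states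
  \<open>x * G\<close> and \<open>G\<close>, unfolded by \<open>G = 1 + F * G\<close>.\<close>

lemma N_rational_stable:
  assumes "F \<in> N_rational k"
  shows "\<exists>X. stable k X \<and> Abs_pser F \<in> nspan X"
  using assms
proof (induction rule: N_rational.induct)
  case zero
  have "Abs_pser (\<lambda>m. 0) = (0 :: nat pser)" by (rule pser_eqI) (simp add: Abs_pser_inverse)
  then show ?case by (intro exI[of _ "{}"]) (simp add: stable_def nspan_zero)
next
  case (var i)
  let ?X = "{xvar i, 1}"
  have "Abs_pser (mps_var i) = xvar i"
    by (rule pser_eqI) (simp add: Abs_pser_inverse pcoeff_pmono mps_var_def)
  moreover have "step k ?X 1" using step_of_nat[of k ?X 1] by simp
  moreover have "step k ?X (xvar i)"
  proof -
    have "(\<Sum>v\<in>{1..k}. xvar v * (if v = i then 1 else 0)) = (\<Sum>v\<in>{1..k}. if v = i then xvar v else 0)"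
      by (rule sum.cong) auto
    also have "\<dots> = xvar i" using var by simp
    finally show ?thesis
      using step_sum_vars[of "\<lambda>v. if v = i then 1 else 0" ?X k] by (simp add: nspan_zero nspan_base)
  qed
  ultimately show ?case by (intro exI[of _ ?X]) (simp add: stable_def nspan_base)
next
  case (add F G)
  then obtain X Y where XY: "stable k X" "Abs_pser F \<in> nspan X" "stable k Y" "Abs_pser G \<in> nspan Y" by blast
  have "Abs_pser (\<lambda>m. F m + G m) = Abs_pser F + Abs_pser G"
    by (rule pser_eqI) (simp add: Abs_pser_inverse)
  moreover have "stable k (X \<union> Y)"
    using XY by (auto simp: stable_def intro: step_mono[of "X \<union> Y" X] step_mono[of "X \<union> Y" Y])
  moreover have "Abs_pser F + Abs_pser G \<in> nspan (X \<union> Y)"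
    using XY by (intro nspan_add) (auto simp: stable_def intro: nspan_mono[of "X \<union> Y" X] nspan_mono[of "X \<union> Y" Y])
  ultimately show ?case by (intro exI[of _ "X \<union> Y"]) simp
next
  case (mult F G)
  then obtain X Y where XY: "stable k X" "Abs_pser F \<in> nspan X" "stable k Y" "Abs_pser G \<in> nspan Y" by blast
  let ?G = "Abs_pser G"
  define Z where "Z = (\<lambda>x. x * ?G) ` X \<union> Y"
  have Z: "finite Z" "(\<lambda>x. x * ?G) ` X \<subseteq> Z" "Y \<subseteq> Z" using XY by (auto simp: Z_def stable_def)
  have G: "step k Z ?G" using step_mono[OF Z(1,3) step_nspan[OF XY(3,4)]] .
  have "step k Z z" if "z \<in> Z" for z
    using that step_mult[OF XY(1) _ Z(1,2) G] step_mono[OF Z(1,3)] XY(3)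
    by (auto simp: Z_def stable_def)
  then have "stable k Z" using Z by (simp add: stable_def)
  moreover have "Abs_pser (mps_mult F G) = Abs_pser F * ?G"
    by (simp add: pcoeff_inject[symmetric] times_pser.rep_eq Abs_pser_inverse)
  moreover have "Abs_pser F * ?G \<in> nspan Z"
    using nspan_mult[OF _ XY(2), of ?G] XY(1) Z by (auto simp: stable_def intro: nspan_mono)
  ultimately show ?case by auto
next
  case (inverse F G)
  then obtain X where X: "stable k X" "Abs_pser F \<in> nspan X" by blast
  let ?F = "Abs_pser F" and ?G = "Abs_pser G"
  have G1: "?G = 1 + ?F * ?G"
    using inverse.hyps(3) star_int_iff[of ?F ?G] by (simp add: Abs_pser_inverse)
  define Z where "Z = (\<lambda>x. x * ?G) ` X \<union> {?G}"
  have Z: "finite Z" "(\<lambda>x. x * ?G) ` X \<subseteq> Z" using X by (auto simp: Z_def stable_def)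
  obtain c Y where Y: "\<forall>v. Y v \<in> nspan X" "?F = of_nat c + var_sum k Y"
    using step_nspan[OF X] by (auto simp: step_def)
  \<comment> \<open>As \<open>F\<close> has no constant term, the unfolding of \<open>G\<close>
    reads a variable before it can return to \<open>G\<close>.\<close>
  have "c = pcoeff ?F 0" by (subst Y(2)) (rule pcoeff_step_0[symmetric])
  then have "c = 0" using inverse.hyps(2) by (simp add: Abs_pser_inverse)
  then have "?F * ?G = (\<Sum>v\<in>{1..k}. xvar v * (Y v * ?G))"
    by (subst Y(2)) (simp add: sum_distrib_right mult.assoc)
  moreover have "Y v * ?G \<in> nspan Z" for v
    using nspan_mult[of X "Y v" ?G] Y(1) X Z by (auto simp: stable_def intro: nspan_mono)
  ultimately have "step k Z (1 + ?F * ?G)"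
    using step_add[OF step_of_nat[of k Z 1] step_sum_vars[of "\<lambda>v. Y v * ?G" Z k]] by simp
  then have G: "step k Z ?G" using G1 by simp
  have "step k Z z" if "z \<in> Z" for z
    using that step_mult[OF X(1) _ Z G] G by (auto simp: Z_def)
  then have "stable k Z" using Z by (simp add: stable_def)
  moreover have "?G \<in> nspan Z" using Z by (intro nspan_base) (auto simp: Z_def)
  ultimately show ?case by blast
qed

section \<open>Paths of a finite automaton, counted by weight\<close>

type_synonym 'q edge = "'q \<times> nat \<times> 'q"

definition edge_src :: "'q edge \<Rightarrow> 'q" where "edge_src e = fst e"
definition edge_label :: "'q edge \<Rightarrow> nat" where "edge_label e = fst (snd e)"
definition edge_dst :: "'q edge \<Rightarrow> 'q" where "edge_dst e = snd (snd e)"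

definition edge_weight :: "'q edge \<Rightarrow> exps" where
  "edge_weight e = Poly_Mapping.single (edge_label e) 1"

text \<open>Composable edges form a local language. Of the dummy edge \<open>(q, 0, q)\<close> in
  front only the target matters; it makes the empty path a path from \<open>q\<close> to
  itself.\<close>

definition paths :: "'q edge set \<Rightarrow> 'q \<Rightarrow> 'q \<Rightarrow> 'q edge list set" where
  "paths E f q = words E (\<lambda>e e'. edge_dst e = edge_src e') (\<lambda>e. edge_dst e = f) (q, 0, q)"

lemma Nil_in_paths [simp]: "[] \<in> paths E f q \<longleftrightarrow> q = f"
  by (simp add: paths_def edge_dst_def)

lemma Cons_in_paths [simp]: "e # es \<in> paths E f q \<longleftrightarrow> e \<in> E \<and> edge_src e = q \<and> es \<in> paths E f (edge_dst e)"
proof -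
  have "es \<in> words E (\<lambda>e e'. edge_dst e = edge_src e') (\<lambda>e. edge_dst e = f) e
    \<longleftrightarrow> es \<in> words E (\<lambda>e e'. edge_dst e = edge_src e') (\<lambda>e. edge_dst e = f) (edge_dst e, 0, edge_dst e)"
    by (cases es) (simp_all add: edge_dst_def)
  then show ?thesis by (auto simp: paths_def) (auto simp: edge_dst_def edge_src_def)
qed

definition path_count :: "'q edge set \<Rightarrow> 'q \<Rightarrow> 'q \<Rightarrow> exps \<Rightarrow> nat" where
  "path_count E f q M = card {es \<in> paths E f q. (\<Sum>e\<leftarrow>es. edge_weight e) = M}"

lemma edge_weight_nonzero: "edge_weight e \<noteq> 0"
  unfolding edge_weight_def by (metis lookup_single_eq lookup_zero one_neq_zero)

lemma single_plus_iff:
  fixes M :: "exps"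
  shows "(\<exists>p. M = Poly_Mapping.single v 1 + p) \<longleftrightarrow> 0 < expt M v"
  by (auto simp: ex_add_iff_le lookup_single lookup_numeral lookup_one when_def Suc_le_eq)

lemma path_count_rec:
  assumes Q: "finite Q" "\<And>q. q \<in> Q \<Longrightarrow> finite (out q)" and q: "q \<in> Q"
  defines "E \<equiv> Sigma Q out"
  shows "path_count E f q M = (if q = f \<and> M = 0 then 1 else 0) +
    (\<Sum>(v, d)\<in>out q. if 0 < expt M v then path_count E f d (M - Poly_Mapping.single v 1) else 0)"
proof -
  let ?R = "\<lambda>e e'. edge_dst e = edge_src e'" and ?F = "\<lambda>e. edge_dst e = f"
  have finE: "finite E" using Q by (simp add: E_def)
  have wc: "word_count E ?R ?F edge_weight e M = path_count E f (edge_dst e) M" for e M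
  proof -
    have "es \<in> words E ?R ?F e \<longleftrightarrow> es \<in> paths E f (edge_dst e)" for es
      by (cases es) (auto simp: paths_def edge_dst_def)
    then show ?thesis by (simp add: word_count_def path_count_def)
  qed
  have "path_count E f q M = word_count E ?R ?F edge_weight (q, 0, q) M"
    using wc[of "(q, 0, q)"] by (simp add: edge_dst_def)
  also have "\<dots> = (if q = f \<and> M = 0 then 1 else 0) + (\<Sum>e\<in>E. if ?R (q, 0, q) e \<and> (\<exists>p. M = edge_weight e + p)
      then path_count E f (edge_dst e) (M - edge_weight e) else 0)"
    by (subst word_count_rec[OF finE]) (simp_all add: edge_weight_nonzero wc cong: if_cong, simp add: edge_dst_def)
  also have "(\<Sum>e\<in>E. if ?R (q, 0, q) e \<and> (\<exists>p. M = edge_weight e + p)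
      then path_count E f (edge_dst e) (M - edge_weight e) else 0) =
    (\<Sum>(p, v, d)\<in>E. if p = q \<and> 0 < expt M v
      then path_count E f d (M - Poly_Mapping.single v 1) else 0)"
    by (rule sum.cong) (auto simp: edge_weight_def edge_dst_def edge_src_def edge_label_def single_plus_iff[simplified])
  also have "\<dots> = (\<Sum>p\<in>Q. \<Sum>(v, d)\<in>out p. if p = q \<and> 0 < expt M v
      then path_count E f d (M - Poly_Mapping.single v 1) else 0)"
    unfolding E_def using Q by (subst sum.Sigma) (auto simp: case_prod_beta)
  also have "\<dots> = (\<Sum>p\<in>Q. if p = q then (\<Sum>(v, d)\<in>out q. if 0 < expt M v
      then path_count E f d (M - Poly_Mapping.single v 1) else 0) else 0)"
    by (rule sum.cong) (auto intro!: sum.cong sum.neutral)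
  also have "\<dots> = (\<Sum>(v, d)\<in>out q. if 0 < expt M v
      then path_count E f d (M - Poly_Mapping.single v 1) else 0)"
    using Q(1) q by simp
  finally show ?thesis .
qed

lemma sum_Sigma3:
  assumes "finite I" "\<And>v. v \<in> I \<Longrightarrow> finite (X v)" "\<And>v y. v \<in> I \<Longrightarrow> y \<in> X v \<Longrightarrow> finite (R v y)"
  shows "(\<Sum>v\<in>I. \<Sum>y\<in>X v. \<Sum>r\<in>R v y. h v y r) = (\<Sum>(v, y, r)\<in>(SIGMA v:I. SIGMA y:X v. R v y). h v y r)"
proof -
  have "(\<Sum>v\<in>I. \<Sum>y\<in>X v. \<Sum>r\<in>R v y. h v y r) = (\<Sum>v\<in>I. \<Sum>(y, r)\<in>Sigma (X v) (R v). h v y r)"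
    using assms by (intro sum.cong refl sum.Sigma) auto
  also have "\<dots> = (\<Sum>(v, y, r)\<in>(SIGMA v:I. SIGMA y:X v. R v y). h v y r)"
    using assms by (intro sum.Sigma) auto
  finally show ?thesis .
qed

type_synonym state = "(nat pser \<times> nat) + nat"

text \<open>
  Every coefficient of a series in the finite stable set \<open>X\<close> is a sum over paths.  Copies
  \<open>Inl (x, r)\<close> of the states \<open>x\<close> and the intermediate states \<open>Inr (Suc r)\<close> turn multiplicities
  into distinct edges; the extra variable \<open>x\<^sub>0\<close> marks the beginning and the two final edges.
\<close>

lemma N_rational_path_count:
  assumes F: "F \<in> N_rational k"
  obtains E :: "state edge set" where "finite E" "edge_label ` E \<subseteq> {0..k}"
    "\<And>m. expt m 0 = 0 \<Longrightarrow>
      F m = path_count E (Inr 0) (Inr 0) (Poly_Mapping.single 0 3 + m)"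
proof -
  let ?l = "expt" and ?s = "Poly_Mapping.single :: nat \<Rightarrow> nat \<Rightarrow> _"
  obtain X where X: "stable k X" "Abs_pser F \<in> nspan X" using N_rational_stable[OF F] by blast
  then have finX: "finite X" by (simp add: stable_def)
  obtain b where b: "Abs_pser F = (\<Sum>x\<in>X. of_nat (b x) * x)" using X(2) by (auto simp: nspan_def)
  have ex: "\<exists>p. x = of_nat (fst p) + (\<Sum>v\<in>{1..k}. xvar v * (\<Sum>y\<in>X. of_nat (snd p v y) * y))" if xX: "x \<in> X" for x
  proof -
    have "step k X x" using X(1) xX by (simp add: stable_def)
    then obtain c Y where Y: "\<forall>v. Y v \<in> nspan X" "x = of_nat c + var_sum k Y"
      unfolding step_def by blast
    then have "\<forall>v. \<exists>a. Y v = (\<Sum>y\<in>X. of_nat (a y) * y)" by (auto simp: nspan_def)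
    then obtain A where "\<And>v. Y v = (\<Sum>y\<in>X. of_nat (A v y) * y)" by metis
    then show ?thesis using Y(2) by (intro exI[of _ "(c, A)"]) simp
  qed
  define c where "c x = fst (SOME p. x = of_nat (fst p) + (\<Sum>v\<in>{1..k}. xvar v * (\<Sum>y\<in>X. of_nat (snd p v y) * y)))" for x
  define A where "A x = snd (SOME p. x = of_nat (fst p) + (\<Sum>v\<in>{1..k}. xvar v * (\<Sum>y\<in>X. of_nat (snd p v y) * y)))" for x
  have cA: "x = of_nat (c x) + (\<Sum>v\<in>{1..k}. xvar v * (\<Sum>y\<in>X. of_nat (A x v y) * y))" if "x \<in> X" for x
    unfolding c_def A_def by (rule someI_ex[OF ex[OF that]])
  have coeff_rec: "pcoeff x m = (if m = 0 then c x else 0) +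
     (\<Sum>v\<in>{1..k}. \<Sum>y\<in>X. if 0 < ?l m v then A x v y * pcoeff y (m - ?s v 1) else 0)" if "x \<in> X" for x m
  proof -
    have "pcoeff x m = pcoeff (of_nat (c x) + (\<Sum>v\<in>{1..k}. xvar v * (\<Sum>y\<in>X. of_nat (A x v y) * y))) m"
      using cA[OF that] by simp
    also have "\<dots> = (if m = 0 then c x else 0) + (\<Sum>v\<in>{1..k}. if 0 < ?l m v then
       (\<Sum>y\<in>X. A x v y * pcoeff y (m - ?s v 1)) else 0)"
      by (simp add: pcoeff_of_nat pcoeff_sum pcoeff_pmono_mult single_plus_iff[simplified] pcoeff_of_nat_mult cong: if_cong)
    also have "(\<Sum>v\<in>{1..k}. if 0 < ?l m v then (\<Sum>y\<in>X. A x v y * pcoeff y (m - ?s v 1)) else 0)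
      = (\<Sum>v\<in>{1..k}. \<Sum>y\<in>X. if 0 < ?l m v then A x v y * pcoeff y (m - ?s v 1) else 0)"
      by (rule sum.cong) auto
    finally show ?thesis .
  qed
  \<comment> \<open>\<open>C\<close> bounds the constants and \<open>K\<close> (below) all initial
    and transition multiplicities, so that every copy used as the target of an edge is a
    state.\<close>
  define C where "C = (\<Sum>x\<in>X. c x)"
  define K where "K = (\<Sum>x\<in>X. b x) + (\<Sum>x\<in>X. \<Sum>v\<in>{1..k}. \<Sum>y\<in>X. A x v y)"
  have C: "c x \<le> C" if "x \<in> X" for x unfolding C_def using finX that by (rule member_le_sum[rotated 2]) simp
  have Kb: "b x \<le> K" if "x \<in> X" for x
    using member_le_sum[of x X b] finX that by (simp add: K_def)
  have KA: "A x v y \<le> K" if "x \<in> X" "v \<in> {1..k}" "y \<in> X" for x v y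
  proof -
    have "A x v y \<le> (\<Sum>y\<in>X. A x v y)" using finX that by (intro member_le_sum) auto
    also have "\<dots> \<le> (\<Sum>v\<in>{1..k}. \<Sum>y\<in>X. A x v y)"
      using that(2) by (intro member_le_sum[of v _ "\<lambda>v. \<Sum>y\<in>X. A x v y"]) auto
    also have "\<dots> \<le> (\<Sum>x\<in>X. \<Sum>v\<in>{1..k}. \<Sum>y\<in>X. A x v y)"
      using finX that by (intro member_le_sum[of x _ "\<lambda>x. \<Sum>v\<in>{1..k}. \<Sum>y\<in>X. A x v y"]) auto
    finally show ?thesis by (simp add: K_def)
  qed
  define Q :: "state set" where "Q = Inl ` (X \<times> {..<K}) \<union> Inr ` {..C}"
  define out :: "state \<Rightarrow> (nat \<times> state) set" where
    "out q = (case q of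
        Inl (x, r) \<Rightarrow> (\<lambda>(v, y, r'). (v, Inl (y, r'))) ` (SIGMA v:{1..k}. SIGMA y:X. {..<A x v y})
          \<union> (\<lambda>r'. (0, Inr (Suc r'))) ` {..<c x}
      | Inr r \<Rightarrow> if r = 0 then (\<lambda>(x, r'). (0, Inl (x, r'))) ` (SIGMA x:X. {..<b x}) else {(0, Inr 0)})" for q
  define E where "E = Sigma Q out"
  have finQ: "finite Q" using finX by (simp add: Q_def)
  have fin_out: "finite (out q)" for q using finX by (auto simp: out_def split: sum.split prod.split)
  let ?n = "path_count E (Inr 0)"
  have rec: "?n q M = (if q = Inr 0 \<and> M = 0 then 1 else 0) +
    (\<Sum>(v, d)\<in>out q. if 0 < ?l M v then ?n d (M - ?s v 1) else 0)" if "q \<in> Q" for q M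
    unfolding E_def using finQ fin_out that by (rule path_count_rec)
  have reindex1: "sum g ((\<lambda>(v, y, r'). (v, Inl (y, r'))) ` U) = (\<Sum>(v, y, r')\<in>U. g (v, Inl (y, r')))"
    for U and g :: "nat \<times> state \<Rightarrow> nat"
    by (subst sum.reindex) (auto simp: inj_on_def case_prod_beta)
  have reindex2: "sum g ((\<lambda>(x, r'). (0, Inl (x, r'))) ` U) = (\<Sum>(x, r')\<in>U. g (0, Inl (x, r')))"
    for U and g :: "nat \<times> state \<Rightarrow> nat"
    by (subst sum.reindex) (auto simp: inj_on_def case_prod_beta)
  \<comment> \<open>The four counts \<open>n0\<close> to \<open>n3\<close> are indexed by the number
    of marks still to be read: back at the wall, about to return, inside the automaton, and before
    the start. Every edge that leaves \<open>Inr 0\<close> carries a mark, so without marks only the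
    empty path remains and no second round can begin.\<close>
  have n0: "?n (Inr 0) m = (if m = 0 then 1 else 0)" if "?l m 0 = 0" for m
    using that by (subst rec) (auto simp: Q_def out_def intro!: sum.neutral)
  have n1: "?n (Inr (Suc r)) (?s 0 1 + m) = (if m = 0 then 1 else 0)" if "?l m 0 = 0" "r < C" for r m
    using that by (subst rec) (auto simp: Q_def out_def n0 lookup_add)
  have n2: "?n (Inl (x, r)) (?s 0 2 + m) = pcoeff x m" if "?l m 0 = 0" "x \<in> X" "r < K" for x r m
    using that
  proof (induction "tdeg m" arbitrary: m x r rule: less_induct)
    case less
    let ?g = "\<lambda>(v, d). if 0 < ?l (?s 0 2 + m) v then ?n d (?s 0 2 + m - ?s v 1) else 0"
    let ?U = "SIGMA v:{1..k}. SIGMA y:X. {..<A x v y}"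
    have "?s 0 2 + m \<noteq> 0"
      by (metis add_eq_0_poly_mapping_iff lookup_single_eq lookup_zero zero_neq_numeral)
    then have "?n (Inl (x, r)) (?s 0 2 + m) = sum ?g (out (Inl (x, r)))"
      using less.prems by (subst rec) (auto simp: Q_def)
    also have "\<dots> = sum ?g ((\<lambda>(v, y, r'). (v, Inl (y, r'))) ` ?U) + sum ?g ((\<lambda>r'. (0, Inr (Suc r'))) ` {..<c x})"
      unfolding out_def using finX by (simp, intro sum.union_disjoint) auto
    also have "sum ?g ((\<lambda>r'. (0, Inr (Suc r'))) ` {..<c x}) = (\<Sum>r'\<in>{..<c x}. ?g (0, Inr (Suc r')))"
      by (subst sum.reindex) (auto simp: inj_on_def)
    also have "\<dots> = (\<Sum>r'\<in>{..<c x}. if m = 0 then 1 else 0)"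
    proof (rule sum.cong[OF refl])
      fix r' assume "r' \<in> {..<c x}"
      then have "r' < C" using C[OF less.prems(2)] by simp
      have eq: "?s 0 2 + m - ?s 0 1 = ?s 0 1 + m"
        by (rule poly_mapping_eqI) (simp add: lookup_add lookup_minus lookup_single lookup_numeral lookup_one when_def)
      show "?g (0, Inr (Suc r')) = (if m = 0 then 1 else 0)"
        unfolding prod.case eq n1[OF less.prems(1) \<open>r' < C\<close>]
        by (simp add: lookup_add lookup_numeral when_def)
    qed
    also have "\<dots> = (if m = 0 then c x else 0)" by simp
    also have "sum ?g ((\<lambda>(v, y, r'). (v, Inl (y, r'))) ` ?U) = (\<Sum>(v, y, r')\<in>?U. ?g (v, Inl (y, r')))"
      by (rule reindex1)
    also have "\<dots> = (\<Sum>(v, y, r')\<in>?U. if 0 < ?l m v then pcoeff y (m - ?s v 1) else 0)"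
    proof (rule sum.cong[OF refl])
      fix z assume "z \<in> ?U"
      then obtain v y r' where z: "z = (v, y, r')" and U: "v \<in> {1..k}" "y \<in> X" "r' \<in> {..<A x v y}"
        by (elim SigmaE) simp
      have v: "v \<noteq> 0" using U by auto
      have "?n (Inl (y, r')) (?s 0 2 + m - ?s v 1) = pcoeff y (m - ?s v 1)" if lv: "0 < ?l m v"
      proof -
        obtain p where p: "m = ?s v 1 + p" using lv single_plus_iff[of m v] by auto
        have e: "?s 0 2 + m - ?s v 1 = ?s 0 2 + p" "m - ?s v 1 = p"
          unfolding p by (rule poly_mapping_eqI, simp add: lookup_add lookup_minus)+
        have "tdeg p < tdeg m" using p by (simp add: tdeg_add)
        moreover have "?l p 0 = 0" using less.prems(1) p by (simp add: lookup_add)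
        moreover have "r' < K" using KA[OF less.prems(2) U(1,2)] U(3) by simp
        ultimately show ?thesis unfolding e using less.hyps U(2) by blast
      qed
      moreover have "?l (?s 0 2 + m) v = ?l m v"
        using v by (simp add: lookup_add lookup_single lookup_numeral when_def)
      ultimately show "(case z of (v, y, r') \<Rightarrow> ?g (v, Inl (y, r'))) =
          (case z of (v, y, r') \<Rightarrow> if 0 < ?l m v then pcoeff y (m - ?s v 1) else 0)"
        unfolding z by (cases "0 < ?l m v") (simp_all only: prod.case if_True if_False simp_thms)
    qed
    also have "\<dots> = (\<Sum>v\<in>{1..k}. \<Sum>y\<in>X. \<Sum>r'\<in>{..<A x v y}. if 0 < ?l m v then pcoeff y (m - ?s v 1) else 0)"
      using finX by (intro sum_Sigma3[symmetric]) auto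
    also have "\<dots> = (\<Sum>v\<in>{1..k}. \<Sum>y\<in>X. if 0 < ?l m v then A x v y * pcoeff y (m - ?s v 1) else 0)"
      by (intro sum.cong refl) simp
    finally show ?case using coeff_rec[OF less.prems(2), of m] by simp
  qed
  have n3: "?n (Inr 0) (?s 0 3 + m) = F m" if "?l m 0 = 0" for m
  proof -
    let ?g = "\<lambda>(v, d). if 0 < ?l (?s 0 3 + m) v then ?n d (?s 0 3 + m - ?s v 1) else 0"
    let ?U = "SIGMA x:X. {..<b x}"
    have "?s 0 3 + m \<noteq> 0"
      by (metis add_eq_0_poly_mapping_iff lookup_single_eq lookup_zero zero_neq_numeral)
    then have "?n (Inr 0) (?s 0 3 + m) = sum ?g (out (Inr 0))"
      by (subst rec) (auto simp: Q_def)
    also have "\<dots> = (\<Sum>(x, r)\<in>?U. ?g (0, Inl (x, r)))"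
      unfolding out_def sum.case if_P[OF refl] by (rule reindex2)
    also have "\<dots> = (\<Sum>(x, r)\<in>?U. pcoeff x m)"
    proof (rule sum.cong[OF refl])
      fix z assume "z \<in> ?U"
      then obtain x r where z: "z = (x, r)" and U: "x \<in> X" "r \<in> {..<b x}"
        by (elim SigmaE) simp
      have eq: "?s 0 3 + m - ?s 0 1 = ?s 0 2 + m"
        by (rule poly_mapping_eqI) (simp add: lookup_add lookup_minus lookup_single lookup_numeral lookup_one when_def)
      have "r < K" using Kb[OF U(1)] U(2) by simp
      then show "(case z of (x, r) \<Rightarrow> ?g (0, Inl (x, r))) = (case z of (x, r) \<Rightarrow> pcoeff x m)"
        unfolding z prod.case eq n2[OF that U(1) \<open>r < K\<close>] by (simp add: lookup_add lookup_numeral when_def)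
    qed
    also have "\<dots> = (\<Sum>x\<in>X. b x * pcoeff x m)"
      using finX by (subst sum.Sigma[symmetric]) auto
    also have "\<dots> = pcoeff (Abs_pser F) m"
      by (simp add: b pcoeff_sum pcoeff_of_nat_mult)
    finally show ?thesis by (simp add: Abs_pser_inverse)
  qed
  show thesis
  proof (rule that[of E])
    show "finite E" unfolding E_def using finQ fin_out by simp
    show "edge_label ` E \<subseteq> {0..k}"
      by (auto simp: E_def out_def edge_label_def split: sum.splits if_splits)
    show "F m = path_count E (Inr 0) (Inr 0) (Poly_Mapping.single 0 3 + m)" if "?l m 0 = 0" for m
      using n3[OF that] by simp
  qed
qed

text \<open>Unique factorisation makes logarithms of distinct primes independent over the integers,
  so a total length determines all exponents. They are divided by the sum of those with indices 1 to
  \<open>k\<close>; the lengths of these variables then add up to 1, and exponent \<open>n\<close>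
  in each of them gives total length \<open>n\<close>.\<close>

lemma independent_lengths:
  fixes k :: nat
  assumes "k \<ge> 1"
  obtains l :: "nat \<Rightarrow> real" where "\<And>v. 0 < l v" "inj l"
    "\<And>M n. vars M \<subseteq> {0..k} \<Longrightarrow>
      (\<Sum>v\<in>{0..k}. real (expt M v) * l v) = real n + 3 * l 0 \<longleftrightarrow>
      M = Poly_Mapping.single 0 3 + diag_monomial k n"
proof -
  let ?l = "expt"
  obtain p :: "nat \<Rightarrow> nat" where p: "inj p" "range p \<subseteq> {p. prime p}"
    using infinite_countable_subset[OF primes_infinite] by blast
  have prime: "prime (p v)" for v using p(2) by auto
  have gt1: "1 < p v" for v using prime prime_gt_1_nat by blast
  define m where "m v = ln (real (p v))" for v
  have m: "0 < m v" for v using gt1[of v] by (simp add: m_def)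
  have unique: "\<forall>v\<in>{0..k}. c v = d v"
    if eq: "(\<Sum>v\<in>{0..k}. real (c v) * m v) = (\<Sum>v\<in>{0..k}. real (d v) * m v)" for c d :: "nat \<Rightarrow> nat"
  proof
    have ln: "(\<Sum>v\<in>{0..k}. real (c v) * m v) = ln (real (\<Prod>v\<in>{0..k}. p v ^ c v))" for c :: "nat \<Rightarrow> nat"
      using gt1 by (simp add: ln_prod m_def ln_realpow less_imp_neq[THEN not_sym] order.strict_trans[OF zero_less_one])
    have pos: "0 < real (\<Prod>v\<in>{0..k}. p v ^ c v)" for c :: "nat \<Rightarrow> nat"
      unfolding of_nat_0_less_iff using prime prime_gt_0_nat by (intro prod_pos) simp
    have "real (\<Prod>v\<in>{0..k}. p v ^ c v) = real (\<Prod>v\<in>{0..k}. p v ^ d v)"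
      using eq ln_inj_iff[OF pos pos] unfolding ln by blast
    then have prods: "(\<Prod>v\<in>{0..k}. p v ^ c v) = (\<Prod>v\<in>{0..k}. p v ^ d v)" by (simp only: of_nat_eq_iff)
    fix v assume v: "v \<in> {0..k}"
    have mult: "multiplicity (p v) (\<Prod>v\<in>{0..k}. p v ^ c v) = c v" for c :: "nat \<Rightarrow> nat"
    proof -
      have "(\<Prod>v\<in>{0..k}. p v ^ c v) = (\<Prod>q\<in>p ` {0..k}. q ^ c (inv p q))"
        using p(1) by (subst prod.reindex) (auto simp: inj_on_def inj_def)
      also have "multiplicity (p v) \<dots> = c v"
        using v prime p(1) by (subst multiplicity_prod_prime_powers) auto
      finally show ?thesis .
    qed
    show "c v = d v" using mult[of c] mult[of d] prods by simp
  qed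
  define s where "s = (\<Sum>v\<in>{1..k}. m v)"
  have s: "0 < s" unfolding s_def using m assms by (intro sum_pos) auto
  define l where "l v = m v / s" for v
  show thesis
  proof (rule that[of l])
    show "0 < l v" for v using m s by (simp add: l_def)
    have "p v = p w" if "l v = l w" for v w
    proof -
      have "ln (real (p v)) = ln (real (p w))" using that s by (simp add: l_def m_def)
      moreover have "0 < real (p v)" "0 < real (p w)" using gt1[of v] gt1[of w] by linarith+
      ultimately show ?thesis by (simp only: ln_inj_iff of_nat_eq_iff)
    qed
    then show "inj l" using p(1) by (auto intro!: injI dest: injD)
    fix M :: "exps" and n :: nat assume M: "vars M \<subseteq> {0..k}"
    define d :: "nat \<Rightarrow> nat" where "d v = (if v = 0 then 3 else n)" for v
    have split: "{0..k} = insert 0 {1..k}" by auto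
    have d: "(\<Sum>v\<in>{0..k}. real (d v) * m v) = 3 * m 0 + real n * s"
      unfolding split s_def sum_distrib_left by (subst sum.insert) (auto simp: d_def intro!: sum.cong)
    have "(\<Sum>v\<in>{0..k}. real (?l M v) * l v) = real n + 3 * l 0 \<longleftrightarrow>
        (\<Sum>v\<in>{0..k}. real (?l M v) * m v) / s = (3 * m 0 + real n * s) / s"
      using s by (simp add: l_def sum_divide_distrib add_divide_distrib algebra_simps)
    also have "\<dots> \<longleftrightarrow> (\<Sum>v\<in>{0..k}. real (?l M v) * m v) = (\<Sum>v\<in>{0..k}. real (d v) * m v)"
      using s d by simp
    also have "\<dots> \<longleftrightarrow> (\<forall>v\<in>{0..k}. ?l M v = d v)"
      using unique[of "?l M" d] by auto
    also have "\<dots> \<longleftrightarrow> M = Poly_Mapping.single 0 3 + diag_monomial k n"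
    proof
      assume eq: "\<forall>v\<in>{0..k}. ?l M v = d v"
      show "M = Poly_Mapping.single 0 3 + diag_monomial k n"
      proof (rule poly_mapping_eqI)
        fix v
        have "?l M v = 0" if "v \<notin> {0..k}" using M that by (auto simp: in_keys_iff)
        then show "?l M v = ?l (Poly_Mapping.single 0 3 + diag_monomial k n) v"
          using eq by (cases "v \<in> {0..k}")
            (auto simp: d_def lookup_add lookup_single lookup_numeral lookup_one when_def diag_monomial_def lookup_sum_single)
      qed
    next
      assume "M = Poly_Mapping.single 0 3 + diag_monomial k n"
      then show "\<forall>v\<in>{0..k}. ?l M v = d v"
        by (auto simp: d_def lookup_add lookup_single lookup_numeral lookup_one when_def diag_monomial_def lookup_sum_single)
    qed
    finally show "(\<Sum>v\<in>{0..k}. real (?l M v) * l v) = real n + 3 * l 0 \<longleftrightarrow>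
      M = Poly_Mapping.single 0 3 + diag_monomial k n" .
  qed
qed

section \<open>Jigsaw tiles\<close>

lemma layered_section:
  assumes "b < N" "y \<in> interior (level N b)"
  shows "(x, y) \<in> layered N A \<longleftrightarrow> x \<in> A b"
proof
  assume "(x, y) \<in> layered N A"
  then obtain b' where b': "b' < N" "x \<in> A b'" "y \<in> level N b'" by (auto simp: layered_def)
  have "real b < y * N" "y * N < real b + 1" "real b' \<le> y * N" "y * N \<le> real b' + 1"
    using assms b'(3) by (auto simp: interior_level level_def field_simps)
  then have "real b' < real b + 1" "real b < real b' + 1" by linarith+
  then have "b = b'" by linarith
  then show "x \<in> A b" using b' by simp
next
  assume "x \<in> A b"
  then show "(x, y) \<in> layered N A" using assms interior_subset by (auto simp: layered_def)
qed

lemma interior_level_nonempty: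
  assumes "N > 0"
  shows "interior (level N b) \<noteq> {}"
proof -
  have "real b / real N < (real b + 1) / real N" using assms by (intro divide_strict_right_mono) auto
  then show ?thesis unfolding interior_level by (simp add: not_le)
qed

lemma mem_layeredI: "b < N \<Longrightarrow> x \<in> A b \<Longrightarrow> y \<in> level N b \<Longrightarrow> (x, y) \<in> layered N A"
  by (auto simp: layered_def)

lemma layered_inj:
  assumes "layered N A = layered N B" "b < N"
  shows "A b = B b"
proof -
  obtain y where "y \<in> interior (level N b)" using interior_level_nonempty[of N b] assms(2) by auto
  then show ?thesis using layered_section[OF assms(2)] assms(1) by blast
qed

lemma layered_const: "N > 0 \<Longrightarrow> layered N (\<lambda>_. X) = X \<times> {0..1}"
proof
  show "layered N (\<lambda>_. X) \<subseteq> X \<times> {0..1}" using level_strip by (auto simp: layered_def)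
  assume "N > 0"
  show "X \<times> {0..1} \<subseteq> layered N (\<lambda>_. X)"
  proof clarify
    fix x and y :: real assume x: "x \<in> X" and "y \<in> {0..1}"
    then obtain b where "b < N" "y \<in> level N b" using ex_level[of y N] \<open>N > 0\<close> by auto
    then show "(x, y) \<in> layered N (\<lambda>_. X)" using x by (intro mem_layeredI)
  qed
qed

lemma shift_layered: "shift s (layered N A) = layered N (\<lambda>b. (+) s ` A b)"
  by (auto simp: layered_def shift_def) (force simp: image_iff)

text \<open>The set is contracted horizontally onto the column at \<open>c\<close>, and the column
  then vertically to a point.\<close>

lemma simply_connected_layered:
  assumes "sections N A"
  shows "simply_connected (layered N A)"
proof -
  let ?S = "layered N A"
  obtain c where c: "\<And>b. b < N \<Longrightarrow> c \<in> A b" and N: "N > 0"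
    using assms interior_subset unfolding sections_def by blast
  have col: "{c} \<times> {0..1} \<subseteq> ?S"
    using ex_level[OF _ _ N] c by (fastforce intro: mem_layeredI)
  have "homotopic_with_canon (\<lambda>_. True) ?S ?S id (\<lambda>z. (c, snd z))"
  proof (rule homotopic_with_linear)
    fix z assume "z \<in> ?S"
    then obtain x y b where z: "z = (x, y)" "b < N" "x \<in> A b" "y \<in> level N b" by (auto simp: layered_def)
    have "convex (A b \<times> level N b)"
      using assms z(2) by (intro convex_Times) (auto simp: sections_def level_def)
    then have "closed_segment (x, y) (c, y) \<subseteq> A b \<times> level N b"
      using z c[OF z(2)] by (intro closed_segment_subset) auto
    also have "\<dots> \<subseteq> ?S" using z(2) by (auto simp: layered_def)
    finally show "closed_segment (id z) (c, snd z) \<subseteq> ?S" by (simp add: z)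
  qed (auto intro!: continuous_intros)
  moreover have "homotopic_with_canon (\<lambda>_. True) ?S ?S (\<lambda>z. (c, snd z)) (\<lambda>z. (c, 0))"
  proof (rule homotopic_with_linear)
    fix z assume "z \<in> ?S"
    then have "snd z \<in> {0..1}" using subsetD[OF layered_subset_strip] by (cases z) auto
    moreover have "convex ({c} \<times> {0..1::real})" by (intro convex_Times) auto
    ultimately have "closed_segment (c, snd z) (c, 0) \<subseteq> {c} \<times> {0..1}"
      by (intro closed_segment_subset) auto
    then show "closed_segment (c, snd z) (c, 0) \<subseteq> ?S" using col by (rule order_trans)
  qed (auto intro!: continuous_intros)
  ultimately have "homotopic_with_canon (\<lambda>_. True) ?S ?S id (\<lambda>z. (c, 0))"
    by (rule homotopic_with_trans)
  then have "contractible ?S" unfolding contractible_def by blast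
  then show ?thesis by (rule contractible_imp_simply_connected)
qed

lemma snd_layered:
  assumes "sections N A"
  shows "snd ` layered N A = {0..1}"
proof
  show "snd ` layered N A \<subseteq> {0..1}" using layered_subset_strip[of N A] by auto
  show "{0..1} \<subseteq> snd ` layered N A"
  proof
    fix y :: real assume "y \<in> {0..1}"
    then obtain b where b: "b < N" "y \<in> level N b" using ex_level[of y N] assms by (auto simp: sections_def)
    obtain c where "c \<in> A b" using assms b(1) interior_subset unfolding sections_def by blast
    then have "(c, y) \<in> layered N A" using b by (intro mem_layeredI)
    then show "y \<in> snd ` layered N A" by force
  qed
qed

lemma tall_tile_layered:
  assumes A: "sections N A" and iv: "\<And>b. b < N \<Longrightarrow> A b = {f b..g b}"
  shows "tall_tile (layered N A)"
proof -
  have N: "N > 0" using assms by (simp add: sections_def)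
  have fg: "f b < g b" if "b < N" for b
    using A iv[OF that] that by (auto simp: sections_def)
  have "axis_parallel_polygon (layered N A)"
    unfolding axis_parallel_polygon_def
  proof (intro conjI exI)
    let ?B = "(\<lambda>b. A b \<times> level N b) ` {..<N}"
    show "finite ?B" by simp
    show "?B \<noteq> {}" using N by auto
    show "layered N A = \<Union>?B" by (simp add: layered_def)
    show "connected (interior (layered N A))" by (rule connected_interior_layered[OF A])
    show "\<forall>R\<in>?B. \<exists>a b c d. a < b \<and> c < d \<and> R = {a..b} \<times> {c..d}"
    proof clarify
      fix b assume "b < N"
      then show "\<exists>a b' c d. a < b' \<and> c < d \<and> A b \<times> level N b = {a..b'} \<times> {c..d}"
        using iv[of b] fg[of b] N
        by (intro exI[of _ "f b"] exI[of _ "g b"] exI[of _ "real b / N"] exI[of _ "(real b + 1) / N"])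
           (simp add: level_def divide_strict_right_mono)
    qed
  qed
  then show ?thesis
    using simply_connected_layered[OF A] snd_layered[OF A] by (simp add: tall_tile_def tile_def height_def)
qed

text \<open>Used to cut a tile off the part of the strip that is still to be tiled. Order is
  inherited, since interiors and bottoms of the parts lie in those of the union.\<close>

lemma row_split_last:
  assumes r: "row (as @ [Q \<union> R])" and pieces: "piece Q" "piece R" and QR: "before Q R"
  shows "row (as @ [Q, R])"
proof -
  have sub: "before X Q \<and> before X R" if "X \<in> set as" for X
  proof -
    have "before X (Q \<union> R)" using r that by (auto simp: row_def sorted_wrt_append)
    moreover have "interior Q \<subseteq> interior (Q \<union> R)" "interior R \<subseteq> interior (Q \<union> R)"
      by (auto intro: interior_mono[THEN subsetD])
    moreover from this have "lower Q \<subseteq> lower (Q \<union> R)" "lower R \<subseteq> lower (Q \<union> R)"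
      unfolding lower_def by (auto intro: foot_mono[THEN subsetD])
    ultimately show ?thesis unfolding before_def left_of_def by blast
  qed
  have "\<forall>P\<in>set (as @ [Q, R]). piece P" using r pieces by (simp add: row_def)
  moreover have "sorted_wrt before (as @ [Q, R])"
    using r sub QR by (auto simp: row_def sorted_wrt_append)
  moreover have "\<Union>(set (as @ [Q, R])) = \<Union>(set (as @ [Q \<union> R]))" by auto
  ultimately show ?thesis using r by (simp add: row_def)
qed

text \<open>Index 0 means a flat side, so the wall state matches the half strips. Any other state
  has its bump at the level of its index: the bottom level stays flat, and
  \<open>idx + 1 < N\<close> leaves a flat level above, so that a dent is closed from below and
  above. With \<delta> below every length the two sides of a tile stay apart.\<close>

locale jigsaw =
  fixes E :: "'q edge set" and wall :: 'q and idx :: "'q \<Rightarrow> nat" and l :: "nat \<Rightarrow> real"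
    and N :: nat and \<delta> :: real
  assumes finite_E: "finite E"
    and idx_wall: "idx wall = 0"
    and idx_inj: "inj_on idx (insert wall (edge_src ` E \<union> edge_dst ` E))"
    and idx_less: "e \<in> E \<Longrightarrow> idx (edge_src e) + 1 < N" "e \<in> E \<Longrightarrow> idx (edge_dst e) + 1 < N"
    and N_pos: "N > 1"
    and \<delta>_pos: "\<delta> > 0"
    and \<delta>_less: "e \<in> E \<Longrightarrow> \<delta> < l (edge_label e)"
    and l_inj: "inj l"
begin

abbreviation len :: "'q edge \<Rightarrow> real" where
  "len e \<equiv> l (edge_label e)"

definition bump :: "nat \<Rightarrow> nat \<Rightarrow> real" where
  "bump i b = (if i \<noteq> 0 \<and> b = i then \<delta> else 0)"

abbreviation left_end :: "'q edge \<Rightarrow> nat \<Rightarrow> real" where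
  "left_end e b \<equiv> bump (idx (edge_src e)) b"

abbreviation right_end :: "'q edge \<Rightarrow> nat \<Rightarrow> real" where
  "right_end e b \<equiv> len e + bump (idx (edge_dst e)) b"

definition sides :: "'q edge \<Rightarrow> nat \<Rightarrow> real set" where
  "sides e b = {left_end e b .. right_end e b}"

definition shape :: "'q edge \<Rightarrow> region" where
  "shape e = layered N (sides e)"

text \<open>What remains of the strip to the right of a side with index \<open>i\<close>. It is a
  piece itself and stands in for the tiles still to be placed.\<close>

definition rest :: "nat \<Rightarrow> region" where
  "rest i = layered N (\<lambda>b. {bump i b ..})"

lemma bump_bounds: "0 \<le> bump i b" "bump i b \<le> \<delta>"
  using \<delta>_pos by (auto simp: bump_def)

lemma bump_0 [simp]: "bump 0 b = 0" "bump i 0 = 0"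
  by (auto simp: bump_def)

lemma sections_sides: "e \<in> E \<Longrightarrow> sections N (sides e)"
proof -
  assume e: "e \<in> E"
  let ?c = "(\<delta> + len e) / 2"
  have c: "\<delta> < ?c" "?c < len e" using \<delta>_less[OF e] by simp_all
  have "?c \<in> interior (sides e b)" for b
    using c bump_bounds[of "idx (edge_src e)" b] bump_bounds[of "idx (edge_dst e)" b]
    unfolding sides_def interior_atLeastAtMost_real greaterThanLessThan_iff by linarith
  moreover have "closed (sides e b) \<and> convex (sides e b)" for b by (simp add: sides_def)
  ultimately show ?thesis unfolding sections_def using N_pos by (intro conjI exI[of _ ?c]) auto
qed

lemma sections_rest: "sections N (\<lambda>b. {s + bump i b ..})"
proof -
  have "s + \<delta> + 1 \<in> interior {s + bump i b ..}" for b
    using bump_bounds(2)[of i b] by simp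
  moreover have "closed {s + bump i b ..} \<and> convex {s + bump i b ..}" for b by simp
  ultimately show ?thesis unfolding sections_def using N_pos by (intro conjI exI[of _ "s + \<delta> + 1"]) auto
qed

lemma piece_shape: "e \<in> E \<Longrightarrow> piece (shape e)"
  unfolding shape_def by (intro piece_layered sections_sides)

lemma piece_rest: "piece (rest i)"
  unfolding rest_def using piece_layered[OF sections_rest[of 0 i]] by simp

lemma rest_0: "rest 0 = right_half 0"
  unfolding rest_def right_half_def using N_pos by (simp add: layered_const)

lemma lower_shape: "e \<in> E \<Longrightarrow> lower (shape e) = {0<..<len e}"
  unfolding shape_def by (simp add: lower_layered[OF sections_sides] sides_def)

lemma l_pos: "e \<in> E \<Longrightarrow> 0 < len e"
  using \<delta>_less \<delta>_pos by fastforce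

lemma width_shape: "e \<in> E \<Longrightarrow> width (shape e) = len e"
  by (simp add: width_def lower_shape l_pos)

lemma tall_tile_shape: "e \<in> E \<Longrightarrow> tall_tile (shape e)"
  unfolding shape_def
  by (rule tall_tile_layered[OF sections_sides, where f = "bump (idx (edge_src e))"
        and g = "\<lambda>b. right_end e b"]) (simp_all add: sides_def)

lemma prototile_shape: "e \<in> E \<Longrightarrow> prototile (shape e)"
proof -
  assume e: "e \<in> E"
  have "bounded (shape e)"
    unfolding shape_def layered_def sides_def level_def by (intro bounded_UN ballI bounded_Times) auto
  then show ?thesis using e by (simp add: prototile_def piece_shape lower_shape l_pos)
qed

lemma norm_tile_shape: "e \<in> E \<Longrightarrow> norm_tile (shape e) = shape e"
proof -
  assume e: "e \<in> E"
  have "snd ` shape e = {0..1}" unfolding shape_def by (rule snd_layered[OF sections_sides[OF e]])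
  then have "Inf (snd ` shape e) = 0" by simp
  moreover have "(+) (0 :: real, 0 :: real) ` shape e = shape e"
    using shift_0[of "shape e"] unfolding shift_def .
  moreover have "Inf (lower (shape e)) = 0" using prototile_shape[OF e] by (simp add: prototile_def)
  ultimately show ?thesis by (simp add: norm_tile_def)
qed

text \<open>Level 0 has no bumps, so it shows the length and hence the label; the other levels show
  the indices of the two end states. Distinct edges therefore give distinct tiles, as the tile set
  is only a set.\<close>

lemma shape_inj: "inj_on shape E"
proof (rule inj_onI)
  fix e e' assume e: "e \<in> E" "e' \<in> E" and eq: "shape e = shape e'"
  have s: "sides e b = sides e' b" if "b < N" for b
    using layered_inj[OF eq[unfolded shape_def] that] .
  have le: "left_end e b \<le> right_end e b" if "e \<in> E" for e b
    using bump_bounds(2)[of "idx (edge_src e)" b] bump_bounds(1)[of "idx (edge_dst e)" b] \<delta>_less[OF that]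
    by linarith
  have b: "left_end e b = left_end e' b \<and>
      right_end e b = right_end e' b" if "b < N" for b
    using s[OF that] le[OF e(1), of b] le[OF e(2), of b] unfolding sides_def by (simp add: Icc_eq_Icc)
  have "len e = len e'" using b[of 0] N_pos by simp
  then have label: "edge_label e = edge_label e'" using l_inj by (simp add: inj_eq)
  have inj: "i = i'" if "\<And>b. b < N \<Longrightarrow> bump i b = bump i' b" "i < N" "i' < N" for i i'
    using that(1)[of i] that(1)[of i'] that(2,3) \<delta>_pos by (auto simp: bump_def split: if_splits)
  have i: "idx (edge_src e) = idx (edge_src e')" "idx (edge_dst e) = idx (edge_dst e')"
    using b \<open>l _ = l _\<close> idx_less[OF e(1)] idx_less[OF e(2)] by (auto intro!: inj)
  have "edge_src e = edge_src e'" by (rule inj_onD[OF idx_inj i(1)]) (use e in auto)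
  moreover have "edge_dst e = edge_dst e'" by (rule inj_onD[OF idx_inj i(2)]) (use e in auto)
  ultimately show "e = e'" using label
    by (simp add: edge_src_def edge_dst_def edge_label_def prod_eq_iff)
qed

lemma shift_shape: "shift s (shape e) = layered N (\<lambda>b. {s + left_end e b .. s + len e + bump (idx (edge_dst e)) b})"
  unfolding shape_def shift_layered by (simp add: sides_def add_ac)

lemma shift_rest: "shift s (rest i) = layered N (\<lambda>b. {s + bump i b ..})"
  unfolding rest_def shift_layered by simp

lemma rest_split:
  assumes e: "e \<in> E"
  shows "rest (idx (edge_src e)) = shape e \<union> shift (len e) (rest (idx (edge_dst e)))"
    and "before (shape e) (shift (len e) (rest (idx (edge_dst e))))"
proof -
  have le: "left_end e b \<le> right_end e b" for b
    using bump_bounds(2)[of "idx (edge_src e)" b] bump_bounds(1)[of "idx (edge_dst e)" b] \<delta>_less[OF e]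
    by linarith
  have "{left_end e b..} = sides e b \<union> {right_end e b..}" for b
    using le[of b] by (auto simp: sides_def)
  then show "rest (idx (edge_src e)) = shape e \<union> shift (len e) (rest (idx (edge_dst e)))"
    unfolding shift_rest unfolding rest_def shape_def layered_def by auto
  have "left_of (shape e) (shift (len e) (rest (idx (edge_dst e))))"
    unfolding left_of_def lower_shape[OF e] shift_rest lower_layered[OF sections_rest] by simp
  moreover have "interior (shape e) \<inter> interior (shift (len e) (rest (idx (edge_dst e)))) = {}"
    unfolding shape_def shift_rest
    by (rule interior_layered_disjoint[OF sections_sides[OF e] sections_rest]) (auto simp: sides_def)
  ultimately show "before (shape e) (shift (len e) (rest (idx (edge_dst e))))"
    by (simp add: before_def)
qed

text \<open>The last piece of the row is always the untiled remainder. Each edge cuts its tile off,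
  and the new remainder begins with the side of the next state.\<close>

lemma path_imp_row:
  "row (as @ [shift s (rest (idx q))]) \<Longrightarrow> es \<in> paths E f q \<Longrightarrow>
    row (as @ place s (map shape es) @ [shift (s + (\<Sum>e\<leftarrow>es. len e)) (rest (idx f))])"
proof (induction es arbitrary: as s q)
  case (Cons e es)
  then have e: "e \<in> E" "edge_src e = q" "es \<in> paths E f (edge_dst e)" by auto
  have "shift s (rest (idx q)) = shift s (shape e) \<union> shift (s + len e) (rest (idx (edge_dst e)))"
    using rest_split(1)[OF e(1)] e(2) by (metis image_Un shift_def shift_shift)
  then have "row (as @ [shift s (shape e) \<union> shift (s + len e) (rest (idx (edge_dst e)))])"
    using Cons.prems(1) by simp
  then have "row (as @ [shift s (shape e), shift (s + len e) (rest (idx (edge_dst e)))])"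
    using before_shift[OF rest_split(2)[OF e(1)], of s]
    by (intro row_split_last) (auto intro: piece_shift piece_shape piece_rest e(1))
  then have "row ((as @ [shift s (shape e)]) @ [shift (s + len e) (rest (idx (edge_dst e)))])"
    by simp
  from Cons.IH[OF this e(3)] show ?case by (simp add: width_shape[OF e(1)] add.assoc)
qed simp

text \<open>Only the part beyond \<open>u\<close> is prescribed, so the left half strip and a placed
  tile are treated alike. The window of \<open>left_profile\<close> extends past
  \<open>s + \<delta>\<close> so as to contain the whole dent.\<close>

definition right_profile :: "(nat \<Rightarrow> real set) \<Rightarrow> real \<Rightarrow> nat \<Rightarrow> bool" where
  "right_profile A s j \<longleftrightarrow> (\<exists>u<s. \<forall>b<N. A b \<inter> {u..} = {u..s + bump j b})"

definition left_profile :: "(nat \<Rightarrow> real set) \<Rightarrow> real \<Rightarrow> nat \<Rightarrow> bool" where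
  "left_profile B s i \<longleftrightarrow> (\<exists>u>s+\<delta>. \<forall>b<N. B b \<inter> {..u} = {s + bump i b..u})"

text \<open>
  If the two sides differ, either the bump of \<open>x\<close> overlaps \<open>y\<close> or the dent of \<open>y\<close> is a hole
  bounded by \<open>x\<close> and \<open>y\<close>.  No other piece can reach into the hole: it would have to cross its
  boundary.
\<close>

lemma profiles_match:
  assumes r: "row (as @ layered N A # layered N B # bs)"
    and A: "right_profile A s j" and B: "left_profile B s i" and ij: "i + 1 < N" "j + 1 < N"
  shows "i = j"
proof (rule ccontr)
  assume "i \<noteq> j"
  let ?x = "layered N A" and ?y = "layered N B"
  obtain u where u: "u < s" "\<And>b. b < N \<Longrightarrow> A b \<inter> {u..} = {u..s + bump j b}"
    using A by (auto simp: right_profile_def)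
  obtain v where v: "v > s + \<delta>" "\<And>b. b < N \<Longrightarrow> B b \<inter> {..v} = {s + bump i b..v}"
    using B by (auto simp: left_profile_def)
  have inA: "t \<in> A b \<longleftrightarrow> t \<le> s + bump j b" if "b < N" "u \<le> t" for b t
    using u(2)[OF that(1)] that(2) by (auto simp: set_eq_iff)
  have inB: "t \<in> B b \<longleftrightarrow> s + bump i b \<le> t" if "b < N" "t \<le> v" for b t
    using v(2)[OF that(1)] that(2) by (auto simp: set_eq_iff)
  have pieces: "\<forall>P\<in>set as \<union> {?x, ?y} \<union> set bs. piece P" using r by (auto simp: row_def)
  have disj_xy: "interior ?x \<inter> interior ?y = {}"
    using r by (auto simp: row_def sorted_wrt_append before_def)
  consider "j \<noteq> 0" | "i \<noteq> 0" using \<open>i \<noteq> j\<close> by auto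
  then show False
  proof cases
    case 1
    \<comment> \<open>At level \<open>j\<close> the left piece protrudes up to
      \<open>s + \<delta>\<close>, while the right piece, having no dent at this level, already
      starts at \<open>s\<close>.\<close>
    let ?G = "{s<..<s+\<delta>} \<times> interior (level N j)"
    have j: "j < N" using ij by simp
    have "?G \<subseteq> ?x" and "?G \<subseteq> ?y"
      using layered_section[OF j] inA[OF j] inB[OF j] u(1) v(1) 1 \<open>i \<noteq> j\<close> by (auto simp: bump_def)
    then have "?G \<subseteq> interior ?x \<inter> interior ?y"
      by (intro Int_greatest interior_maximal open_Times) auto
    moreover have "?G \<noteq> {}" using \<delta>_pos interior_level_nonempty[of N j] N_pos by auto
    ultimately show False using disj_xy by blast
  next
    case 2
    let ?G = "{s<..<s+\<delta>} \<times> interior (level N i)"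
    have i: "i < N" using ij by simp
    obtain t where t: "t \<in> interior (level N i)" using interior_level_nonempty[of N i] N_pos by auto
    define z where "z = (s + \<delta> / 2, t)"
    have z: "z \<in> ?G" using t \<delta>_pos by (simp add: z_def)
    have "z \<notin> ?x" "z \<notin> ?y"
      using layered_section[OF i t] inA[OF i, of "s + \<delta> / 2"] inB[OF i, of "s + \<delta> / 2"]
        u(1) v(1) 2 \<open>i \<noteq> j\<close> \<delta>_pos by (auto simp: bump_def z_def)
    moreover have "z \<in> strip" using z interior_subset level_strip[OF i] by (fastforce simp: z_def)
    then have "z \<in> \<Union>(set (as @ ?x # ?y # bs))" using r unfolding row_def by blast
    ultimately obtain R where R: "R \<in> set as \<union> set bs" "z \<in> R" by auto
    then have pR: "piece R" using pieces by auto
    have disj: "interior R \<inter> interior ?x = {}" "interior R \<inter> interior ?y = {}"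
      using r R(1) by (auto simp: row_def sorted_wrt_append before_def)
    have opG: "open ?G" by (intro open_Times) auto
    obtain z' where "z' \<in> ?G" "z' \<in> interior R" by (rule piece_meets[OF pR opG z R(2)])
    then have "interior R \<inter> ?G \<noteq> {}" by blast
    \<comment> \<open>\<open>R\<close> abuts the bottom line, whereas the hole lies in a level with
      \<open>i \<ge> 1\<close>.\<close>
    moreover have "interior R - ?G \<noteq> {}"
    proof -
      obtain p where "p \<in> lower R" using pR by (auto simp: piece_def)
      then obtain \<epsilon> where \<epsilon>: "0 < \<epsilon>" "{p} \<times> {0<..\<epsilon>} \<subseteq> interior R"
        using foot_vertical unfolding lower_def by metis
      define y where "y = min \<epsilon> (1 / real N)"
      have y: "0 < y" "y \<le> \<epsilon>" "y \<le> 1 / real N" using \<epsilon>(1) N_pos by (auto simp: y_def)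
      have "1 / real N \<le> real i / real N" using 2 by (intro divide_right_mono) auto
      then have "y \<notin> interior (level N i)" using y by (simp add: interior_level)
      moreover have "(p, y) \<in> interior R" using y \<epsilon>(2) by auto
      ultimately show ?thesis by blast
    qed
    moreover have "connected (interior R)" using pR by (simp add: piece_def)
    ultimately have "interior R \<inter> frontier ?G \<noteq> {}" by (intro connected_Int_frontier)
    then obtain w where w: "w \<in> interior R" "w \<in> frontier ?G" by blast
    \<comment> \<open>The left edge of the hole belongs to the left piece and the right edge to the
      right piece. The horizontal edges belong to the right piece as well: its sections at levels
      \<open>i - 1\<close> and \<open>i + 1\<close> have no dent and start at
      \<open>s\<close>.\<close>
    have "frontier ?G \<subseteq> ?x \<union> ?y"
    proof
      fix w assume w: "w \<in> frontier ?G"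
      obtain a b where ab: "w = (a, b)" by (cases w)
      have "closure ?G = {s..s+\<delta>} \<times> level N i"
        using \<delta>_pos N_pos by (simp add: closure_Times closure_interior_level)
      then have wG: "s \<le> a" "a \<le> s + \<delta>" "b \<in> level N i" "w \<notin> ?G"
        using w opG by (auto simp: frontier_def interior_open ab)
      consider "a = s" | "a = s + \<delta>" | "b \<notin> interior (level N i)" using wG ab by force
      then show "w \<in> ?x \<union> ?y"
      proof cases
        case 1
        then have "a \<in> A i" using inA[OF i, of a] u(1) bump_bounds(1)[of j i] by simp
        then show ?thesis using wG i by (auto simp: layered_def ab)
      next
        case 2
        then have "a \<in> B i" using inB[OF i, of a] v(1) bump_bounds(2)[of i i] by simp
        then show ?thesis using wG i by (auto simp: layered_def ab)
      next
        case 3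
        then have "b = real i / N \<or> b = (real i + 1) / N"
          using wG(3) unfolding interior_level by (auto simp: level_def)
        then have "b \<in> level N (i - 1) \<or> b \<in> level N (i + 1)"
          using \<open>i \<noteq> 0\<close> by (auto simp: level_def of_nat_diff divide_right_mono)
        moreover have "a \<in> B (i - 1)" "a \<in> B (i + 1)"
          using inB[of "i - 1" a] inB[of "i + 1" a] ij wG(1,2) v(1) \<open>i \<noteq> 0\<close> by (auto simp: bump_def)
        ultimately show ?thesis using ij i by (auto simp: layered_def ab)
      qed
    qed
    then have "w \<in> ?x \<or> w \<in> ?y" using w(2) by blast
    then show False
      using piece_meets[OF _ open_interior w(1)] pieces disj by blast
  qed
qed

text \<open>Only the right profile of the piece placed last is carried along. By
  \<open>profiles_match\<close> it fixes the source of the next edge; at the end the flat right half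
  strip forces the wall state.\<close>

lemma row_imp_path:
  "row (as @ layered N A # place s (map shape es) @ [right_half (s + (\<Sum>e\<leftarrow>es. len e))]) \<Longrightarrow>
    right_profile A s (idx q) \<Longrightarrow> idx q + 1 < N \<Longrightarrow> q \<in> insert wall (edge_src ` E \<union> edge_dst ` E) \<Longrightarrow>
    set es \<subseteq> E \<Longrightarrow> es \<in> paths E wall q"
proof (induction es arbitrary: as A s q)
  case Nil
  have "right_half s = layered N (\<lambda>_. {s..})" using N_pos by (simp add: layered_const right_half_def)
  moreover have "left_profile (\<lambda>_. {s..}) s 0"
    unfolding left_profile_def by (intro exI[of _ "s + \<delta> + 1"]) auto
  ultimately have "idx wall = idx q"
    using profiles_match[of as A "\<lambda>_. {s..}" "[]" s "idx q" 0] Nil N_pos by (simp add: idx_wall)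
  then have "q = wall" using idx_inj Nil by (metis inj_on_def insertI1)
  then show ?case by simp
next
  case (Cons e es)
  then have e: "e \<in> E" by simp
  let ?B = "\<lambda>b. {s + left_end e b .. s + len e + bump (idx (edge_dst e)) b}"
  have "left_profile ?B s (idx (edge_src e))"
    unfolding left_profile_def
  proof (intro exI[of _ "s + len e"] conjI allI impI)
    show "s + \<delta> < s + len e" using \<delta>_less[OF e] by simp
    fix b
    show "?B b \<inter> {..s + len e} = {s + left_end e b..s + len e}"
      using bump_bounds(1)[of "idx (edge_dst e)" b] by auto
  qed
  moreover have row: "row (as @ layered N A # layered N ?B # place (s + len e) (map shape es)
      @ [right_half (s + len e + (\<Sum>e\<leftarrow>es. len e))])"
    using Cons.prems(1) by (simp add: shift_shape width_shape[OF e] add.assoc)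
  ultimately have "idx (edge_src e) = idx q"
    using profiles_match Cons.prems(2,3) idx_less(1)[OF e] by blast
  then have "edge_src e = q"
    using idx_inj Cons.prems(4) e by (metis (no_types, lifting) UnCI image_eqI inj_on_def insertCI)
  moreover have "right_profile ?B (s + len e) (idx (edge_dst e))"
    unfolding right_profile_def
  proof (intro exI[of _ "s + \<delta>"] conjI allI impI)
    show "s + \<delta> < s + len e" using \<delta>_less[OF e] by simp
    fix b
    show "?B b \<inter> {s + \<delta>..} = {s + \<delta>..s + len e + bump (idx (edge_dst e)) b}"
      using bump_bounds(2)[of "idx (edge_src e)" b] by auto
  qed
  then have "es \<in> paths E wall (edge_dst e)"
    using Cons.IH[of "as @ [layered N A]" ?B "s + len e" "edge_dst e"] row idx_less(2)[OF e]
      Cons.prems(5) e by simp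
  ultimately show ?case using e by simp
qed

lemma tile_count_paths:
  assumes "0 < \<epsilon>"
  shows "tile_count (shape ` E) \<epsilon> n = card {es \<in> paths E wall wall. (\<Sum>e\<leftarrow>es. len e) = real n + \<epsilon>}"
proof -
  let ?a = "real n + \<epsilon>"
  let ?P = "{es \<in> paths E wall wall. (\<Sum>e\<leftarrow>es. len e) = ?a}" and ?W = "tiling_words (shape ` E) ?a"
  have T0: "{t \<in> norm_tile ` shape ` E. prototile t} = shape ` E"
    using norm_tile_shape prototile_shape by (auto simp: image_iff)
  have sumw: "(\<Sum>t\<leftarrow>map shape es. width t) = (\<Sum>e\<leftarrow>es. len e)" if "set es \<subseteq> E" for es
    using that by (induction es) (auto simp: width_shape)
  have half: "left_half 0 = layered N (\<lambda>_. {..0})" using N_pos by (simp add: layered_const left_half_def)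
  have prof: "right_profile (\<lambda>_. {..0}) 0 (idx wall)"
    unfolding right_profile_def idx_wall by (intro exI[of _ "-1"]) auto
  have iff: "row (left_half 0 # place 0 (map shape es) @ [right_half ?a]) \<longleftrightarrow> es \<in> paths E wall wall"
    if es: "set es \<subseteq> E" "(\<Sum>e\<leftarrow>es. len e) = ?a" for es
  proof
    assume "row (left_half 0 # place 0 (map shape es) @ [right_half ?a])"
    then show "es \<in> paths E wall wall"
      using row_imp_path[of "[]" "\<lambda>_. {..0}" 0 es wall] prof es N_pos by (simp add: half idx_wall)
  next
    assume "es \<in> paths E wall wall"
    then show "row (left_half 0 # place 0 (map shape es) @ [right_half ?a])"
      using path_imp_row[of "[left_half 0]" 0 wall es wall] row_halves[of 0] es
      by (simp add: idx_wall rest_0)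
  qed
  have sub: "set es \<subseteq> E" if "es \<in> paths E wall wall" for es
    using that by (simp add: paths_def words_def)
  have "bij_betw (map shape) ?P
      ?W"
    unfolding bij_betw_def
  proof
    show "inj_on (map shape) ?P"
    proof (rule inj_onI)
      fix es es'
      assume "es \<in> ?P"
        "es' \<in> ?P" "map shape es = map shape es'"
      moreover from this have "inj_on shape (set es \<union> set es')"
        using sub inj_on_subset[OF shape_inj] by simp
      ultimately show "es = es'" by (simp add: inj_on_map_eq_map)
    qed
    show "map shape ` ?P =
      ?W"
    proof (intro equalityI subsetI)
      fix ws assume "ws \<in> map shape ` ?P"
      then obtain es where "es \<in> paths E wall wall" "(\<Sum>e\<leftarrow>es. len e) = ?a" "ws = map shape es" by auto
      then show "ws \<in> ?W"
        using sub[of es] sumw[of es] iff[of es] by (auto simp: tiling_words_def)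
    next
      fix ws assume ws: "ws \<in> ?W"
      then have "ws \<in> lists (shape ` E)" by (auto simp: tiling_words_def)
      then obtain es where "set es \<subseteq> E" "ws = map shape es" unfolding lists_image by auto
      then show "ws \<in> map shape ` ?P"
        using ws sumw[of es] iff[of es] by (auto simp: tiling_words_def)
    qed
  qed
  moreover have "card {\<P>. tiling (shape ` E) ?a \<P>} =
      card ?W"
    using card_tilings[of "shape ` E" ?a] finite_E tall_tile_shape assms unfolding T0 by simp
  ultimately show ?thesis by (simp add: tile_count_def bij_betw_same_card)
qed

end

section \<open>From path weights to lengths, and the equivalence\<close>

lemma sum_lengths_eq_weight:
  assumes "edge_label ` set es \<subseteq> {0..k}"
  shows "(\<Sum>e\<leftarrow>es. l (edge_label e)) =
    (\<Sum>v\<in>{0..k}. real (expt (\<Sum>e\<leftarrow>es. edge_weight e) v) * l v)"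
  using assms
proof (induction es)
  case (Cons e es)
  have "(\<Sum>v\<in>{0..k}. real (expt (edge_weight e) v) * l v)
      = (\<Sum>v\<in>{0..k}. if v = edge_label e then l v else 0)"
    by (rule sum.cong) (auto simp: edge_weight_def lookup_single when_def)
  also have "\<dots> = l (edge_label e)" using Cons.prems by simp
  finally have "(\<Sum>v\<in>{0..k}. real (expt (edge_weight e) v) * l v) = l (edge_label e)" .
  then show ?case using Cons by (simp add: lookup_add distrib_right sum.distrib)
qed simp

lemma keys_path_weight:
  assumes "edge_label ` set es \<subseteq> {0..k}"
  shows "vars (\<Sum>e\<leftarrow>es. edge_weight e) \<subseteq> {0..k}"
  using assms
proof (induction es)
  case (Cons e es)
  have "vars (edge_weight e) \<subseteq> {0..k}" using Cons.prems by (auto simp: edge_weight_def)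
  then show ?case using Cons keys_add[of "edge_weight e" "\<Sum>e\<leftarrow>es. edge_weight e"] by auto
qed simp

theorem diagonal_tile_count:
  assumes "k \<ge> 1" and F: "F \<in> N_rational k"
  shows "\<exists>T \<epsilon>. finite T \<and> (\<forall>t\<in>T. tall_tile t) \<and> 0 \<le> \<epsilon> \<and>
    (\<forall>n. tile_count T \<epsilon> n = F (diag_monomial k n))"
proof -
  obtain E :: "state edge set" where E: "finite E" "edge_label ` E \<subseteq> {0..k}"
    and FE: "\<And>m. expt m 0 = 0 \<Longrightarrow>
      F m = path_count E (Inr 0) (Inr 0) (Poly_Mapping.single 0 3 + m)"
    using N_rational_path_count[OF F] by blast
  obtain l where l: "\<And>v. 0 < l v" "inj l"
    and len: "\<And>M n. vars M \<subseteq> {0..k} \<Longrightarrow>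
      (\<Sum>v\<in>{0..k}. real (expt M v) * l v) = real n + 3 * l 0 \<longleftrightarrow>
      M = Poly_Mapping.single 0 3 + diag_monomial k n"
    using independent_lengths[OF assms(1)] by blast
  define w :: "state" where "w = Inr 0"
  define S where "S = insert w (edge_src ` E \<union> edge_dst ` E)"
  have "finite S" using E(1) by (simp add: S_def)
  then obtain h :: "state \<Rightarrow> nat" where h: "inj_on h S"
    using finite_imp_inj_to_nat_seg by blast
  \<comment> \<open>The wall must have index 0, so the numbering of the other states is moved up by
    one.\<close>
  define idx where "idx q = (if q = w then 0 else Suc (h q))" for q
  \<comment> \<open>The summand 2 leaves a flat level above the highest bump.\<close>
  define N where "N = Max (idx ` S) + 2"
  \<comment> \<open>Half of the minimum makes the inequality strict; the inserted 1 covers an empty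
    \<open>E\<close>.\<close>
  define \<delta> where "\<delta> = Min (insert 1 (l ` edge_label ` E)) / 2"
  have idx: "idx q + 1 < N" if "q \<in> S" for q
  proof -
    have "idx q \<le> Max (idx ` S)" using \<open>finite S\<close> that by (intro Max_ge) auto
    then show ?thesis by (simp add: N_def)
  qed
  have min: "0 < Min (insert 1 (l ` edge_label ` E))" using E(1) l(1) by simp
  interpret jigsaw E w idx l N \<delta>
  proof
    show "inj_on idx (insert w (edge_src ` E \<union> edge_dst ` E))"
      using h unfolding S_def[symmetric] by (auto simp: inj_on_def idx_def)
    show "\<delta> > 0" using min by (simp add: \<delta>_def)
    fix e assume e: "e \<in> E"
    then have "edge_src e \<in> S" "edge_dst e \<in> S" by (auto simp: S_def)
    then show "idx (edge_src e) + 1 < N" "idx (edge_dst e) + 1 < N"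
      using idx[of "edge_src e"] idx[of "edge_dst e"] by auto
    have "Min (insert 1 (l ` edge_label ` E)) \<le> l (edge_label e)" using E(1) e by (intro Min_le) auto
    then show "\<delta> < l (edge_label e)" using min by (simp add: \<delta>_def)
  qed (use E l(2) in \<open>auto simp: idx_def N_def\<close>)
  \<comment> \<open>The extra length \<open>3 * l 0\<close> is that of the three marks read in one
    round.\<close>
  have "tile_count (shape ` E) (3 * l 0) n = F (diag_monomial k n)" for n
  proof -
    have "(\<Sum>e\<leftarrow>es. l (edge_label e)) = real n + 3 * l 0 \<longleftrightarrow>
        (\<Sum>e\<leftarrow>es. edge_weight e) = Poly_Mapping.single 0 3 + diag_monomial k n"
      if "es \<in> paths E w w" for es
    proof -
      have "edge_label ` set es \<subseteq> {0..k}" using that E(2) by (auto simp: paths_def words_def)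
      then show ?thesis by (simp only: sum_lengths_eq_weight len[OF keys_path_weight])
    qed
    then have "{es \<in> paths E w w. (\<Sum>e\<leftarrow>es. l (edge_label e)) = real n + 3 * l 0} =
        {es \<in> paths E w w. (\<Sum>e\<leftarrow>es. edge_weight e) = Poly_Mapping.single 0 3 + diag_monomial k n}"
      by blast
    moreover have "expt (diag_monomial k n) 0 = 0"
      by (simp add: diag_monomial_def lookup_sum_single)
    ultimately show ?thesis
      using tile_count_paths[of "3 * l 0" n] l(1)[of 0] FE by (simp add: path_count_def w_def)
  qed
  then show ?thesis
    using finite_E tall_tile_shape l(1)[of 0]
    by (intro exI[of _ "shape ` E"] exI[of _ "3 * l 0"]) auto
qed

theorem theorem1p2:
  fixes f :: "nat \<Rightarrow> nat"
  shows "f \<in> tile_counting_functions \<longleftrightarrow>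
    (\<exists>k\<ge>1. \<exists>F\<in>N_rational k. \<forall>n. f n = F (diag_monomial k n))"
proof
  assume "f \<in> tile_counting_functions"
  then show "\<exists>k\<ge>1. \<exists>F\<in>N_rational k. \<forall>n. f n = F (diag_monomial k n)"
    using tile_count_diagonal by (auto simp: tile_counting_functions_def)
next
  assume "\<exists>k\<ge>1. \<exists>F\<in>N_rational k. \<forall>n. f n = F (diag_monomial k n)"
  then obtain k F where kF: "k \<ge> 1" "F \<in> N_rational k" "\<forall>n. f n = F (diag_monomial k n)" by blast
  from diagonal_tile_count[OF kF(1,2)] obtain T \<epsilon> where
    T: "finite T" "\<forall>t\<in>T. tall_tile t" "0 \<le> \<epsilon>" "\<forall>n. tile_count T \<epsilon> n = F (diag_monomial k n)"
    by blast
  then have "f = tile_count T \<epsilon>" using kF(3) by auto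
  then show "f \<in> tile_counting_functions" using T by (auto simp: tile_counting_functions_def)
qed

end
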